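(* Let $\mu$ be a Borel measure on $\mathbb{R}^n$ and $(s_t)_{t>0}$ kernels satisfying the standing assumptions (power bound, size and continuity). If $\mu$ is doubling and the conical square function $S$ is of weak type $(1,1)$ with respect to $\mu$, then for any $p\in(1,\infty)$ there holds $$\|Sf\|_{L^p(w)}\lesssim_{n,p}[w]_{A_p}^{\max\left(\frac12,\frac1{p-1}\right)}\|f\|_{L^p(w)}$$ for every weight $w$ with $[w]_{A_p}<\infty$ and every $f\in L^p(w)$, where $$[w]_{A_p}=\sup_Q\left(\frac{1}{\mu(Q)}\int_Q w\,d\mu\right)\left(\frac1{\mu(Q)}\int_Q w^{-\frac1{p-1}}\,d\mu\right)^{p-1},$$ the supremum being over all cubes $Q\subset\mathbb{R}^n$.
   Context: Standing assumptions: fix $n\ge 1$, $m>0$, $\alpha>0$. The Borel measure $\mu$ on $\mathbb{R}^n$ satisfies $\mu(B(x,r))\lesssim r^m$ for all $x\in\mathbb{R}^n$, $r>0$. The (measurable, complex-valued) kernels $s_t(x,y)$, $t>0$, satisfy $|s_t(x,y)|\lesssim \frac{t^\alpha}{(t+|x-y|)^{m+\alpha}}$ for all $x,y$, and $|s_t(x,y)-s_t(x,z)|\lesssim\frac{|y-z|^\alpha}{(t+|x-y|)^{m+\alpha}}$ whenever $|y-z|<t/2$. No regularity in the first variable is assumed. Set $\theta_tf(x)=\int_{\mathbb{R}^n}s_t(x,y)f(y)\,d\mu(y)$ and $$Sf(x)=\left(\iint_{\Gamma(x)}|\theta_tf(y)|^2\,\frac{d\mu(y)\,dt}{t^{m+1}}\right)^{1/2},\qquad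 \Gamma(x)=\{(y,t)\in\mathbb{R}^n\times(0,\infty):|x-y|<t\}.$$ $\mu$ doubling means $\mu(B(x,2r))\lesssim\mu(B(x,r))$ for all $x\in\mathbb{R}^n$, $r>0$ (with $\mu\neq0$). Weak type $(1,1)$ means $S:L^1(\mu)\to L^{1,\infty}(\mu)$ boundedly. A weight is a nonnegative locally $\mu$-integrable function $w$, and $\|f\|_{L^p(w)}=\left(\int|f|^pw\,d\mu\right)^{1/p}$. The implicit constant in $\lesssim_{n,p}$ depends on $n,p$ and on the fixed data (the constants in the assumptions on $\mu$ and $s_t$, and the weak-type norm of $S$), but not on $w$ or $f$. *)

theory Defs
  imports "HOL-Analysis.Analysis"
begin

text \<open>
  Real powers on \<open>[0, \<infinity>]\<close>, with \<open>0\<close> to a negative power equal to \<open>\<infinity>\<close>. The latter matters for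
  \<open>w powr (-1/(p-1))\<close> in the \<open>A\<^sub>p\<close> characteristic, where the convention \<open>0 powr a = 0\<close> on the reals
  would wrongly admit weights vanishing on sets of positive measure.
\<close>

definition epowr :: "ennreal \<Rightarrow> real \<Rightarrow> ennreal" where
  "epowr x a =
    (if a = 0 then 1
     else if x = 0 then (if a > 0 then 0 else \<infinity>)
     else if x = \<infinity> then (if a > 0 then \<infinity> else 0)
     else ennreal (enn2real x powr a))"

definition power_bound :: "(real^'n) measure \<Rightarrow> real \<Rightarrow> real \<Rightarrow> bool" where
  "power_bound \<mu> m C \<longleftrightarrow> (\<forall>x. \<forall>r>0. emeasure \<mu> (ball x r) \<le> ennreal (C * r powr m))"

definition doubling :: "(real^'n) measure \<Rightarrow> real \<Rightarrow> bool" where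
  "doubling \<mu> C \<longleftrightarrow> emeasure \<mu> UNIV \<noteq> 0 \<and>
    (\<forall>x. \<forall>r>0. emeasure \<mu> (ball x (2 * r)) \<le> ennreal C * emeasure \<mu> (ball x r))"

text \<open>
  Only the values \<open>s t x y\<close> with \<open>t > 0\<close> are relevant. Joint measurability in \<open>(t, x, y)\<close> is what
  makes the double integral in the square function meaningful.
\<close>

definition measurable_kernel :: "(real \<Rightarrow> real^'n \<Rightarrow> real^'n \<Rightarrow> complex) \<Rightarrow> bool" where
  "measurable_kernel s \<longleftrightarrow>
    set_borel_measurable borel ({0<..} \<times> UNIV \<times> UNIV) (\<lambda>(t, x, y). s t x y)"

definition size_condition ::
    "(real \<Rightarrow> real^'n \<Rightarrow> real^'n \<Rightarrow> complex) \<Rightarrow> real \<Rightarrow> real \<Rightarrow> real \<Rightarrow> bool" where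
  "size_condition s m \<alpha> C \<longleftrightarrow>
    (\<forall>t>0. \<forall>x y. norm (s t x y) \<le> C * (t powr \<alpha> / (t + dist x y) powr (m + \<alpha>)))"

definition continuity_condition ::
    "(real \<Rightarrow> real^'n \<Rightarrow> real^'n \<Rightarrow> complex) \<Rightarrow> real \<Rightarrow> real \<Rightarrow> real \<Rightarrow> bool" where
  "continuity_condition s m \<alpha> C \<longleftrightarrow>
    (\<forall>t>0. \<forall>x y z. dist y z < t / 2 \<longrightarrow>
      norm (s t x y - s t x z) \<le> C * (dist y z powr \<alpha> / (t + dist x y) powr (m + \<alpha>)))"

definition theta ::
    "(real^'n) measure \<Rightarrow> (real \<Rightarrow> real^'n \<Rightarrow> real^'n \<Rightarrow> complex) \<Rightarrow> real \<Rightarrow>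
     (real^'n \<Rightarrow> complex) \<Rightarrow> real^'n \<Rightarrow> complex" where
  "theta \<mu> s t f x = (\<integral>y. s t x y * f y \<partial>\<mu>)"

definition upward_cone :: "real^'n \<Rightarrow> ((real^'n) \<times> real) set" where
  "upward_cone x = {(y, t). 0 < t \<and> dist x y < t}"

definition conical_S ::
    "(real^'n) measure \<Rightarrow> real \<Rightarrow> (real \<Rightarrow> real^'n \<Rightarrow> real^'n \<Rightarrow> complex) \<Rightarrow>
     (real^'n \<Rightarrow> complex) \<Rightarrow> real^'n \<Rightarrow> ennreal" where
  "conical_S \<mu> m s f x =
    epowr (\<integral>\<^sup>+ (y, t). ennreal ((norm (theta \<mu> s t f y))\<^sup>2 / t powr (m + 1))
             * indicator (upward_cone x) (y, t) \<partial>(\<mu> \<Otimes>\<^sub>M lborel)) (1 / 2)"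

definition weak_L1_norm :: "'a measure \<Rightarrow> ('a \<Rightarrow> ennreal) \<Rightarrow> ennreal" where
  "weak_L1_norm \<mu> g =
    (SUP l\<in>{0<..}. ennreal l * emeasure \<mu> {x \<in> space \<mu>. ennreal l < g x})"

definition weak_type_1_1 ::
    "'a measure \<Rightarrow> (('a \<Rightarrow> complex) \<Rightarrow> 'a \<Rightarrow> ennreal) \<Rightarrow> real \<Rightarrow> bool" where
  "weak_type_1_1 \<mu> T C \<longleftrightarrow>
    (\<forall>f. integrable \<mu> f \<longrightarrow>
      weak_L1_norm \<mu> (T f) \<le> ennreal C * (\<integral>\<^sup>+ x. ennreal (norm (f x)) \<partial>\<mu>))"

definition is_weight :: "(real^'n) measure \<Rightarrow> (real^'n \<Rightarrow> real) \<Rightarrow> bool" where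
  "is_weight \<mu> w \<longleftrightarrow> w \<in> borel_measurable \<mu> \<and> (\<forall>x. 0 \<le> w x) \<and>
    (\<forall>K. compact K \<longrightarrow> set_integrable \<mu> K w)"

definition Lp_norm ::
    "'a measure \<Rightarrow> ('a \<Rightarrow> real) \<Rightarrow> real \<Rightarrow> ('a \<Rightarrow> ennreal) \<Rightarrow> ennreal" where
  "Lp_norm \<mu> w p g = epowr (\<integral>\<^sup>+ x. epowr (g x) p * ennreal (w x) \<partial>\<mu>) (1 / p)"

definition cubes :: "(real^'n) set set" where
  "cubes = {cbox a (\<chi> i. a $ i + l) | a l. 0 < l}"

definition Ap_char :: "(real^'n) measure \<Rightarrow> real \<Rightarrow> (real^'n \<Rightarrow> real) \<Rightarrow> ennreal" where
  "Ap_char \<mu> p w =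
    (SUP Q\<in>cubes.
      ((\<integral>\<^sup>+ x\<in>Q. ennreal (w x) \<partial>\<mu>) / emeasure \<mu> Q) *
      epowr ((\<integral>\<^sup>+ x\<in>Q. epowr (ennreal (w x)) (- 1 / (p - 1)) \<partial>\<mu>) / emeasure \<mu> Q) (p - 1))"

end

theory Submission
  imports Defs
begin

text \<open>
  The square function is dominated pointwise by averages of \<open>f\<close> over a sparse family of dyadic cubes,
  in the \<open>\<ell>\<^sup>2\<close> sense, and such sparse sums are estimated in \<open>L\<^sup>p(w)\<close> with the right power of the
  characteristic.

  Domination. The cone above \<open>x\<close> is covered by the boxes \<open>3Q \<times> (\<ell>/2, \<ell>]\<close>, where \<open>Q\<close> runs over the
  dyadic cells that contain \<open>x\<close> and \<open>\<ell>\<close> is the side of \<open>Q\<close>. Adding the energies of \<open>\<theta>\<^sub>t f\<close> over these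
  boxes gives a square function that is larger than \<open>S f\<close> and whose summands are constant on cells
  (\<open>Ssq_truncated_le_Dsq\<close>). It still has weak type (1,1), because the wider aperture can be paid for by
  an exceptional set of comparable measure (\<open>change_of_aperture\<close>, \<open>Dsq_weak_type\<close>). For a cell \<open>Q\<close>, the
  part of \<open>f\<close> far from \<open>Q\<close> contributes at scales below \<open>Q\<close> at most a constant times the tail average of
  \<open>Q\<close>, a geometrically weighted sum of the averages of \<open>|f|\<close> over the triples of the ancestors of \<open>Q\<close>
  (\<open>Dsq_tail\<close>). Together with the weak type this bounds the square function at scales below \<open>Q\<close> by the
  tail average of \<open>Q\<close>, except on a bad set that fills at most half of \<open>Q\<close> (\<open>bad_small\<close>). The recursion
  stops at the maximal subcells that consist of bad points. As the summands are constant on cells, one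
  good point in the last cell before stopping controls all summands met so far, which yields a sum over
  the stopping cells (\<open>stopping_domination\<close>). The function is never truncated in this recursion, so no
  constants accumulate. The price is the tails. The bad set also controls averages, hence the
  tail average of a stopping cell consists of averages over boundedly many ancestors and a small multiple
  of the tail average of an earlier stopping cell, and the latter can be absorbed
  (\<open>square_sum_absorption\<close>, \<open>sparse_domination\<close>).

  Weights. Put \<open>r = min 2 (p - 1)\<close>, so that the exponent of the theorem is \<open>1 / r\<close>. Since \<open>r \<le> 2\<close>, the
  \<open>\<ell>\<^sup>2\<close> sum of averages is at most the \<open>\<ell>\<^sup>r\<close> sum. By duality the latter becomes a bilinear form, the
  \<open>A\<^sub>p\<close> condition bounds the coefficient of a cube by \<open>[w] \<sigma>(E)\<^bsup>r/p\<^esup> w(E)\<^bsup>1-r/p\<^esup>\<close> with pairwise disjoint sets \<open>E\<close>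
  (\<open>sparse_coefficient_bound\<close>), and Hoelder's inequality leads to the maximal operators of the two
  measures \<open>\<sigma> d\<mu>\<close> and \<open>w d\<mu>\<close> (\<open>sparse_weighted_bound\<close>). Their norms do not depend on the measure, because
  triples of dyadic cells have a covering property of Besicovitch type (\<open>Besicovitch_selection\<close>,
  \<open>maximal_strong_type\<close>). This is why exactly one factor \<open>[w]\<^bsup>1/r\<^esup>\<close> appears.

  The estimate on a single cell passes to the whole space because \<open>2\<^sup>n\<close> cells around the origin exhaust it
  (\<open>integrable_bound\<close>), and from integrable \<open>f\<close> to all \<open>f \<in> L\<^sup>p(w)\<close> by truncation and Fatou's lemma
  (\<open>weighted_bound\<close>).
\<close>

section \<open>Powers on the extended half-line\<close>

lemma epowr_ennreal: "0 \<le> x \<Longrightarrow> 0 < a \<Longrightarrow> epowr (ennreal x) a = ennreal (x powr a)"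
  by (auto simp: epowr_def)

lemma epowr_ennreal_pos: "0 < x \<Longrightarrow> epowr (ennreal x) a = ennreal (x powr a)"
  by (auto simp: epowr_def)

lemma epowr_0 [simp]: "0 < a \<Longrightarrow> epowr 0 a = 0"
  by (simp add: epowr_def)

lemma epowr_top [simp]: "0 < a \<Longrightarrow> epowr top a = top"
  by (simp add: epowr_def)

lemma epowr_1 [simp]: "epowr x 1 = x"
  by (cases x) (auto simp: epowr_def)

lemma epowr_mono: "x \<le> y \<Longrightarrow> 0 < a \<Longrightarrow> epowr x a \<le> epowr y a"
  by (cases x; cases y) (auto simp: epowr_ennreal top_unique intro!: ennreal_leI powr_mono2)

lemma epowr_mult: "0 < a \<Longrightarrow> epowr (x * y) a = epowr x a * epowr y a"
proof (cases "x = 0 \<or> y = 0")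
  case False
  assume a: "0 < a"
  show ?thesis
  proof (cases x)
    case (real r)
    note x = this
    with False have "0 < r" by auto
    show ?thesis
    proof (cases y)
      case (real s)
      then show ?thesis using x a
        by (simp add: epowr_ennreal powr_mult flip: ennreal_mult)
    next
      case top
      then show ?thesis using x a \<open>0 < r\<close> by (simp add: epowr_ennreal ennreal_mult_top)
    qed
  next
    case top
    then show ?thesis
      using False a by (cases y) (auto simp: epowr_ennreal ennreal_top_mult)
  qed
qed auto

lemma epowr_epowr: "0 < a \<Longrightarrow> 0 < b \<Longrightarrow> epowr (epowr x a) b = epowr x (a * b)"
  by (cases x) (auto simp: epowr_ennreal powr_powr)

lemma epowr_add: "0 < a \<Longrightarrow> 0 < b \<Longrightarrow> epowr x (a + b) = epowr x a * epowr x b"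
  by (cases x) (auto simp: epowr_ennreal powr_add ennreal_mult ennreal_top_mult)

lemma epowr_2: "epowr x 2 = x\<^sup>2"
  using epowr_add[of 1 1 x] by (simp add: power2_eq_square)

lemma epowr_inverse_exponent: "0 < a \<Longrightarrow> epowr (epowr x a) (1 / a) = x"
  by (simp add: epowr_epowr)

lemma measurable_epowr [measurable]: "(\<lambda>x. epowr x a) \<in> borel_measurable borel"
  unfolding epowr_def by measurable

text \<open>Continuity from below comes for free from monotonicity of the inverse power.\<close>

lemma epowr_SUP:
  fixes v :: "nat \<Rightarrow> ennreal"
  assumes a: "0 < a"
  shows "epowr (SUP n. v n) a = (SUP n. epowr (v n) a)"
proof (rule antisym)
  let ?y = "SUP n. epowr (v n) a"
  have "v n \<le> epowr ?y (1 / a)" for n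
  proof -
    have "epowr (epowr (v n) a) (1 / a) \<le> epowr ?y (1 / a)"
      using a by (intro epowr_mono SUP_upper) auto
    then show ?thesis using a by (simp add: epowr_inverse_exponent)
  qed
  then have "(SUP n. v n) \<le> epowr ?y (1 / a)" by (intro SUP_least)
  then have "epowr (SUP n. v n) a \<le> epowr (epowr ?y (1 / a)) a"
    using a by (intro epowr_mono)
  then show "epowr (SUP n. v n) a \<le> ?y" using a by (simp add: epowr_epowr)
next
  show "(SUP n. epowr (v n) a) \<le> epowr (SUP n. v n) a"
    using a by (intro SUP_least epowr_mono SUP_upper) auto
qed

lemma epowr_add_le: "0 < a \<Longrightarrow> epowr (x + y) a \<le> ennreal (2 powr a) * (epowr x a + epowr y a)"
proof -
  assume a: "0 < a"
  have "epowr (x + y) a \<le> epowr (2 * max x y) a"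
    using a by (intro epowr_mono) (auto simp: mult_2 intro!: add_mono)
  also have "\<dots> = ennreal (2 powr a) * epowr (max x y) a"
    using a epowr_ennreal[of 2 a] by (simp add: epowr_mult)
  also have "epowr (max x y) a \<le> epowr x a + epowr y a"
    by (auto simp: max_def)
  finally show ?thesis by (simp add: mult_left_mono)
qed

section \<open>Integral inequalities\<close>

lemma epowr_Young:
  fixes x y :: ennreal and t :: real
  assumes t: "0 < t" "t < 1"
  shows "epowr x t * epowr y (1 - t) \<le> ennreal t * x + ennreal (1 - t) * y"
proof (cases "x = 0 \<or> y = 0 \<or> x = top \<or> y = top")
  case True
  then show ?thesis using t by (auto simp: ennreal_mult_top ennreal_top_mult)
next
  case False
  then obtain a b where ab: "x = ennreal a" "y = ennreal b" "0 < a" "0 < b"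
    by (cases x; cases y) auto
  have "a powr t * b powr (1 - t) \<le> t * a + (1 - t) * b"
    using Youngs_inequality_0[of t "1 - t" a b] t ab by simp
  then show ?thesis using ab t
    by (simp add: epowr_ennreal ennreal_leI flip: ennreal_mult ennreal_plus)
qed

text \<open>In this geometric-mean form no conjugate exponents occur, and the inequality is the Young inequality
  after both integrals have been normalised to one.\<close>

lemma nn_integral_Hoelder:
  fixes f g :: "'a \<Rightarrow> ennreal"
  assumes [measurable]: "f \<in> borel_measurable M" "g \<in> borel_measurable M"
    and t: "0 < t" "t < 1"
  shows "(\<integral>\<^sup>+x. epowr (f x) t * epowr (g x) (1 - t) \<partial>M)
    \<le> epowr (\<integral>\<^sup>+x. f x \<partial>M) t * epowr (\<integral>\<^sup>+x. g x \<partial>M) (1 - t)"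
proof -
  let ?X = "\<integral>\<^sup>+x. f x \<partial>M" and ?Y = "\<integral>\<^sup>+x. g x \<partial>M"
  consider "?X = 0" | "?Y = 0" | "?X \<noteq> 0" "?Y \<noteq> 0" "?X = top \<or> ?Y = top"
    | "?X \<noteq> 0" "?Y \<noteq> 0" "?X \<noteq> top" "?Y \<noteq> top" by blast
  then show ?thesis
  proof cases
    case 1
    then have "AE x in M. f x = 0" by (simp add: nn_integral_0_iff_AE)
    then have "(\<integral>\<^sup>+x. epowr (f x) t * epowr (g x) (1 - t) \<partial>M) = (\<integral>\<^sup>+x. 0 \<partial>M)"
      by (intro nn_integral_cong_AE) (use t in auto)
    then show ?thesis by simp
  next
    case 2
    then have "AE x in M. g x = 0" by (simp add: nn_integral_0_iff_AE)
    then have "(\<integral>\<^sup>+x. epowr (f x) t * epowr (g x) (1 - t) \<partial>M) = (\<integral>\<^sup>+x. 0 \<partial>M)"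
      by (intro nn_integral_cong_AE) (use t in auto)
    then show ?thesis by simp
  next
    case 3
    then have "epowr ?X t * epowr ?Y (1 - t) = top"
      using t by (cases ?X; cases ?Y) (auto simp: epowr_ennreal ennreal_mult_top ennreal_top_mult)
    then show ?thesis by (metis top_greatest)
  next
    case 4
    then obtain X Y where XY: "?X = ennreal X" "?Y = ennreal Y" "0 < X" "0 < Y"
      by (cases ?X; cases ?Y) auto
    define c where "c = ennreal (X powr t * Y powr (1 - t))"
    have "(\<integral>\<^sup>+x. epowr (f x) t * epowr (g x) (1 - t) \<partial>M)
      \<le> (\<integral>\<^sup>+x. c * (ennreal (t / X) * f x + ennreal ((1 - t) / Y) * g x) \<partial>M)"
    proof (rule nn_integral_mono)
      fix x
      have *: "epowr (f x) t = ennreal (X powr t) * epowr (ennreal (1 / X) * f x) t"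
        using XY t by (simp add: epowr_mult epowr_ennreal powr_divide mult.assoc[symmetric]
            flip: ennreal_mult)
      have **: "epowr (g x) (1 - t) = ennreal (Y powr (1 - t)) * epowr (ennreal (1 / Y) * g x) (1 - t)"
        using XY t by (simp add: epowr_mult epowr_ennreal powr_divide mult.assoc[symmetric]
            flip: ennreal_mult)
      have "epowr (f x) t * epowr (g x) (1 - t)
        = c * (epowr (ennreal (1 / X) * f x) t * epowr (ennreal (1 / Y) * g x) (1 - t))"
        unfolding * ** c_def by (simp add: ennreal_mult mult_ac)
      also have "\<dots> \<le> c * (ennreal t * (ennreal (1 / X) * f x) + ennreal (1 - t) * (ennreal (1 / Y) * g x))"
        using t by (intro mult_left_mono epowr_Young) auto
      also have "\<dots> = c * (ennreal (t / X) * f x + ennreal ((1 - t) / Y) * g x)"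
        using t XY by (simp add: mult.assoc[symmetric] flip: ennreal_mult)
      finally show "epowr (f x) t * epowr (g x) (1 - t) \<le> \<dots>" .
    qed
    also have "\<dots> = c * (ennreal (t / X) * ?X + ennreal ((1 - t) / Y) * ?Y)"
      by (simp add: nn_integral_cmult nn_integral_add)
    also have "ennreal (t / X) * ?X + ennreal ((1 - t) / Y) * ?Y = 1"
      using XY t by (simp flip: ennreal_mult ennreal_plus)
    finally have "(\<integral>\<^sup>+x. epowr (f x) t * epowr (g x) (1 - t) \<partial>M) \<le> c" by simp
    also have "c = epowr (ennreal X) t * epowr (ennreal Y) (1 - t)"
      unfolding c_def by (simp only: epowr_ennreal_pos XY(3,4) ennreal_mult powr_ge_zero)
    finally show ?thesis unfolding XY(1,2) .
  qed
qed

lemma sum_Hoelder: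
  fixes f g :: "'a \<Rightarrow> ennreal"
  assumes "finite I" "0 < t" "t < 1"
  shows "(\<Sum>i\<in>I. epowr (f i) t * epowr (g i) (1 - t))
    \<le> epowr (\<Sum>i\<in>I. f i) t * epowr (\<Sum>i\<in>I. g i) (1 - t)"
  using nn_integral_Hoelder[of f "count_space I" g t] assms
  by (simp add: nn_integral_count_space_finite)

lemma epowr_eq_layer_integral:
  fixes x :: ennreal
  assumes a: "0 < a"
  shows "(\<integral>\<^sup>+t. ennreal (a * t powr (a - 1)) * indicator {t. 0 < t \<and> ennreal t < x} t \<partial>lborel) = epowr x a"
proof -
  have fin: "(\<integral>\<^sup>+t. ennreal (a * t powr (a - 1)) * indicator {t. 0 < t \<and> ennreal t < ennreal c} t \<partial>lborel)
      = ennreal (c powr a)" if c: "0 \<le> c" for c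
  proof -
    have I: "((\<lambda>x. a * x powr (a - 1)) has_integral (c powr a)) {0..c}"
      using has_integral_mult_right[OF has_integral_powr_from_0[of "a - 1" c], of a] a c by simp
    define h where "h = (\<lambda>x. if x \<in> {0..c} then a * x powr (a - 1) else 0)"
    have "(h has_integral (c powr a)) UNIV"
      using I unfolding h_def by (simp only: has_integral_restrict_UNIV)
    moreover have "h \<in> borel_measurable borel" unfolding h_def by measurable
    ultimately have "(\<integral>\<^sup>+t. ennreal (h t) \<partial>lborel) = ennreal (c powr a)"
      by (intro nn_integral_has_integral_lborel) (use a in \<open>auto simp: h_def\<close>)
    also have "(\<integral>\<^sup>+t. ennreal (h t) \<partial>lborel)
      = (\<integral>\<^sup>+t. ennreal (a * t powr (a - 1)) * indicator {t. 0 < t \<and> ennreal t < ennreal c} t \<partial>lborel)"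
    proof (rule nn_integral_cong_AE)
      have "AE t in lborel. t \<noteq> (0::real)" "AE t in lborel. t \<noteq> c"
        by (rule AE_lborel_singleton)+
      then show "AE t in lborel. ennreal (h t)
        = ennreal (a * t powr (a - 1)) * indicator {t. 0 < t \<and> ennreal t < ennreal c} t"
        by eventually_elim (use c in \<open>auto simp: h_def indicator_def ennreal_less_iff\<close>)
    qed
    finally show ?thesis .
  qed
  show ?thesis
  proof (cases x)
    case (real c)
    then show ?thesis using fin[of c] a by (simp add: epowr_ennreal)
  next
    case top
    let ?I = "\<integral>\<^sup>+t. ennreal (a * t powr (a - 1)) * indicator {t. 0 < t \<and> ennreal t < x} t \<partial>lborel"
    have "ennreal (real n) \<le> ?I" for n
    proof -
      have "ennreal (real n) = (\<integral>\<^sup>+t. ennreal (a * t powr (a - 1))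
          * indicator {t. 0 < t \<and> ennreal t < ennreal (real n powr (1 / a))} t \<partial>lborel)"
        using fin[of "real n powr (1 / a)"] a by (simp add: powr_powr)
      also have "\<dots> \<le> ?I"
        by (intro nn_integral_mono) (auto simp: indicator_def top)
      finally show ?thesis .
    qed
    then have "?I = top"
      by (metis ennreal_of_nat_eq_real_of_nat ennreal_Ex_less_of_nat leD top.not_eq_extremum)
    then show ?thesis using top a by simp
  qed
qed

text \<open>Tonelli's theorem, applied to the region under the graph of \<open>u\<close>.\<close>

lemma nn_integral_layer_cake:
  assumes "sigma_finite_measure M" and u [measurable]: "u \<in> borel_measurable M" and a: "0 < a"
  shows "(\<integral>\<^sup>+x. epowr (u x) a \<partial>M)
    = (\<integral>\<^sup>+t. ennreal (a * t powr (a - 1)) * indicator {0<..} t * emeasure M {x \<in> space M. ennreal t < u x} \<partial>lborel)"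
proof -
  interpret sigma_finite_measure M by fact
  interpret pair_sigma_finite M lborel ..
  have "(\<integral>\<^sup>+x. epowr (u x) a \<partial>M)
    = (\<integral>\<^sup>+x. (\<integral>\<^sup>+t. ennreal (a * t powr (a - 1)) * indicator {t. 0 < t \<and> ennreal t < u x} t \<partial>lborel) \<partial>M)"
    by (simp add: epowr_eq_layer_integral a)
  also have "\<dots> = (\<integral>\<^sup>+x. (\<integral>\<^sup>+t. ennreal (a * t powr (a - 1)) * indicator {0<..} t
       * indicator {x \<in> space M. ennreal t < u x} x \<partial>lborel) \<partial>M)"
    by (intro nn_integral_cong) (auto simp: indicator_def)
  also have "\<dots> = (\<integral>\<^sup>+t. (\<integral>\<^sup>+x. ennreal (a * t powr (a - 1)) * indicator {0<..} t
       * indicator {x \<in> space M. ennreal t < u x} x \<partial>M) \<partial>lborel)"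
    by (rule Fubini'[symmetric]) measurable
  also have "\<dots> = (\<integral>\<^sup>+t. ennreal (a * t powr (a - 1)) * indicator {0<..} t
       * emeasure M {x \<in> space M. ennreal t < u x} \<partial>lborel)"
    by (intro nn_integral_cong) (simp add: nn_integral_cmult_indicator)
  finally show ?thesis .
qed

text \<open>Marcinkiewicz interpolation between weak type (1,1) and the trivial bound on \<open>L\<^sup>\<infinity>\<close>, in the
  form in which the truncation of \<open>g\<close> at half the height has already been carried out.\<close>

lemma Marcinkiewicz_strong_type:
  assumes M: "sigma_finite_measure M"
    and [measurable]: "u \<in> borel_measurable M" "g \<in> borel_measurable M"
    and p: "1 < p" and C: "0 \<le> C"
    and weak: "\<And>l. 0 < l \<Longrightarrow> ennreal l * emeasure M {x \<in> space M. ennreal l < u x}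
        \<le> ennreal C * (\<integral>\<^sup>+x. g x * indicator {x. ennreal l < 2 * g x} x \<partial>M)"
  shows "(\<integral>\<^sup>+x. epowr (u x) p \<partial>M) \<le> ennreal (C * p / (p - 1) * 2 powr (p - 1)) * (\<integral>\<^sup>+x. epowr (g x) p \<partial>M)"
proof -
  interpret sigma_finite_measure M by fact
  interpret pair_sigma_finite M lborel ..
  define K where "K = C * p / (p - 1)"
  have K: "0 \<le> K" using C p by (simp add: K_def)
  have "(\<integral>\<^sup>+x. epowr (u x) p \<partial>M)
    = (\<integral>\<^sup>+t. ennreal (p * t powr (p - 1)) * indicator {0<..} t * emeasure M {x \<in> space M. ennreal t < u x} \<partial>lborel)"
    by (rule nn_integral_layer_cake) (use M p in auto)
  also have "\<dots> \<le> (\<integral>\<^sup>+t. (\<integral>\<^sup>+x. ennreal (K * ((p - 1) * t powr (p - 1 - 1))) * indicator {0<..} t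
      * (g x * indicator {x. ennreal t < 2 * g x} x) \<partial>M) \<partial>lborel)"
  proof (rule nn_integral_mono)
    fix t :: real
    show "ennreal (p * t powr (p - 1)) * indicator {0<..} t * emeasure M {x \<in> space M. ennreal t < u x}
      \<le> (\<integral>\<^sup>+x. ennreal (K * ((p - 1) * t powr (p - 1 - 1))) * indicator {0<..} t
      * (g x * indicator {x. ennreal t < 2 * g x} x) \<partial>M)"
    proof (cases "0 < t")
      case True
      have "p * t powr (p - 1) = p * t powr (p - 2) * t"
        using True powr_add[of t "p - 2" 1] by simp
      then have "ennreal (p * t powr (p - 1)) * emeasure M {x \<in> space M. ennreal t < u x}
        = ennreal (p * t powr (p - 2)) * (ennreal t * emeasure M {x \<in> space M. ennreal t < u x})"
        using p True by (simp add: ennreal_mult mult.assoc)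
      also have "\<dots> \<le> ennreal (p * t powr (p - 2)) *
          (ennreal C * (\<integral>\<^sup>+x. g x * indicator {x. ennreal t < 2 * g x} x \<partial>M))"
        by (intro mult_left_mono weak True) auto
      also have "\<dots> = ennreal (K * ((p - 1) * t powr (p - 1 - 1)))
          * (\<integral>\<^sup>+x. g x * indicator {x. ennreal t < 2 * g x} x \<partial>M)"
        unfolding mult.assoc[symmetric]
        by (rule arg_cong2[where f = "(*)"], subst ennreal_mult[symmetric])
          (use p C in \<open>auto simp: K_def\<close>)
      also have "\<dots> = (\<integral>\<^sup>+x. ennreal (K * ((p - 1) * t powr (p - 1 - 1)))
          * (g x * indicator {x. ennreal t < 2 * g x} x) \<partial>M)"
        by (rule nn_integral_cmult[symmetric]) measurable
      finally show ?thesis using True by simp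
    qed simp
  qed
  also have "\<dots> = (\<integral>\<^sup>+x. (\<integral>\<^sup>+t. ennreal (K * ((p - 1) * t powr (p - 1 - 1))) * indicator {0<..} t
      * (g x * indicator {x. ennreal t < 2 * g x} x) \<partial>lborel) \<partial>M)"
    by (rule Fubini') measurable
  also have "\<dots> = (\<integral>\<^sup>+x. ennreal K * g x * (\<integral>\<^sup>+t. ennreal ((p - 1) * t powr (p - 1 - 1))
      * indicator {t. 0 < t \<and> ennreal t < 2 * g x} t \<partial>lborel) \<partial>M)"
  proof (rule nn_integral_cong)
    fix x
    have "(\<integral>\<^sup>+t. ennreal (K * ((p - 1) * t powr (p - 1 - 1))) * indicator {0<..} t
      * (g x * indicator {x. ennreal t < 2 * g x} x) \<partial>lborel)
      = (\<integral>\<^sup>+t. (ennreal K * g x) * (ennreal ((p - 1) * t powr (p - 1 - 1))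
      * indicator {t. 0 < t \<and> ennreal t < 2 * g x} t) \<partial>lborel)"
      using K p by (intro nn_integral_cong) (auto simp: indicator_def ennreal_mult mult_ac)
    also have "\<dots> = ennreal K * g x * (\<integral>\<^sup>+t. ennreal ((p - 1) * t powr (p - 1 - 1))
      * indicator {t. 0 < t \<and> ennreal t < 2 * g x} t \<partial>lborel)"
      by (rule nn_integral_cmult) measurable
    finally show "(\<integral>\<^sup>+t. ennreal (K * ((p - 1) * t powr (p - 1 - 1))) * indicator {0<..} t
      * (g x * indicator {x. ennreal t < 2 * g x} x) \<partial>lborel) = \<dots>" .
  qed
  also have "\<dots> = (\<integral>\<^sup>+x. ennreal (K * 2 powr (p - 1)) * epowr (g x) p \<partial>M)"
  proof (rule nn_integral_cong)
    fix x
    have "epowr (2 * g x) (p - 1) = ennreal (2 powr (p - 1)) * epowr (g x) (p - 1)"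
      using p epowr_ennreal[of 2 "p - 1"] by (simp add: epowr_mult)
    moreover have "epowr (g x) p = g x * epowr (g x) (p - 1)"
      using epowr_add[of 1 "p - 1" "g x"] p by simp
    moreover have "(\<integral>\<^sup>+t. ennreal ((p - 1) * t powr (p - 1 - 1))
      * indicator {t. 0 < t \<and> ennreal t < 2 * g x} t \<partial>lborel) = epowr (2 * g x) (p - 1)"
      by (rule epowr_eq_layer_integral) (use p in auto)
    ultimately show "ennreal K * g x * (\<integral>\<^sup>+t. ennreal ((p - 1) * t powr (p - 1 - 1))
      * indicator {t. 0 < t \<and> ennreal t < 2 * g x} t \<partial>lborel) = ennreal (K * 2 powr (p - 1)) * epowr (g x) p"
      using K by (simp only: ennreal_mult powr_ge_zero mult_ac)
  qed
  also have "\<dots> = ennreal (K * 2 powr (p - 1)) * (\<integral>\<^sup>+x. epowr (g x) p \<partial>M)"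
    by (rule nn_integral_cmult) measurable
  finally show ?thesis by (simp add: K_def)
qed

section \<open>Dyadic cells and their triples\<close>

text \<open>Cells of level \<open>k\<close> are half-open with side \<open>2\<^bsup>-k\<^esup>\<close>, and \<open>k\<close> ranges over all integers. A cell is given by
  its level and any of its points, so that the ancestors of a cell are obtained by lowering the level
  alone; a function of the cell is a function of \<open>(k, x)\<close> that depends on \<open>x\<close> through \<open>idx k x\<close> only.\<close>

definition side :: "int \<Rightarrow> real" where
  "side k = 2 powr (- real_of_int k)"

definition idx :: "int \<Rightarrow> real^'n \<Rightarrow> int^'n" where
  "idx k x = (\<chi> i. \<lfloor>x $ i / side k\<rfloor>)"

definition cell :: "int \<Rightarrow> real^'n \<Rightarrow> (real^'n) set" where
  "cell k x = {y. idx k y = idx k x}"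

text \<open>Triples are closed, hence members of \<open>cubes\<close>, to which the \<open>A\<^sub>p\<close> condition applies directly.\<close>

definition triple :: "int \<Rightarrow> real^'n \<Rightarrow> (real^'n) set" where
  "triple k x = cbox (\<chi> i. (real_of_int (idx k x $ i) - 1) * side k) (\<chi> i. (real_of_int (idx k x $ i) + 2) * side k)"

lemma side_pos [simp]: "0 < side k" "0 \<le> side k" "side k \<noteq> 0"
  by (auto simp: side_def)

lemma side_0 [simp]: "side 0 = 1" by (simp add: side_def)

lemma side_minus_nat: "side (k - int j) = side k * 2 ^ j"
  by (simp add: side_def powr_diff powr_realpow powr_minus field_simps)

lemma side_minus_1: "side (k - 1) = 2 * side k"
  using side_minus_nat[of k 1] by simp

lemma side_antimono: "j \<le> k \<Longrightarrow> side k \<le> side j"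
  by (simp add: side_def)

lemma idx_bounds:
  "real_of_int (idx k x $ i) * side k \<le> x $ i"
  "x $ i < (real_of_int (idx k x $ i) + 1) * side k"
  by (simp_all add: idx_def flip: pos_le_divide_eq pos_divide_less_eq)

lemma idx_coarser:
  fixes x y :: "real^'n"
  assumes "idx k x = idx k y" "j \<le> k"
  shows "idx j x = idx j y"
  using assms(2)
proof (induction j rule: int_le_induct)
  case base
  then show ?case by (rule assms)
next
  case (step j)
  have "idx (j - 1) z $ i = idx j z $ i div 2" for z :: "real^'n" and i
  proof -
    have "idx (j - 1) z $ i = \<lfloor>z $ i / side j / real_of_int 2\<rfloor>"
      by (simp add: idx_def side_minus_1 mult.commute)
    also have "\<dots> = idx j z $ i div 2"
      by (subst floor_divide_real_eq_div) (auto simp: idx_def)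
    finally show ?thesis .
  qed
  then show ?case using step.IH by (simp add: vec_eq_iff)
qed

lemma self_in_cell [simp]: "x \<in> cell k x"
  by (simp add: cell_def)

lemma triple_cong: "idx k x = idx k y \<Longrightarrow> triple k x = triple k y"
  by (simp add: triple_def)

lemma cell_cong: "idx k x = idx k y \<Longrightarrow> cell k x = cell k y"
  by (simp add: cell_def)

lemma mem_triple: "y \<in> triple k x \<longleftrightarrow>
    (\<forall>i. (real_of_int (idx k x $ i) - 1) * side k \<le> y $ i \<and> y $ i \<le> (real_of_int (idx k x $ i) + 2) * side k)"
  by (simp add: triple_def mem_box_cart)

lemma cell_mono: "j \<le> k \<Longrightarrow> cell k x \<subseteq> cell j x"
  by (auto simp: cell_def intro: idx_coarser)

lemma mem_triple_of_near:
  assumes "\<And>i. \<bar>y $ i - x $ i\<bar> \<le> side k"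
  shows "y \<in> triple k x"
  unfolding mem_triple
proof
  fix i
  show "(real_of_int (idx k x $ i) - 1) * side k \<le> y $ i \<and> y $ i \<le> (real_of_int (idx k x $ i) + 2) * side k"
    using assms[of i] idx_bounds[where k=k and x=x and i=i] by (simp add: algebra_simps abs_le_iff)
qed

lemma cell_subset_triple: "cell k x \<subseteq> triple k x"
proof
  fix y assume "y \<in> cell k x"
  then have "triple k x = triple k y" by (intro triple_cong) (simp add: cell_def)
  then show "y \<in> triple k x" using mem_triple_of_near[of y y k] by simp
qed

lemma triple_near:
  assumes "y \<in> triple k x" "z \<in> cell k x"
  shows "\<bar>y $ i - z $ i\<bar> \<le> 2 * side k"
proof -
  have "idx k z = idx k x" using assms by (simp add: cell_def)
  then show ?thesis
    using assms(1)[unfolded mem_triple, rule_format, of i] idx_bounds[where k=k and x=z and i=i]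
    by (simp add: algebra_simps abs_le_iff)
qed

lemma triple_mono: 
  assumes "j \<le> k"
  shows "triple k x \<subseteq> triple j x"
proof (cases "j = k")
  case False
  then have "side k \<le> side (j + 1)" using assms by (intro side_antimono) auto
  then have *: "2 * side k \<le> side j" using side_minus_1[of "j + 1"] by simp
  show ?thesis
  proof
    fix y assume "y \<in> triple k x"
    then have "\<bar>y $ i - x $ i\<bar> \<le> side j" for i
      using triple_near[of y k x x i] * by simp
    then show "y \<in> triple j x" by (rule mem_triple_of_near)
  qed
qed simp

lemma side_LIMSEQ_ancestors: "\<exists>j0. \<forall>j\<ge>j0. c \<le> side (k - int j)"
proof -
  obtain n where "c / side k < 2 ^ n" using real_arch_pow[of 2] by auto
  then have "c \<le> side k * 2 ^ j" if "n \<le> j" for j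
  proof -
    have "c / side k \<le> 2 ^ j" using \<open>c / side k < 2 ^ n\<close> power_increasing[OF that, of "2::real"] by linarith
    then show ?thesis by (simp add: field_simps)
  qed
  then show ?thesis by (auto simp: side_minus_nat)
qed

lemma mem_triple_ancestor: "\<exists>j0. \<forall>j\<ge>j0. y \<in> triple (k - int j) x"
proof -
  obtain j0 where j0: "\<forall>j\<ge>j0. norm (y - x) \<le> side (k - int j)" using side_LIMSEQ_ancestors by blast
  have "y \<in> triple (k - int j) x" if "j0 \<le> j" for j
  proof (rule mem_triple_of_near)
    fix i
    show "\<bar>y $ i - x $ i\<bar> \<le> side (k - int j)"
      using component_le_norm_cart[of "y - x" i] j0 that by (auto intro: order_trans)
  qed
  then show ?thesis by blast
qed

lemma measurable_idx [measurable]: "(\<lambda>x. idx k x $ i) \<in> measurable borel (count_space UNIV)"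
  unfolding idx_def by simp measurable

lemma cell_measurable [measurable]: "cell k x \<in> sets borel"
proof -
  have "cell k x = {y \<in> space borel. \<forall>i. idx k y $ i = idx k x $ i}"
    by (auto simp: cell_def vec_eq_iff)
  also have "\<dots> \<in> sets borel" by measurable
  finally show ?thesis .
qed

lemma triple_measurable [measurable]: "triple k x \<in> sets borel"
  by (simp add: triple_def)

lemma triple_in_cubes: "triple k x \<in> cubes"
  unfolding cubes_def triple_def
  by (rule CollectI, rule exI[of _ "\<chi> i. (real_of_int (idx k x $ i) - 1) * side k"], rule exI[of _ "3 * side k"])
    (simp add: algebra_simps vec_eq_iff cong: arg_cong2[where f = cbox])

section \<open>A covering lemma of Besicovitch type and the maximal operator over triples\<close>

text \<open>The covering argument on one coordinate axis: if \<open>z\<close> lies in the triples of two intervals that sit in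
  the same position relative to the grid intervals of \<open>z\<close>, then the shorter interval is contained in the
  triple of the longer one. Each coordinate allows the four positions from \<open>-2\<close> to \<open>1\<close>; the value \<open>-2\<close>
  occurs because triples are closed.\<close>

lemma Besicovitch_coordinate:
  fixes r r' :: int and u u' z y :: real
  assumes u: "0 < u" "u \<le> u'"
    and z: "(real_of_int r - 1) * u \<le> z" "z \<le> (real_of_int r + 2) * u"
      "(real_of_int r' - 1) * u' \<le> z" "z \<le> (real_of_int r' + 2) * u'"
    and code: "r - \<lfloor>z / u\<rfloor> = r' - \<lfloor>z / u'\<rfloor>"
    and y: "real_of_int r * u \<le> y" "y < (real_of_int r + 1) * u"
  shows "(real_of_int r' - 1) * u' \<le> y \<and> y \<le> (real_of_int r' + 2) * u'"
proof -
  define F F' where "F = \<lfloor>z / u\<rfloor>" and "F' = \<lfloor>z / u'\<rfloor>"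
  have "real_of_int F \<le> z / u" "z / u < real_of_int F + 1"
    "real_of_int F' \<le> z / u'" "z / u' < real_of_int F' + 1"
    unfolding F_def F'_def by linarith+
  then have F: "real_of_int F * u \<le> z" "z < (real_of_int F + 1) * u"
    "real_of_int F' * u' \<le> z" "z < (real_of_int F' + 1) * u'"
    using u by (simp_all add: pos_le_divide_eq pos_divide_less_eq)
  have "(real_of_int r - 1) * u < (real_of_int F + 1) * u" "real_of_int F * u \<le> (real_of_int r + 2) * u" using F z by linarith+
  then have "real_of_int r - 1 < real_of_int F + 1" "real_of_int F \<le> real_of_int r + 2" using u by simp_all
  then have "r - F \<in> {-2..1}" by auto
  then have v: "r - F = -2 \<or> r - F = -1 \<or> r - F = 0 \<or> r - F = 1" by auto
  define d where "d = real_of_int (r - F)"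
  have "real_of_int r = real_of_int F + d" "real_of_int r' = real_of_int F' + d"
    using code by (simp_all add: F_def F'_def d_def)
  then have P: "real_of_int r * u = real_of_int F * u + d * u" "real_of_int r' * u' = real_of_int F' * u' + d * u'"
    by (simp_all only: distrib_right)
  have "d = -2 \<or> d = -1 \<or> d = 0 \<or> d = 1" using v by (auto simp: d_def)
  then show ?thesis
  proof (elim disjE)
    assume d: "d = -2"
    show ?thesis using F z y u P unfolding d left_diff_distrib distrib_right
      by (intro conjI) linarith+
  next
    assume d: "d = -1"
    show ?thesis using F z y u P unfolding d left_diff_distrib distrib_right
      by (intro conjI) linarith+
  next
    assume d: "d = 0"
    show ?thesis using F z y u P unfolding d left_diff_distrib distrib_right
      by (intro conjI) linarith+
  next
    assume d: "d = 1"
    show ?thesis using F z y u P unfolding d left_diff_distrib distrib_right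
      by (intro conjI) linarith+
  qed
qed

text \<open>A greedy choice by size leaves cells none of which lies in the triple of a larger one. Two chosen
  triples through the same point \<open>z\<close> therefore differ in their position relative to \<open>z\<close>, and there are
  \<open>4\<^sup>n\<close> positions.\<close>

lemma Besicovitch_selection:
  fixes k :: "'i \<Rightarrow> int" and c :: "'i \<Rightarrow> real^'n"
  assumes "finite I"
  shows "\<exists>G\<subseteq>I. (\<forall>i\<in>I. \<exists>j\<in>G. cell (k i) (c i) \<subseteq> triple (k j) (c j)) \<and>
    (\<forall>z. card {j\<in>G. z \<in> triple (k j) (c j)} \<le> 4 ^ CARD('n))"
proof -
  let ?cell = "\<lambda>i. cell (k i) (c i)" and ?triple = "\<lambda>i. triple (k i) (c i)"
  define sep where "sep = (\<lambda>i j. (k j \<le> k i \<and> \<not> ?cell i \<subseteq> ?triple j) \<or> (k i \<le> k j \<and> \<not> ?cell j \<subseteq> ?triple i))"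
  have "\<exists>G\<subseteq>I. (\<forall>i\<in>I. \<exists>j\<in>G. ?cell i \<subseteq> ?triple j) \<and> (\<forall>i\<in>G. \<forall>j\<in>G. i \<noteq> j \<longrightarrow> sep i j)"
    using assms
  proof (induction "card I" arbitrary: I rule: less_induct)
    case (less I)
    show ?case
    proof (cases "I = {}")
      case False
      \<comment> \<open>greedy choice: a largest cell, and every other cell not yet covered by its triple\<close>
      have "Min (k ` I) \<in> k ` I" using less.prems False by (intro Min_in) auto
      then obtain i0 where i0: "i0 \<in> I" "k i0 = Min (k ` I)" by auto
      then have i0_min: "\<And>i. i \<in> I \<Longrightarrow> k i0 \<le> k i" using less.prems by simp
      let ?I' = "{i\<in>I. \<not> ?cell i \<subseteq> ?triple i0}"
      have "card ?I' < card I"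
        using less.prems by (rule psubset_card_mono) (use i0(1) cell_subset_triple[of "k i0" "c i0"] in blast)
      then obtain G where G: "G \<subseteq> ?I'" "\<forall>i\<in>?I'. \<exists>j\<in>G. ?cell i \<subseteq> ?triple j" "\<forall>i\<in>G. \<forall>j\<in>G. i \<noteq> j \<longrightarrow> sep i j"
        using less.hyps[of ?I'] less.prems by auto
      have "insert i0 G \<subseteq> I" using G i0 by auto
      moreover have "\<forall>i\<in>I. \<exists>j\<in>insert i0 G. ?cell i \<subseteq> ?triple j" using G by auto
      moreover have "\<forall>i\<in>insert i0 G. \<forall>j\<in>insert i0 G. i \<noteq> j \<longrightarrow> sep i j"
        using G i0_min unfolding sep_def by blast
      ultimately show ?thesis by blast
    qed auto
  qed
  then obtain G where G: "G \<subseteq> I" "\<forall>i\<in>I. \<exists>j\<in>G. ?cell i \<subseteq> ?triple j" "\<forall>i\<in>G. \<forall>j\<in>G. i \<noteq> j \<longrightarrow> sep i j"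
    by (elim exE conjE) (rule that)
  have "card {j\<in>G. z \<in> ?triple j} \<le> 4 ^ CARD('n)" for z
  proof -
    define code where "code = (\<lambda>j a. idx (k j) (c j) $ a - idx (k j) z $ a)"
    have code_range: "code j a \<in> {-2..1}" if "z \<in> ?triple j" for j a
    proof -
      have "(real_of_int (idx (k j) (c j) $ a) - 1) * side (k j) \<le> z $ a"
           "z $ a \<le> (real_of_int (idx (k j) (c j) $ a) + 2) * side (k j)"
        using that by (auto simp: mem_triple)
      then have "(real_of_int (idx (k j) (c j) $ a) - 1) * side (k j) < (real_of_int (idx (k j) z $ a) + 1) * side (k j)"
        "real_of_int (idx (k j) z $ a) * side (k j) \<le> (real_of_int (idx (k j) (c j) $ a) + 2) * side (k j)"
        using idx_bounds[where k="k j" and x=z and i=a] by linarith+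
      then have "real_of_int (idx (k j) (c j) $ a) - 1 < real_of_int (idx (k j) z $ a) + 1"
        "real_of_int (idx (k j) z $ a) \<le> real_of_int (idx (k j) (c j) $ a) + 2"
        by simp_all
      then show ?thesis by (auto simp: code_def)
    qed
    have sub: "?cell i \<subseteq> ?triple j"
      if "z \<in> ?triple i" "z \<in> ?triple j" "code i = code j" "k j \<le> k i" for i j
    proof
      fix y assume "y \<in> ?cell i"
      then have y: "idx (k i) y = idx (k i) (c i)" by (simp add: cell_def)
      show "y \<in> ?triple j"
        unfolding mem_triple
      proof
        fix a
        show "(real_of_int (idx (k j) (c j) $ a) - 1) * side (k j) \<le> y $ a \<and>
          y $ a \<le> (real_of_int (idx (k j) (c j) $ a) + 2) * side (k j)"
        proof (rule Besicovitch_coordinate)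
          show "side (k i) \<le> side (k j)" using that by (intro side_antimono)
          show "idx (k i) (c i) $ a - \<lfloor>z $ a / side (k i)\<rfloor> = idx (k j) (c j) $ a - \<lfloor>z $ a / side (k j)\<rfloor>"
            using fun_cong[OF that(3), of a] by (simp add: code_def idx_def)
        qed (use that y idx_bounds[where k="k i" and x=y and i=a] in \<open>auto simp: mem_triple\<close>)
      qed
    qed
    have "inj_on code {j\<in>G. z \<in> ?triple j}"
    proof (rule inj_onI)
      fix i j assume "i \<in> {j\<in>G. z \<in> ?triple j}" "j \<in> {j\<in>G. z \<in> ?triple j}" "code i = code j"
      then show "i = j"
        using G(3) sub[of i j] sub[of j i] unfolding sep_def by auto
    qed
    moreover have "code ` {j\<in>G. z \<in> ?triple j} \<subseteq> (UNIV \<rightarrow>\<^sub>E {-2..1})"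
      using code_range by auto
    moreover have "finite ((UNIV :: 'n set) \<rightarrow>\<^sub>E {-2..1::int})" by (intro finite_PiE) auto
    ultimately have "card {j\<in>G. z \<in> ?triple j} \<le> card ((UNIV :: 'n set) \<rightarrow>\<^sub>E {-2..1::int})"
      by (rule card_inj_on_le)
    also have "\<dots> = 4 ^ CARD('n)" by (subst card_PiE) auto
    finally show ?thesis .
  qed
  then show ?thesis using G(1,2) by (intro exI[of _ G] conjI allI)
qed

text \<open>Bounded overlap gives the weak type (1,1) with a constant that does not depend on the measure.\<close>

lemma maximal_weak_type:
  fixes k :: "'i \<Rightarrow> int" and c :: "'i \<Rightarrow> real^'n"
  assumes [measurable_cong]: "sets \<nu> = sets borel" and I: "finite I"
    and [measurable]: "g \<in> borel_measurable borel"
    and avg: "\<And>i. i \<in> I \<Longrightarrow> l * emeasure \<nu> (triple (k i) (c i)) \<le> (\<integral>\<^sup>+x. g x * indicator (triple (k i) (c i)) x \<partial>\<nu>)"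
  shows "l * emeasure \<nu> (\<Union>i\<in>I. cell (k i) (c i)) \<le> 4 ^ CARD('n) * (\<integral>\<^sup>+x. g x \<partial>\<nu>)"
proof -
  let ?cell = "\<lambda>i. cell (k i) (c i)" and ?triple = "\<lambda>i. triple (k i) (c i)"
  obtain G where G: "G \<subseteq> I" "\<forall>i\<in>I. \<exists>j\<in>G. ?cell i \<subseteq> ?triple j" "\<And>z. card {j\<in>G. z \<in> ?triple j} \<le> 4 ^ CARD('n)"
    using Besicovitch_selection[OF I] by blast
  have finG: "finite G" using G I finite_subset by blast
  have "emeasure \<nu> (\<Union>i\<in>I. ?cell i) \<le> emeasure \<nu> (\<Union>j\<in>G. ?triple j)"
  proof (rule emeasure_mono)
    show "(\<Union>i\<in>I. ?cell i) \<subseteq> (\<Union>j\<in>G. ?triple j)" using G(2) by blast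
  qed (use finG in auto)
  also have "\<dots> \<le> (\<Sum>j\<in>G. emeasure \<nu> (?triple j))"
    using finG by (intro emeasure_subadditive_finite) auto
  finally have "l * emeasure \<nu> (\<Union>i\<in>I. ?cell i) \<le> l * (\<Sum>j\<in>G. emeasure \<nu> (?triple j))"
    by (rule mult_left_mono) simp
  also have "\<dots> = (\<Sum>j\<in>G. l * emeasure \<nu> (?triple j))" by (rule sum_distrib_left)
  also have "\<dots> \<le> (\<Sum>j\<in>G. \<integral>\<^sup>+x. g x * indicator (?triple j) x \<partial>\<nu>)"
    using G by (intro sum_mono avg) auto
  also have "\<dots> = (\<integral>\<^sup>+x. (\<Sum>j\<in>G. g x * indicator (?triple j) x) \<partial>\<nu>)"
    by (rule nn_integral_sum[symmetric]) measurable
  also have "\<dots> \<le> (\<integral>\<^sup>+x. 4 ^ CARD('n) * g x \<partial>\<nu>)"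
  proof (rule nn_integral_mono)
    fix x
    have "(\<Sum>j\<in>G. g x * indicator (?triple j) x) = g x * of_nat (card {j\<in>G. x \<in> ?triple j})"
      using finG by (simp add: sum_distrib_left[symmetric] indicator_def sum.If_cases Int_def)
    also have "\<dots> \<le> g x * of_nat (4 ^ CARD('n))"
      by (intro mult_left_mono of_nat_mono G) auto
    finally show "(\<Sum>j\<in>G. g x * indicator (?triple j) x) \<le> 4 ^ CARD('n) * g x" by (simp add: mult.commute)
  qed
  also have "\<dots> = 4 ^ CARD('n) * (\<integral>\<^sup>+x. g x \<partial>\<nu>)" by (rule nn_integral_cmult) measurable
  finally show ?thesis .
qed

lemma divide_times_cancel_pos: "0 < v \<Longrightarrow> x / ennreal v * ennreal v = x"
  using ennreal_times_divide[of "ennreal v" x "ennreal v"] ennreal_mult_divide_eq[of "ennreal v" x]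
  by (simp add: mult.commute)

lemma ennreal_le_of_add_left_le: "a + b \<le> a + c \<Longrightarrow> a \<noteq> top \<Longrightarrow> b \<le> (c :: ennreal)"
  by (simp add: ennreal_add_left_cancel_le)

definition maximal_op ::
    "(real^'n) measure \<Rightarrow> 'i set \<Rightarrow> ('i \<Rightarrow> int) \<Rightarrow> ('i \<Rightarrow> real^'n) \<Rightarrow> (real^'n \<Rightarrow> ennreal) \<Rightarrow> real^'n \<Rightarrow> ennreal" where
  "maximal_op \<nu> I k c g x = (SUP i\<in>I. (\<integral>\<^sup>+y. g y * indicator (triple (k i) (c i)) y \<partial>\<nu>)
      / emeasure \<nu> (triple (k i) (c i)) * indicator (cell (k i) (c i)) x)"

lemma maximal_op_measurable:
  assumes "countable I"
  shows "maximal_op \<nu> I k c g \<in> borel_measurable borel"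
  unfolding maximal_op_def[abs_def] by (rule borel_measurable_SUP[OF assms]) measurable

definition maximal_const :: "nat \<Rightarrow> real \<Rightarrow> real" where
  "maximal_const n p = 2 * 4 ^ n * p / (p - 1) * 2 powr (p - 1)"

text \<open>Interpolation starts from a bound on each level set by the integral of \<open>g\<close> over \<open>{g > l / 2}\<close>. It comes
  from the weak type bound for the truncation of \<open>g\<close> at half the height, since the truncated part lowers
  the averages by at most \<open>l / 2\<close>.\<close>

lemma maximal_strong_type:
  fixes k :: "'i \<Rightarrow> int" and c :: "'i \<Rightarrow> real^'n"
  assumes sets [measurable_cong]: "sets \<nu> = sets borel" and \<nu>: "sigma_finite_measure \<nu>" and I: "finite I"
    and [measurable]: "g \<in> borel_measurable borel"
    and fin: "\<And>i. i \<in> I \<Longrightarrow> emeasure \<nu> (triple (k i) (c i)) < \<infinity>" and p: "1 < p"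
  shows "(\<integral>\<^sup>+x. epowr (maximal_op \<nu> I k c g x) p \<partial>\<nu>)
    \<le> ennreal (maximal_const CARD('n) p) * (\<integral>\<^sup>+x. epowr (g x) p \<partial>\<nu>)"
  unfolding maximal_const_def
proof (rule Marcinkiewicz_strong_type)
  show "maximal_op \<nu> I k c g \<in> borel_measurable \<nu>"
    using maximal_op_measurable[OF countable_finite[OF I]] by (simp add: measurable_cong_sets[OF sets])
  fix l :: real assume l: "0 < l"
  let ?triple = "\<lambda>i. triple (k i) (c i)"
  let ?g = "\<lambda>x. g x * indicator {x. ennreal l < 2 * g x} x"
  define a where "a = (\<lambda>i. (\<integral>\<^sup>+y. g y * indicator (?triple i) y \<partial>\<nu>) / emeasure \<nu> (?triple i))"
  let ?I = "{i\<in>I. ennreal l < a i}"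
  let ?X = "emeasure \<nu> {x \<in> space \<nu>. ennreal l < maximal_op \<nu> I k c g x}"
  have mop: "maximal_op \<nu> I k c g x = (SUP i\<in>I. a i * indicator (cell (k i) (c i)) x)" for x
    by (simp add: maximal_op_def a_def)
  have "ennreal l < a i * indicator (cell (k i) (c i)) x \<longleftrightarrow> ennreal l < a i \<and> x \<in> cell (k i) (c i)" for i x
    by (cases "x \<in> cell (k i) (c i)") auto
  then have level: "{x \<in> space \<nu>. ennreal l < maximal_op \<nu> I k c g x} = (\<Union>i\<in>?I. cell (k i) (c i))"
    unfolding mop less_SUP_iff sets_eq_imp_space_eq[OF sets] by auto
  have "ennreal (l / 2) * emeasure \<nu> (\<Union>i\<in>?I. cell (k i) (c i)) \<le> 4 ^ CARD('n) * (\<integral>\<^sup>+x. ?g x \<partial>\<nu>)"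
  proof (rule maximal_weak_type)
    fix i assume i: "i \<in> ?I"
    let ?v = "emeasure \<nu> (?triple i)"
    obtain v where v: "?v = ennreal v" "0 \<le> v" using fin[of i] i by (cases ?v) auto
    have ai: "ennreal l < (\<integral>\<^sup>+y. g y * indicator (?triple i) y \<partial>\<nu>) / ?v"
      using i by (simp add: a_def)
    have vpos: "0 < v"
    proof (rule ccontr)
      assume "\<not> 0 < v"
      then have 0: "?v = 0" using v by (simp add: ennreal_neg)
      have "(\<integral>\<^sup>+y. g y * indicator (?triple i) y \<partial>\<nu>) = 0"
        using 0 by (intro nn_integral_null_set) (simp add: null_sets_def)
      then show False using ai 0 by simp
    qed
    have "ennreal l * ?v \<le> (\<integral>\<^sup>+y. g y * indicator (?triple i) y \<partial>\<nu>)"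
    proof -
      have "ennreal l \<le> (\<integral>\<^sup>+y. g y * indicator (?triple i) y \<partial>\<nu>) / ennreal v"
        using ai v by auto
      then have "ennreal l * ennreal v \<le> (\<integral>\<^sup>+y. g y * indicator (?triple i) y \<partial>\<nu>) / ennreal v * ennreal v"
        by (rule mult_right_mono) simp
      also have "(\<integral>\<^sup>+y. g y * indicator (?triple i) y \<partial>\<nu>) / ennreal v * ennreal v
        = (\<integral>\<^sup>+y. g y * indicator (?triple i) y \<partial>\<nu>)"
        using vpos by (intro divide_times_cancel_pos)
      finally show ?thesis unfolding v .
    qed
    also have "\<dots> \<le> (\<integral>\<^sup>+y. ennreal (l / 2) * indicator (?triple i) y + ?g y * indicator (?triple i) y \<partial>\<nu>)"
    proof (rule nn_integral_mono)
      fix y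
      have "g y \<le> ennreal (l / 2)" if "\<not> ennreal l < 2 * g y"
      proof -
        have le: "2 * g y \<le> ennreal l" using that by simp
        show ?thesis
        proof (cases "g y")
          case (real r)
          then show ?thesis using le l by (simp add: ennreal_mult[symmetric] flip: ennreal_numeral)
        next
          case top
          then show ?thesis using le by (simp add: ennreal_mult_top top_unique)
        qed
      qed
      then show "g y * indicator (?triple i) y \<le> ennreal (l / 2) * indicator (?triple i) y + ?g y * indicator (?triple i) y"
        by (auto simp: indicator_def)
    qed
    also have "\<dots> = ennreal (l / 2) * ?v + (\<integral>\<^sup>+y. ?g y * indicator (?triple i) y \<partial>\<nu>)"
      by (subst nn_integral_add) (auto simp: nn_integral_cmult_indicator)
    also have "ennreal l * ?v = ennreal (l / 2) * ?v + ennreal (l / 2) * ?v"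
      by (subst distrib_right[symmetric], subst ennreal_plus[symmetric]) (use l in auto)
    finally show "ennreal (l / 2) * ?v \<le> (\<integral>\<^sup>+y. ?g y * indicator (?triple i) y \<partial>\<nu>)"
      by (rule ennreal_le_of_add_left_le) (simp add: v flip: ennreal_mult'')
  qed (use I sets in auto)
  then have le: "ennreal (l / 2) * ?X \<le> 4 ^ CARD('n) * (\<integral>\<^sup>+x. ?g x \<partial>\<nu>)"
    by (simp only: level)
  have "ennreal l = 2 * ennreal (l / 2)" using l ennreal_mult[of 2 "l / 2"] by simp
  then have "ennreal l * ?X = 2 * ennreal (l / 2) * ?X" by (rule arg_cong[where f = "\<lambda>z. z * ?X"])
  also have "\<dots> = 2 * (ennreal (l / 2) * ?X)" by (rule mult.assoc)
  also have "\<dots> \<le> 2 * (4 ^ CARD('n) * (\<integral>\<^sup>+x. ?g x \<partial>\<nu>))" using le by (rule mult_left_mono) simp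
  also have "\<dots> = ennreal (2 * 4 ^ CARD('n)) * (\<integral>\<^sup>+x. ?g x \<partial>\<nu>)"
  proof -
    have "ennreal (2 * 4 ^ CARD('n)) = ennreal 2 * ennreal (4 ^ CARD('n))" by (rule ennreal_mult) auto
    also have "ennreal (4 ^ CARD('n)) = ennreal 4 ^ CARD('n)" by (rule ennreal_power[symmetric]) auto
    finally have "ennreal (2 * 4 ^ CARD('n)) = 2 * 4 ^ CARD('n)" by (simp only: ennreal_numeral)
    then show ?thesis by (simp only: mult.assoc)
  qed
  finally show "ennreal l * ?X \<le> ennreal (2 * 4 ^ CARD('n)) * (\<integral>\<^sup>+x. ?g x \<partial>\<nu>)" .
qed (use \<nu> p in auto)

section \<open>Sparse families and the sharp weighted bound\<close>

text \<open>On \<open>E i\<close> the maximal operator is at least the \<open>i\<close>-th average, and the sets \<open>E i\<close> are disjoint.\<close>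

lemma Carleson_embedding:
  fixes k :: "'i \<Rightarrow> int" and c :: "'i \<Rightarrow> real^'n"
  assumes sets [measurable_cong]: "sets \<nu> = sets borel" and \<nu>: "sigma_finite_measure \<nu>" and I: "finite I"
    and g [measurable]: "g \<in> borel_measurable borel"
    and fin: "\<And>i. i \<in> I \<Longrightarrow> emeasure \<nu> (triple (k i) (c i)) < \<infinity>" and s: "1 < s"
    and E: "\<And>i. i \<in> I \<Longrightarrow> E i \<in> sets borel" "\<And>i. i \<in> I \<Longrightarrow> E i \<subseteq> cell (k i) (c i)" "disjoint_family_on E I"
  shows "(\<Sum>i\<in>I. epowr ((\<integral>\<^sup>+y. g y * indicator (triple (k i) (c i)) y \<partial>\<nu>) / emeasure \<nu> (triple (k i) (c i))) s
      * emeasure \<nu> (E i)) \<le> ennreal (maximal_const CARD('n) s) * (\<integral>\<^sup>+x. epowr (g x) s \<partial>\<nu>)"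
proof -
  define a where "a = (\<lambda>i. (\<integral>\<^sup>+y. g y * indicator (triple (k i) (c i)) y \<partial>\<nu>) / emeasure \<nu> (triple (k i) (c i)))"
  have "(\<Sum>i\<in>I. epowr (a i) s * emeasure \<nu> (E i)) = (\<Sum>i\<in>I. \<integral>\<^sup>+x. epowr (a i) s * indicator (E i) x \<partial>\<nu>)"
    using E sets by (intro sum.cong refl nn_integral_cmult_indicator[symmetric]) auto
  also have "\<dots> = (\<integral>\<^sup>+x. (\<Sum>i\<in>I. epowr (a i) s * indicator (E i) x) \<partial>\<nu>)"
    using E sets by (intro nn_integral_sum[symmetric]) auto
  also have "\<dots> \<le> (\<integral>\<^sup>+x. epowr (maximal_op \<nu> I k c g x) s \<partial>\<nu>)"
  proof (rule nn_integral_mono)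
    fix x
    show "(\<Sum>i\<in>I. epowr (a i) s * indicator (E i) x) \<le> epowr (maximal_op \<nu> I k c g x) s"
    proof (cases "\<exists>i\<in>I. x \<in> E i")
      case True
      then obtain i where i: "i \<in> I" "x \<in> E i" by blast
      then have "x \<notin> E j" if "j \<in> I" "j \<noteq> i" for j
        using E(3) that unfolding disjoint_family_on_def by blast
      then have "(\<Sum>j\<in>I. epowr (a j) s * indicator (E j) x) = (\<Sum>j\<in>I. if j = i then epowr (a i) s else 0)"
        using i by (intro sum.cong) auto
      also have "\<dots> = epowr (a i) s" using i I by simp
      also have "\<dots> \<le> epowr (maximal_op \<nu> I k c g x) s"
      proof (rule epowr_mono)
        have "x \<in> cell (k i) (c i)" using E(2)[OF i(1)] i(2) by blast
        then have "a i = a i * indicator (cell (k i) (c i)) x" by simp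
        also have "\<dots> \<le> (SUP i\<in>I. a i * indicator (cell (k i) (c i)) x)"
          using i by (intro SUP_upper)
        finally show "a i \<le> maximal_op \<nu> I k c g x"
          by (simp add: maximal_op_def a_def)
      qed (use s in auto)
      finally show ?thesis .
    next
      case False
      then have "(\<Sum>i\<in>I. epowr (a i) s * indicator (E i) x) = 0" by (intro sum.neutral) auto
      then show ?thesis by simp
    qed
  qed
  also have "\<dots> \<le> ennreal (maximal_const CARD('n) s) * (\<integral>\<^sup>+x. epowr (g x) s \<partial>\<nu>)"
    by (rule maximal_strong_type) (use assms in auto)
  finally show ?thesis by (simp add: a_def)
qed

text \<open>Here \<open>W, S, M\<close> are the masses of a cube for \<open>w\<close>, \<open>\<sigma>\<close> and \<open>\<mu>\<close>, and \<open>we, se, e\<close> those of its private part. One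
  factor \<open>A\<close> is spent; what remains is \<open>S\<close> to the power \<open>r - p + 1\<close>, which decreases in \<open>S\<close> and so passes to
  \<open>se\<close>, and \<open>M\<close> to the power \<open>p - r\<close>, which is comparable to a power of \<open>e\<close>. The exponents of \<open>se\<close> then add up
  to \<open>r / p\<close>.\<close>

lemma sparse_coefficient_bound:
  fixes W S M e we se A b p r :: real
  assumes pos: "0 < W" "0 < S" "0 < M" "0 < e" "0 < we" "0 < se" "0 \<le> b" "0 \<le> A"
    and Ap: "W / M * (S / M) powr (p - 1) \<le> A"
    and sparse: "M \<le> b * e" and e: "e \<le> se powr (1 - 1 / p) * we powr (1 / p)" and se: "se \<le> S"
    and r: "0 < r" "r \<le> p - 1"
  shows "(S / M) powr r * W \<le> A * b powr (p - r) * (se powr (r / p) * we powr (1 - r / p))"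
proof -
  have p: "0 < p" "r < p" using r by auto
  have "(S / M) powr r * W = (W / M * (S / M) powr (p - 1)) * ((S / M) powr (r - p + 1) * M)"
    using pos by (simp add: powr_add[symmetric] algebra_simps)
  also have "\<dots> \<le> A * ((S / M) powr (r - p + 1) * M)"
    using Ap pos by (intro mult_right_mono) auto
  also have "(S / M) powr (r - p + 1) * M = S powr (r - p + 1) * M powr (p - r)"
  proof -
    have "M powr (p - r) = M powr (1 - (r - p + 1))" by simp
    also have "\<dots> = M / M powr (r - p + 1)" unfolding powr_diff using pos by simp
    finally show ?thesis using pos by (simp add: powr_divide)
  qed
  also have "\<dots> \<le> se powr (r - p + 1) * (b * (se powr (1 - 1 / p) * we powr (1 / p))) powr (p - r)"
  proof (rule mult_mono)
    show "S powr (r - p + 1) \<le> se powr (r - p + 1)" using pos r se by (intro powr_mono2') auto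
    have "M \<le> b * (se powr (1 - 1 / p) * we powr (1 / p))"
      using sparse mult_left_mono[OF e, of b] pos by linarith
    then show "M powr (p - r) \<le> (b * (se powr (1 - 1 / p) * we powr (1 / p))) powr (p - r)"
      using pos p by (intro powr_mono2) auto
  qed auto
  also have "\<dots> = b powr (p - r) * (se powr (r - p + 1 + (1 - 1 / p) * (p - r)) * we powr (1 / p * (p - r)))"
    using pos by (simp add: powr_mult powr_powr powr_add)
  also have "r - p + 1 + (1 - 1 / p) * (p - r) = r / p" using p by (simp add: field_simps)
  also have "1 / p * (p - r) = 1 - r / p" using p by (simp add: field_simps)
  finally show ?thesis using pos by (simp add: mult_left_mono mult.assoc)
qed

text \<open>Finiteness of \<open>Y\<close> is what allows \<open>Y\<^bsup>1-t\<^esup>\<close> to be divided out.\<close>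

lemma epowr_le_cancel_power:
  fixes Y X :: ennreal
  assumes le: "Y \<le> ennreal K * (epowr X t * epowr Y (1 - t))" and t: "0 < t" "t < 1" and Y: "Y < \<infinity>" and K: "0 \<le> K"
  shows "Y \<le> ennreal (K powr (1 / t)) * X"
proof (cases "Y = 0")
  case False
  then obtain y where y: "Y = ennreal y" "0 < y" using Y by (cases Y) auto
  have "epowr Y t * epowr Y (1 - t) \<le> ennreal K * epowr X t * epowr Y (1 - t)"
    using le epowr_add[of t "1 - t" Y] t by (simp add: mult.assoc)
  moreover have "epowr Y (1 - t) = ennreal (y powr (1 - t))" using y t by (simp add: epowr_ennreal)
  ultimately have "epowr Y t * ennreal (y powr (1 - t)) / ennreal (y powr (1 - t))
      \<le> ennreal K * epowr X t * ennreal (y powr (1 - t)) / ennreal (y powr (1 - t))"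
    by (simp add: divide_right_mono_ennreal)
  then have "epowr Y t \<le> ennreal K * epowr X t"
    using y by (simp add: ennreal_mult_divide_eq)
  then have "epowr (epowr Y t) (1 / t) \<le> epowr (ennreal K * epowr X t) (1 / t)"
    using t by (intro epowr_mono) auto
  then show ?thesis using t K by (simp add: epowr_epowr epowr_mult epowr_ennreal)
qed auto

text \<open>The dual weight \<open>\<sigma> = w\<^bsup>-1/(p-1)\<^esup>\<close> is the one for which \<open>w\<^bsup>1/p\<^esup> \<sigma>\<^bsup>1-1/p\<^esup> = 1\<close>.\<close>

lemma weighted_Hoelder:
  assumes [measurable]: "f \<in> borel_measurable M" "w \<in> borel_measurable M" "T \<in> sets M"
    and wpos: "\<And>x. 0 < w x" and p: "1 < p"
  shows "(\<integral>\<^sup>+x. f x * indicator T x \<partial>M) \<le> epowr (\<integral>\<^sup>+x. epowr (f x) p * ennreal (w x) \<partial>M) (1 / p)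
    * epowr (\<integral>\<^sup>+x. ennreal (w x powr (- 1 / (p - 1))) * indicator T x \<partial>M) (1 - 1 / p)"
proof -
  let ?\<sigma> = "\<lambda>x. w x powr (- 1 / (p - 1))"
  have "(\<integral>\<^sup>+x. f x * indicator T x \<partial>M)
    = (\<integral>\<^sup>+x. epowr (epowr (f x) p * ennreal (w x)) (1 / p) * epowr (ennreal (?\<sigma> x) * indicator T x) (1 - 1 / p) \<partial>M)"
  proof (rule nn_integral_cong)
    fix x
    have "- 1 / (p - 1) * (1 - 1 / p) = - (1 / p)" using p by (simp add: field_simps)
    then have "?\<sigma> x powr (1 - 1 / p) = w x powr (- (1 / p))"
      unfolding powr_powr by (simp only:)
    then have "w x powr (1 / p) * ?\<sigma> x powr (1 - 1 / p) = 1" using wpos[of x] by (simp add: powr_minus)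
    then have one: "ennreal (w x powr (1 / p)) * ennreal (?\<sigma> x powr (1 - 1 / p)) = 1"
      by (simp flip: ennreal_mult)
    have "epowr (epowr (f x) p * ennreal (w x)) (1 / p) = f x * ennreal (w x powr (1 / p))"
      using p wpos[of x] by (simp add: epowr_mult epowr_epowr epowr_ennreal)
    moreover have "epowr (ennreal (?\<sigma> x) * indicator T x) (1 - 1 / p) = ennreal (?\<sigma> x powr (1 - 1 / p)) * indicator T x"
      using p by (cases "x \<in> T") (simp_all add: epowr_ennreal)
    ultimately show "f x * indicator T x = epowr (epowr (f x) p * ennreal (w x)) (1 / p) * epowr (ennreal (?\<sigma> x) * indicator T x) (1 - 1 / p)"
      using arg_cong[OF one, of "\<lambda>z. f x * indicator T x * z"] by (simp only: mult_ac mult_1_right mult_1_left)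
  qed
  also have "\<dots> \<le> epowr (\<integral>\<^sup>+x. epowr (f x) p * ennreal (w x) \<partial>M) (1 / p)
      * epowr (\<integral>\<^sup>+x. ennreal (?\<sigma> x) * indicator T x \<partial>M) (1 - 1 / p)"
    using p by (intro nn_integral_Hoelder) auto
  finally show ?thesis .
qed

lemma Ap_dual_finite:
  fixes W S M :: ennreal
  assumes Ap: "W / M * epowr (S / M) (p - 1) \<le> ennreal A" and W: "0 < W" and M: "M < \<infinity>" and p: "1 < p"
  shows "S < \<infinity>"
proof (rule ccontr)
  assume "\<not> ?thesis"
  then have "S = top" by (simp add: not_less top_unique)
  then have "epowr (S / M) (p - 1) = top" using M p by (simp add: ennreal_top_divide)
  moreover have "W / M \<noteq> 0" using W M by (auto simp: zero_less_iff_neq_zero less_top)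
  ultimately show False using Ap by (simp add: ennreal_mult_top top_unique)
qed

definition sparse_const :: "nat \<Rightarrow> real \<Rightarrow> real \<Rightarrow> real \<Rightarrow> real" where
  "sparse_const n p r b = b powr (p - r) *
     (maximal_const n p powr (r / p) * maximal_const n (p / (p - r)) powr (1 - r / p))"

text \<open>Let \<open>F\<close> be the sum inside the power. With \<open>f = g \<sigma>\<close> each average of \<open>f\<close> is an average of \<open>g\<close> with respect
  to \<open>\<sigma> d\<mu>\<close> times \<open>\<sigma>(3Q)/\<mu>(3Q)\<close>, and pairing \<open>F\<close> with a function \<open>h\<close> produces averages of \<open>h\<close> with respect to
  \<open>w d\<mu>\<close>. The coefficient bound, Hoelder for sums and two Carleson embeddings bound the pairing. The choice
  \<open>h = F\<^bsup>p/r - 1\<^esup>\<close> turns it into the integral to be estimated, which is finite and so can be cancelled.\<close>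

lemma sparse_weighted_bound:
  fixes k :: "'i \<Rightarrow> int" and c :: "'i \<Rightarrow> real^'n" and w :: "real^'n \<Rightarrow> real"
  assumes sets [measurable_cong]: "sets \<mu> = sets borel" and \<mu>: "sigma_finite_measure \<mu>" and I: "finite I"
    and w [measurable]: "w \<in> borel_measurable borel" and wpos: "\<And>x. 0 < w x"
    and Wfin: "\<And>i. i \<in> I \<Longrightarrow> (\<integral>\<^sup>+x. ennreal (w x) * indicator (triple (k i) (c i)) x \<partial>\<mu>) < \<infinity>"
    and \<mu>fin: "\<And>i. i \<in> I \<Longrightarrow> emeasure \<mu> (triple (k i) (c i)) < \<infinity>"
    and \<mu>pos: "\<And>i. i \<in> I \<Longrightarrow> 0 < emeasure \<mu> (triple (k i) (c i))"
    and r: "0 < r" "r \<le> p - 1" and A: "0 \<le> A" and b: "0 \<le> b"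
    and Ap: "\<And>i. i \<in> I \<Longrightarrow> ((\<integral>\<^sup>+x. ennreal (w x) * indicator (triple (k i) (c i)) x \<partial>\<mu>) / emeasure \<mu> (triple (k i) (c i))) *
       epowr ((\<integral>\<^sup>+x. ennreal (w x powr (- 1 / (p - 1))) * indicator (triple (k i) (c i)) x \<partial>\<mu>)
         / emeasure \<mu> (triple (k i) (c i))) (p - 1) \<le> ennreal A"
    and E: "\<And>i. i \<in> I \<Longrightarrow> E i \<in> sets borel" "\<And>i. i \<in> I \<Longrightarrow> E i \<subseteq> cell (k i) (c i)" "disjoint_family_on E I"
    and sparse: "\<And>i. i \<in> I \<Longrightarrow> emeasure \<mu> (triple (k i) (c i)) \<le> ennreal b * emeasure \<mu> (E i)"
    and f [measurable]: "f \<in> borel_measurable borel"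
    and Xfin: "(\<integral>\<^sup>+x. epowr (f x) p * ennreal (w x) \<partial>\<mu>) < \<infinity>"
  shows "(\<integral>\<^sup>+x. epowr (\<Sum>i\<in>I. epowr ((\<integral>\<^sup>+y. f y * indicator (triple (k i) (c i)) y \<partial>\<mu>) / emeasure \<mu> (triple (k i) (c i))) r
        * indicator (cell (k i) (c i)) x) (p / r) * ennreal (w x) \<partial>\<mu>)
     \<le> ennreal ((A * sparse_const CARD('n) p r b) powr (p / r)) * (\<integral>\<^sup>+x. epowr (f x) p * ennreal (w x) \<partial>\<mu>)"
proof -
  let ?T = "\<lambda>i. triple (k i) (c i)" and ?Q = "\<lambda>i. cell (k i) (c i)"
  have p: "1 < p" "r < p" using r by auto
  define \<sigma> where "\<sigma> = (\<lambda>x. w x powr (- 1 / (p - 1)))"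
  have [measurable]: "\<sigma> \<in> borel_measurable borel" unfolding \<sigma>_def by measurable
  have \<sigma>pos: "0 < \<sigma> x" for x using wpos[of x] by (simp add: \<sigma>_def)
  define \<nu>w where "\<nu>w = density \<mu> (\<lambda>x. ennreal (w x))"
  define \<nu>s where "\<nu>s = density \<mu> (\<lambda>x. ennreal (\<sigma> x))"
  have sets_w [measurable_cong]: "sets \<nu>w = sets borel" and sets_s [measurable_cong]: "sets \<nu>s = sets borel"
    by (simp_all add: \<nu>w_def \<nu>s_def sets)
  have sf_w: "sigma_finite_measure \<nu>w" and sf_s: "sigma_finite_measure \<nu>s"
    unfolding \<nu>w_def \<nu>s_def
    by (auto simp: sigma_finite_measure.sigma_finite_iff_density_finite[OF \<mu>])
  have em_w: "emeasure \<nu>w X = (\<integral>\<^sup>+x. ennreal (w x) * indicator X x \<partial>\<mu>)" if "X \<in> sets borel" for X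
    using that by (simp add: \<nu>w_def emeasure_density sets)
  have em_s: "emeasure \<nu>s X = (\<integral>\<^sup>+x. ennreal (\<sigma> x) * indicator X x \<partial>\<mu>)" if "X \<in> sets borel" for X
    using that by (simp add: \<nu>s_def emeasure_density sets)
  have pos_of: "0 < (\<integral>\<^sup>+x. ennreal (v x) * indicator X x \<partial>\<mu>)"
    if "X \<in> sets borel" "0 < emeasure \<mu> X" "v \<in> borel_measurable borel" "\<And>x. 0 < v x" for v and X :: "(real^'n) set"
  proof (rule ccontr)
    assume "\<not> ?thesis"
    then have "AE x in \<mu>. ennreal (v x) * indicator X x = 0"
      using that by (simp add: nn_integral_0_iff_AE)
    then have "AE x in \<mu>. x \<notin> X"
      by eventually_elim (use not_le[THEN iffD2, OF that(4)] in \<open>auto simp: indicator_def ennreal_eq_0_iff split: if_splits\<close>)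
    then have "emeasure \<mu> X = 0"
      using that sets AE_iff_measurable[of X \<mu> "\<lambda>x. x \<notin> X"] by (auto simp: sets_eq_imp_space_eq[OF sets])
    then show False using that by simp
  qed
  have Epos: "0 < emeasure \<mu> (E i)" if "i \<in> I" for i
    using sparse[OF that] \<mu>pos[OF that] by (cases "emeasure \<mu> (E i) = 0") (auto simp: zero_less_iff_neq_zero)
  have ET: "E i \<subseteq> ?T i" if "i \<in> I" for i
    using E(2)[OF that] cell_subset_triple[of "k i" "c i"] by blast
  have Ap': "emeasure \<nu>w (?T i) / emeasure \<mu> (?T i) * epowr (emeasure \<nu>s (?T i) / emeasure \<mu> (?T i)) (p - 1) \<le> ennreal A"
    if "i \<in> I" for i
    using Ap[OF that] by (simp add: em_w em_s \<sigma>_def)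
  have s_fin: "emeasure \<nu>s (?T i) < \<infinity>" if i: "i \<in> I" for i
    using pos_of[OF _ \<mu>pos[OF i] w wpos] p
    by (intro Ap_dual_finite[OF Ap'[OF i] _ \<mu>fin[OF i]]) (auto simp: em_w)
  have w_fin: "emeasure \<nu>w (?T i) < \<infinity>" if i: "i \<in> I" for i
    using Wfin[OF i] em_w[of "?T i"] by simp
  define m G H where "m = (\<lambda>i. \<integral>\<^sup>+y. f y * indicator (?T i) y \<partial>\<mu>)"
    and "G = (\<lambda>i. m i / emeasure \<nu>s (?T i))"
    and "H = (\<lambda>h i. (\<integral>\<^sup>+y. h y * indicator (?T i) y \<partial>\<nu>w) / emeasure \<nu>w (?T i))"
  define F where "F = (\<lambda>x. \<Sum>i\<in>I. epowr (m i / emeasure \<mu> (?T i)) r * indicator (?Q i) x)"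
  have F_meas [measurable]: "F \<in> borel_measurable borel" unfolding F_def by measurable
  let ?X = "\<integral>\<^sup>+x. epowr (f x) p * ennreal (w x) \<partial>\<mu>"
  let ?Y = "\<integral>\<^sup>+x. epowr (F x) (p / r) * ennreal (w x) \<partial>\<mu>"
  have coeff: "epowr (emeasure \<nu>s (?T i) / emeasure \<mu> (?T i)) r * emeasure \<nu>w (?T i)
      \<le> ennreal (A * b powr (p - r)) * (epowr (emeasure \<nu>s (E i)) (r / p) * epowr (emeasure \<nu>w (E i)) (1 - r / p))"
    and pos_s: "0 < emeasure \<nu>s (?T i)" and pos_w: "0 < emeasure \<nu>w (?T i)"
    if i: "i \<in> I" for i
  proof -
    have Ei: "E i \<in> sets borel" using E i by auto
    show ps: "0 < emeasure \<nu>s (?T i)" using pos_of[OF _ \<mu>pos[OF i], of \<sigma>] \<sigma>pos by (simp add: em_s)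
    show pw: "0 < emeasure \<nu>w (?T i)" using pos_of[OF _ \<mu>pos[OF i], of w] wpos by (simp add: em_w)
    have pse: "0 < emeasure \<nu>s (E i)" using pos_of[OF Ei Epos[OF i], of \<sigma>] \<sigma>pos by (simp add: em_s Ei)
    have pwe: "0 < emeasure \<nu>w (E i)" using pos_of[OF Ei Epos[OF i], of w] wpos by (simp add: em_w Ei)
    have "emeasure \<nu>s (E i) \<le> emeasure \<nu>s (?T i)" "emeasure \<nu>w (E i) \<le> emeasure \<nu>w (?T i)"
        "emeasure \<mu> (E i) \<le> emeasure \<mu> (?T i)"
      using ET[OF i] by (auto intro!: emeasure_mono simp: sets sets_w sets_s)
    then obtain S W M e se we where reals: "emeasure \<nu>s (?T i) = ennreal S" "emeasure \<nu>w (?T i) = ennreal W"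
      "emeasure \<mu> (?T i) = ennreal M" "emeasure \<mu> (E i) = ennreal e" "emeasure \<nu>s (E i) = ennreal se"
      "emeasure \<nu>w (E i) = ennreal we" "0 \<le> S" "0 \<le> W" "0 \<le> M" "0 \<le> e" "0 \<le> se" "0 \<le> we" and seS: "se \<le> S"
      using s_fin[OF i] w_fin[OF i] \<mu>fin[OF i]
      by (cases "emeasure \<nu>s (?T i)"; cases "emeasure \<nu>w (?T i)"; cases "emeasure \<mu> (?T i)";
          cases "emeasure \<nu>s (E i)"; cases "emeasure \<nu>w (E i)"; cases "emeasure \<mu> (E i)")
        (auto simp: top_unique)
    have pos: "0 < S" "0 < W" "0 < M" "0 < e" "0 < se" "0 < we"
      using ps pw pse pwe \<mu>pos[OF i] Epos[OF i] unfolding reals by auto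
    have "(S / M) powr r * W \<le> A * b powr (p - r) * (se powr (r / p) * we powr (1 - r / p))"
    proof (rule sparse_coefficient_bound)
      have "ennreal (W / M * (S / M) powr (p - 1)) = ennreal W / ennreal M * epowr (ennreal S / ennreal M) (p - 1)"
        by (subst ennreal_mult) (use pos p in \<open>auto simp: divide_ennreal epowr_ennreal\<close>)
      then have "ennreal (W / M * (S / M) powr (p - 1)) \<le> ennreal A"
        using Ap'[OF i] unfolding reals by simp
      then show "W / M * (S / M) powr (p - 1) \<le> A" using A by simp
      have "ennreal M \<le> ennreal (b * e)" using sparse[OF i] b reals by (simp add: ennreal_mult)
      then show "M \<le> b * e" using b pos by (simp add: ennreal_le_iff)
      have "emeasure \<mu> (E i) = (\<integral>\<^sup>+x. epowr (ennreal (\<sigma> x) * indicator (E i) x) (1 - 1 / p)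
          * epowr (ennreal (w x) * indicator (E i) x) (1 - (1 - 1 / p)) \<partial>\<mu>)"
      proof -
        have "\<sigma> x powr (1 - 1 / p) * w x powr (1 / p) = 1" for x
        proof -
          have "- 1 / (p - 1) * (1 - 1 / p) = - (1 / p)" using p by (simp add: field_simps)
          then have "\<sigma> x powr (1 - 1 / p) = w x powr (- (1 / p))"
            unfolding \<sigma>_def powr_powr by (simp only:)
          then show ?thesis using wpos[of x] by (simp add: powr_minus)
        qed
        then have "epowr (ennreal (\<sigma> x) * indicator (E i) x) (1 - 1 / p)
          * epowr (ennreal (w x) * indicator (E i) x) (1 - (1 - 1 / p)) = indicator (E i) x" for x
          using p \<sigma>pos[of x] wpos[of x] by (auto simp: indicator_def epowr_ennreal simp flip: ennreal_mult)
        then show ?thesis using Ei sets by simp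
      qed
      also have "\<dots> \<le> epowr (\<integral>\<^sup>+x. ennreal (\<sigma> x) * indicator (E i) x \<partial>\<mu>) (1 - 1 / p)
          * epowr (\<integral>\<^sup>+x. ennreal (w x) * indicator (E i) x \<partial>\<mu>) (1 - (1 - 1 / p))"
        using p Ei by (intro nn_integral_Hoelder) auto
      finally have "ennreal e \<le> epowr (ennreal se) (1 - 1 / p) * epowr (ennreal we) (1 / p)"
        unfolding em_s[OF Ei, symmetric] em_w[OF Ei, symmetric] reals by simp
      then show "e \<le> se powr (1 - 1 / p) * we powr (1 / p)"
        using p pos by (simp add: epowr_ennreal flip: ennreal_mult)
    qed (use pos A b seS r in auto)
    then show "epowr (emeasure \<nu>s (?T i) / emeasure \<mu> (?T i)) r * emeasure \<nu>w (?T i)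
      \<le> ennreal (A * b powr (p - r)) * (epowr (emeasure \<nu>s (E i)) (r / p) * epowr (emeasure \<nu>w (E i)) (1 - r / p))"
      unfolding reals using pos A r p
      by (simp add: divide_ennreal epowr_ennreal ennreal_leI flip: ennreal_mult)
  qed
  have form: "(\<Sum>i\<in>I. epowr (m i / emeasure \<mu> (?T i)) r * (\<integral>\<^sup>+y. h y * indicator (?T i) y \<partial>\<nu>w))
     \<le> ennreal (A * sparse_const CARD('n) p r b) * (epowr ?X (r / p)
         * epowr (\<integral>\<^sup>+x. epowr (h x) (p / (p - r)) * ennreal (w x) \<partial>\<mu>) (1 - r / p))"
    if h [measurable]: "h \<in> borel_measurable borel" for h
  proof -
    let ?Z = "\<integral>\<^sup>+x. epowr (h x) (p / (p - r)) * ennreal (w x) \<partial>\<mu>"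
    have "epowr (m i / emeasure \<mu> (?T i)) r * (\<integral>\<^sup>+y. h y * indicator (?T i) y \<partial>\<nu>w)
       \<le> ennreal (A * b powr (p - r)) * (epowr (epowr (G i) p * emeasure \<nu>s (E i)) (r / p)
            * epowr (epowr (H h i) (p / (p - r)) * emeasure \<nu>w (E i)) (1 - r / p))" if i: "i \<in> I" for i
    proof -
      obtain S where S: "emeasure \<nu>s (?T i) = ennreal S" "0 < S"
        using s_fin[OF i] pos_s[OF i] by (cases "emeasure \<nu>s (?T i)") auto
      obtain W where W: "emeasure \<nu>w (?T i) = ennreal W" "0 < W"
        using w_fin[OF i] pos_w[OF i] by (cases "emeasure \<nu>w (?T i)") auto
      have mG: "m i = G i * emeasure \<nu>s (?T i)" using S by (simp add: G_def divide_times_cancel_pos)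
      have "(\<integral>\<^sup>+y. h y * indicator (?T i) y \<partial>\<nu>w) = H h i * emeasure \<nu>w (?T i)"
        using W by (simp add: H_def divide_times_cancel_pos)
      then have "epowr (m i / emeasure \<mu> (?T i)) r * (\<integral>\<^sup>+y. h y * indicator (?T i) y \<partial>\<nu>w)
        = epowr (G i) r * H h i * (epowr (emeasure \<nu>s (?T i) / emeasure \<mu> (?T i)) r * emeasure \<nu>w (?T i))"
        unfolding mG using r by (simp add: epowr_mult mult_ac flip: ennreal_times_divide)
      also have "\<dots> \<le> epowr (G i) r * H h i * (ennreal (A * b powr (p - r)) *
          (epowr (emeasure \<nu>s (E i)) (r / p) * epowr (emeasure \<nu>w (E i)) (1 - r / p)))"
        by (intro mult_left_mono coeff i) simp
      also have "epowr (G i) r = epowr (epowr (G i) p) (r / p)" using r p by (simp add: epowr_epowr)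
      also have "H h i = epowr (epowr (H h i) (p / (p - r))) (1 - r / p)"
      proof -
        have "p / (p - r) * (1 - r / p) = 1" "0 < 1 - r / p" using p r by (simp_all add: field_simps)
        then show ?thesis using p by (simp add: epowr_epowr)
      qed
      also have "epowr (epowr (G i) p) (r / p) * epowr (epowr (H h i) (p / (p - r))) (1 - r / p) *
          (ennreal (A * b powr (p - r)) * (epowr (emeasure \<nu>s (E i)) (r / p) * epowr (emeasure \<nu>w (E i)) (1 - r / p)))
        = ennreal (A * b powr (p - r)) * (epowr (epowr (G i) p * emeasure \<nu>s (E i)) (r / p)
            * epowr (epowr (H h i) (p / (p - r)) * emeasure \<nu>w (E i)) (1 - r / p))"
        using r p by (simp add: epowr_mult mult_ac)
      finally show ?thesis .
    qed
    then have "(\<Sum>i\<in>I. epowr (m i / emeasure \<mu> (?T i)) r * (\<integral>\<^sup>+y. h y * indicator (?T i) y \<partial>\<nu>w))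
      \<le> (\<Sum>i\<in>I. ennreal (A * b powr (p - r)) * (epowr (epowr (G i) p * emeasure \<nu>s (E i)) (r / p)
            * epowr (epowr (H h i) (p / (p - r)) * emeasure \<nu>w (E i)) (1 - r / p)))"
      by (rule sum_mono)
    also have "\<dots> = ennreal (A * b powr (p - r)) * (\<Sum>i\<in>I. epowr (epowr (G i) p * emeasure \<nu>s (E i)) (r / p)
            * epowr (epowr (H h i) (p / (p - r)) * emeasure \<nu>w (E i)) (1 - r / p))"
      by (rule sum_distrib_left[symmetric])
    also have "\<dots> \<le> ennreal (A * b powr (p - r)) * (epowr (\<Sum>i\<in>I. epowr (G i) p * emeasure \<nu>s (E i)) (r / p)
            * epowr (\<Sum>i\<in>I. epowr (H h i) (p / (p - r)) * emeasure \<nu>w (E i)) (1 - r / p))"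
      using I r p by (intro mult_left_mono sum_Hoelder) auto
    also have "\<dots> \<le> ennreal (A * b powr (p - r)) * (epowr (ennreal (maximal_const CARD('n) p) * ?X) (r / p)
            * epowr (ennreal (maximal_const CARD('n) (p / (p - r))) * ?Z) (1 - r / p))"
    proof (intro mult_left_mono mult_mono epowr_mono)
      let ?g = "\<lambda>x. f x * ennreal (1 / \<sigma> x)"
      have cancel: "ennreal (\<sigma> x) * (f x * ennreal (1 / \<sigma> x) * y) = f x * y" for x y
      proof -
        have "ennreal (\<sigma> x) * ennreal (1 / \<sigma> x) = 1"
          using \<sigma>pos[of x] by (simp flip: ennreal_mult)
        moreover have "ennreal (\<sigma> x) * (f x * ennreal (1 / \<sigma> x) * y) = (ennreal (\<sigma> x) * ennreal (1 / \<sigma> x)) * (f x * y)"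
          by (simp only: mult_ac)
        ultimately show ?thesis by simp
      qed
      have "m i = (\<integral>\<^sup>+y. ?g y * indicator (?T i) y \<partial>\<nu>s)" for i
        unfolding m_def \<nu>s_def by (subst nn_integral_density) (auto simp: cancel)
      then have "(\<Sum>i\<in>I. epowr (G i) p * emeasure \<nu>s (E i)) \<le> ennreal (maximal_const CARD('n) p) * (\<integral>\<^sup>+x. epowr (?g x) p \<partial>\<nu>s)"
        unfolding G_def by (simp only:, intro Carleson_embedding) (use I sf_s sets_s s_fin p E in auto)
      also have "(\<integral>\<^sup>+x. epowr (?g x) p \<partial>\<nu>s) = ?X"
      proof -
        have "ennreal (\<sigma> x) * epowr (?g x) p = epowr (f x) p * ennreal (w x)" for x
        proof -
          have "\<sigma> x * (1 / \<sigma> x) powr p = \<sigma> x powr (1 - p)"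
            using \<sigma>pos[of x] by (simp add: powr_diff powr_divide)
          also have "\<dots> = w x powr (- 1 / (p - 1) * (1 - p))" by (simp only: \<sigma>_def powr_powr)
          also have "- 1 / (p - 1) * (1 - p) = 1" using p by (simp add: field_simps)
          finally have "\<sigma> x * (1 / \<sigma> x) powr p = w x" using wpos[of x] by simp
          moreover have "epowr (?g x) p = epowr (f x) p * ennreal ((1 / \<sigma> x) powr p)"
            using p \<sigma>pos[of x] by (simp add: epowr_mult epowr_ennreal)
          ultimately show ?thesis
            using \<sigma>pos[of x] by (metis ennreal_mult' less_eq_real_def mult.left_commute)
        qed
        then show ?thesis unfolding \<nu>s_def by (subst nn_integral_density) auto
      qed
      finally show "(\<Sum>i\<in>I. epowr (G i) p * emeasure \<nu>s (E i)) \<le> ennreal (maximal_const CARD('n) p) * ?X" .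
      have "(\<Sum>i\<in>I. epowr (H h i) (p / (p - r)) * emeasure \<nu>w (E i))
          \<le> ennreal (maximal_const CARD('n) (p / (p - r))) * (\<integral>\<^sup>+x. epowr (h x) (p / (p - r)) \<partial>\<nu>w)"
        unfolding H_def by (intro Carleson_embedding) (use I sf_w sets_w w_fin p r E in auto)
      also have "(\<integral>\<^sup>+x. epowr (h x) (p / (p - r)) \<partial>\<nu>w) = ?Z"
        unfolding \<nu>w_def by (subst nn_integral_density) (auto simp: mult.commute)
      finally show "(\<Sum>i\<in>I. epowr (H h i) (p / (p - r)) * emeasure \<nu>w (E i))
          \<le> ennreal (maximal_const CARD('n) (p / (p - r))) * ?Z" .
    qed (use r p in auto)
    also have "\<dots> = ennreal (A * sparse_const CARD('n) p r b) * (epowr ?X (r / p) * epowr ?Z (1 - r / p))"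
    proof -
      have mc: "0 \<le> maximal_const CARD('n) p" "0 \<le> maximal_const CARD('n) (p / (p - r))"
        using p r by (auto simp: maximal_const_def field_simps)
      have "ennreal (A * sparse_const CARD('n) p r b) = ennreal (A * b powr (p - r)) *
        (ennreal (maximal_const CARD('n) p powr (r / p)) * ennreal (maximal_const CARD('n) (p / (p - r)) powr (1 - r / p)))"
        using A by (simp add: sparse_const_def mult.assoc flip: ennreal_mult)
      then show ?thesis
        using mc r p by (simp add: epowr_mult epowr_ennreal mult_ac)
    qed
    finally show ?thesis .
  qed
  have mfin: "m i < \<infinity>" if i: "i \<in> I" for i
  proof -
    have "m i \<le> epowr ?X (1 / p) * epowr (\<integral>\<^sup>+x. ennreal (\<sigma> x) * indicator (?T i) x \<partial>\<mu>) (1 - 1 / p)"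
      unfolding m_def \<sigma>_def using wpos p by (intro weighted_Hoelder) auto
    also have "\<dots> < \<infinity>"
    proof -
      obtain X where X: "?X = ennreal X" "0 \<le> X" using Xfin by (cases ?X) auto
      obtain S where S: "(\<integral>\<^sup>+x. ennreal (\<sigma> x) * indicator (?T i) x \<partial>\<mu>) = ennreal S" "0 \<le> S"
        using s_fin[OF i] em_s[of "?T i"] by (cases "\<integral>\<^sup>+x. ennreal (\<sigma> x) * indicator (?T i) x \<partial>\<mu>") auto
      show ?thesis unfolding X S using p X S by (simp add: epowr_ennreal flip: ennreal_mult)
    qed
    finally show ?thesis .
  qed
  have Yfin: "?Y < \<infinity>"
  proof -
    define B where "B = (\<Sum>i\<in>I. epowr (m i / emeasure \<mu> (?T i)) r)"
    have "epowr (m i / emeasure \<mu> (?T i)) r < \<infinity>" if i: "i \<in> I" for i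
    proof -
      obtain M where "emeasure \<mu> (?T i) = ennreal M" "0 < M"
        using \<mu>fin[OF i] \<mu>pos[OF i] by (cases "emeasure \<mu> (?T i)") auto
      moreover obtain y where "m i = ennreal y" "0 \<le> y" using mfin[OF i] by (cases "m i") auto
      ultimately show ?thesis using r by (simp add: divide_ennreal epowr_ennreal)
    qed
    then have "B < \<infinity>" unfolding B_def using I by (simp add: less_top)
    then obtain B' where B': "B = ennreal B'" "0 \<le> B'" by (cases B) auto
    have "?Y \<le> (\<integral>\<^sup>+x. epowr B (p / r) * (\<Sum>i\<in>I. ennreal (w x) * indicator (?T i) x) \<partial>\<mu>)"
    proof (rule nn_integral_mono)
      fix x
      show "epowr (F x) (p / r) * ennreal (w x) \<le> epowr B (p / r) * (\<Sum>i\<in>I. ennreal (w x) * indicator (?T i) x)"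
      proof (cases "\<exists>i\<in>I. x \<in> ?Q i")
        case True
        then obtain i where i: "i \<in> I" "x \<in> ?Q i" by blast
        have "F x \<le> B" unfolding F_def B_def by (intro sum_mono) (auto simp: indicator_def)
        then have "epowr (F x) (p / r) \<le> epowr B (p / r)" using r p by (intro epowr_mono) auto
        moreover have "ennreal (w x) \<le> (\<Sum>i\<in>I. ennreal (w x) * indicator (?T i) x)"
        proof -
          have "ennreal (w x) = ennreal (w x) * indicator (?T i) x"
            using i cell_subset_triple[of "k i" "c i"] by auto
          also have "\<dots> \<le> (\<Sum>i\<in>I. ennreal (w x) * indicator (?T i) x)"
            using i I by (intro member_le_sum) auto
          finally show ?thesis .
        qed
        ultimately show ?thesis by (intro mult_mono) auto
      next
        case False
        then have "F x = 0" unfolding F_def by (intro sum.neutral) auto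
        then show ?thesis using r p by simp
      qed
    qed
    also have "\<dots> = epowr B (p / r) * (\<Sum>i\<in>I. emeasure \<nu>w (?T i))"
      by (simp add: nn_integral_cmult nn_integral_sum em_w)
    also have "\<dots> < \<infinity>"
    proof -
      have "(\<Sum>i\<in>I. emeasure \<nu>w (?T i)) < \<infinity>" using w_fin I by (simp add: less_top)
      then show ?thesis using B' r p by (simp add: epowr_ennreal ennreal_mult_less_top)
    qed
    finally show ?thesis .
  qed
  define h where "h = (\<lambda>x. epowr (F x) (p / r - 1))"
  have [measurable]: "h \<in> borel_measurable borel" unfolding h_def by measurable
  have q: "0 < p / r - 1" using r p by (simp add: field_simps)
  have "?Y = (\<integral>\<^sup>+x. F x * h x \<partial>\<nu>w)"
    unfolding \<nu>w_def using epowr_add[of 1 "p / r - 1"] q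
    by (subst nn_integral_density) (auto simp: h_def mult_ac)
  also have "\<dots> = (\<integral>\<^sup>+x. (\<Sum>i\<in>I. epowr (m i / emeasure \<mu> (?T i)) r * (h x * indicator (?Q i) x)) \<partial>\<nu>w)"
    unfolding F_def sum_distrib_right by (simp add: mult_ac)
  also have "\<dots> = (\<Sum>i\<in>I. epowr (m i / emeasure \<mu> (?T i)) r * (\<integral>\<^sup>+x. h x * indicator (?Q i) x \<partial>\<nu>w))"
    by (subst nn_integral_sum) (auto simp: nn_integral_cmult)
  also have "\<dots> \<le> (\<Sum>i\<in>I. epowr (m i / emeasure \<mu> (?T i)) r * (\<integral>\<^sup>+x. h x * indicator (?T i) x \<partial>\<nu>w))"
    by (intro sum_mono mult_left_mono nn_integral_mono mult_left_mono)
      (use cell_subset_triple in \<open>auto simp: indicator_def\<close>)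
  also have "\<dots> \<le> ennreal (A * sparse_const CARD('n) p r b) * (epowr ?X (r / p)
         * epowr (\<integral>\<^sup>+x. epowr (h x) (p / (p - r)) * ennreal (w x) \<partial>\<mu>) (1 - r / p))"
    by (rule form) measurable
  also have "(\<integral>\<^sup>+x. epowr (h x) (p / (p - r)) * ennreal (w x) \<partial>\<mu>) = ?Y"
  proof -
    have "(p / r - 1) * (p / (p - r)) = p / r" using r p by (simp add: field_simps)
    then show ?thesis unfolding h_def using q p by (simp add: epowr_epowr)
  qed
  finally have "?Y \<le> ennreal ((A * sparse_const CARD('n) p r b) powr (1 / (r / p))) * ?X"
    using r p Yfin A by (intro epowr_le_cancel_power) (auto simp: sparse_const_def)
  then show ?thesis by (simp add: F_def m_def)
qed

text \<open>Cells of all levels are countable, and the weak type bound passes to increasing unions.\<close>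

lemma maximal_weak_type_countable:
  fixes k :: "nat \<Rightarrow> int" and c :: "nat \<Rightarrow> real^'n"
  assumes sets [measurable_cong]: "sets \<nu> = sets borel" and g [measurable]: "g \<in> borel_measurable borel"
    and avg: "\<And>i. i \<in> I \<Longrightarrow> l * emeasure \<nu> (triple (k i) (c i)) \<le> (\<integral>\<^sup>+x. g x * indicator (triple (k i) (c i)) x \<partial>\<nu>)"
  shows "l * emeasure \<nu> (\<Union>i\<in>I. cell (k i) (c i)) \<le> 4 ^ CARD('n) * (\<integral>\<^sup>+x. g x \<partial>\<nu>)"
proof -
  let ?U = "\<lambda>N. \<Union>i\<in>I \<inter> {..<N}. cell (k i) (c i)"
  have "(\<Union>i\<in>I. cell (k i) (c i)) = (\<Union>N. ?U N)" by blast
  then have "emeasure \<nu> (\<Union>i\<in>I. cell (k i) (c i)) = emeasure \<nu> (\<Union>N. ?U N)" by (rule arg_cong)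
  also have "emeasure \<nu> (\<Union>N. ?U N) = (SUP N. emeasure \<nu> (?U N))"
    by (rule SUP_emeasure_incseq[symmetric]) (auto simp: incseq_def)
  finally have "l * emeasure \<nu> (\<Union>i\<in>I. cell (k i) (c i)) = l * (SUP N. emeasure \<nu> (?U N))"
    by (rule arg_cong)
  also have "\<dots> = (SUP N. l * emeasure \<nu> (?U N))" by (rule SUP_mult_left_ennreal)
  also have "\<dots> \<le> 4 ^ CARD('n) * (\<integral>\<^sup>+x. g x \<partial>\<nu>)"
    by (intro SUP_least maximal_weak_type) (use sets avg in auto)
  finally show ?thesis .
qed

definition corner :: "int \<Rightarrow> int^'n \<Rightarrow> real^'n" where
  "corner k z = (\<chi> i. real_of_int (z $ i) * side k)"

lemma idx_corner [simp]: "idx k (corner k z) = z"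
  by (simp add: idx_def corner_def vec_eq_iff)

lemma maximal_weak_type_pointwise:
  fixes \<nu> :: "(real^'n) measure" and l :: ennreal and K :: "int set"
  assumes sets [measurable_cong]: "sets \<nu> = sets borel" and g [measurable]: "g \<in> borel_measurable borel"
  defines "U \<equiv> {x. \<exists>k\<in>K. l * emeasure \<nu> (triple k x) \<le> (\<integral>\<^sup>+y. g y * indicator (triple k x) y \<partial>\<nu>)}"
  shows "U \<in> sets borel" "l * emeasure \<nu> U \<le> 4 ^ CARD('n) * (\<integral>\<^sup>+x. g x \<partial>\<nu>)"
proof -
  define e :: "nat \<Rightarrow> int \<times> (int^'n)" where "e = from_nat"
  define k c where "k = (\<lambda>i. fst (e i))" and "c = (\<lambda>i. corner (fst (e i)) (snd (e i)))"
  define I where "I = {i. k i \<in> K \<and> l * emeasure \<nu> (triple (k i) (c i)) \<le> (\<integral>\<^sup>+y. g y * indicator (triple (k i) (c i)) y \<partial>\<nu>)}"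
  have eq: "U = (\<Union>i\<in>I. cell (k i) (c i))"
  proof (intro set_eqI iffI)
    fix x assume "x \<in> U"
    then obtain j where j: "j \<in> K" "l * emeasure \<nu> (triple j x) \<le> (\<integral>\<^sup>+y. g y * indicator (triple j x) y \<partial>\<nu>)"
      unfolding U_def by blast
    define i where "i = to_nat (j, idx j x)"
    have i: "k i = j" "idx j (c i) = idx j x" by (simp_all add: i_def k_def c_def e_def)
    have "triple j (c i) = triple j x" by (rule triple_cong) (rule i(2))
    then have "i \<in> I" using j i by (simp add: I_def)
    moreover have "x \<in> cell (k i) (c i)" using i by (simp add: cell_def)
    ultimately show "x \<in> (\<Union>i\<in>I. cell (k i) (c i))" by blast
  next
    fix x assume "x \<in> (\<Union>i\<in>I. cell (k i) (c i))"
    then obtain i where i: "i \<in> I" "idx (k i) x = idx (k i) (c i)" by (auto simp: cell_def)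
    then have t: "triple (k i) x = triple (k i) (c i)" by (intro triple_cong)
    have "k i \<in> K" "l * emeasure \<nu> (triple (k i) (c i)) \<le> (\<integral>\<^sup>+y. g y * indicator (triple (k i) (c i)) y \<partial>\<nu>)"
      using i(1) by (auto simp: I_def)
    then show "x \<in> U" unfolding U_def by (intro CollectI bexI[of _ "k i"]) (simp_all only: t)
  qed
  show "U \<in> sets borel" unfolding eq by measurable
  show "l * emeasure \<nu> U \<le> 4 ^ CARD('n) * (\<integral>\<^sup>+x. g x \<partial>\<nu>)"
    unfolding eq by (rule maximal_weak_type_countable) (use sets in \<open>auto simp: I_def\<close>)
qed

lemma le_suminf_ennreal: "f j \<le> (\<Sum>j. f j :: ennreal)"
  using sum_le_suminf[of f "{j}"] by simp

lemma measurable_vec_nth [measurable]: "(\<lambda>x :: real^'n. x $ i) \<in> borel_measurable borel"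
  by (rule borel_measurable_nth)

lemma measurable_real_idx [measurable]: "(\<lambda>x. real_of_int (idx k x $ i)) \<in> borel_measurable borel"
  unfolding idx_def by simp

section \<open>The setting and the dyadic square function\<close>

text \<open>The dimension is a numeral parameter \<open>n\<close>, so that every constant below is a function of real numbers and
  of \<open>n\<close> alone and does not involve the measure or the kernels.\<close>

locale conical =
  fixes \<mu> :: "(real^'n) measure" and s :: "real \<Rightarrow> real^'n \<Rightarrow> real^'n \<Rightarrow> complex"
    and m \<alpha> C\<^sub>\<mu> C\<^sub>s C\<^sub>d C\<^sub>w :: real and n :: nat
  assumes sets_mu [measurable_cong]: "sets \<mu> = sets borel"
    and n: "n = CARD('n)" and m: "0 < m" and \<alpha>: "0 < \<alpha>"
    and const_nonneg: "0 \<le> C\<^sub>\<mu>" "0 \<le> C\<^sub>s" "0 \<le> C\<^sub>d" "0 \<le> C\<^sub>w"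
    and power: "power_bound \<mu> m C\<^sub>\<mu>" and kernel: "measurable_kernel s"
    and size: "size_condition s m \<alpha> C\<^sub>s" and doubling: "doubling \<mu> C\<^sub>d"
    and weak_type: "weak_type_1_1 \<mu> (conical_S \<mu> m s) C\<^sub>w"
begin

lemma space_mu [simp]: "space \<mu> = UNIV"
  using sets_eq_imp_space_eq[OF sets_mu] by simp

lemma borel_sets_mu [simp]: "X \<in> sets \<mu> \<longleftrightarrow> X \<in> sets borel"
  by (simp add: sets_mu)

lemma ball_finite: "emeasure \<mu> (ball x r) < \<infinity>"
proof (cases "0 < r")
  case True
  then have "emeasure \<mu> (ball x r) \<le> ennreal (C\<^sub>\<mu> * r powr m)"
    using power unfolding power_bound_def by blast
  then show ?thesis by (simp add: le_less_trans)
qed (simp add: ball_empty)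

lemma ball_pow2: "0 < r \<Longrightarrow> emeasure \<mu> (ball x (2 ^ j * r)) \<le> ennreal (C\<^sub>d ^ j) * emeasure \<mu> (ball x r)"
proof (induction j)
  case (Suc j)
  have "emeasure \<mu> (ball x (2 * (2 ^ j * r))) \<le> ennreal C\<^sub>d * emeasure \<mu> (ball x (2 ^ j * r))"
    using doubling Suc.prems unfolding doubling_def by auto
  also have "\<dots> \<le> ennreal C\<^sub>d * (ennreal (C\<^sub>d ^ j) * emeasure \<mu> (ball x r))"
    using Suc by (intro mult_left_mono) auto
  also have "\<dots> = ennreal (C\<^sub>d ^ Suc j) * emeasure \<mu> (ball x r)"
    using const_nonneg by (simp add: ennreal_mult mult.assoc)
  finally show ?case by (simp add: mult.assoc)
qed simp

lemma ball_pos: "0 < r \<Longrightarrow> 0 < emeasure \<mu> (ball x r)"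
proof (rule ccontr)
  assume r: "0 < r" "\<not> 0 < emeasure \<mu> (ball x r)"
  have "(\<Union>j. ball x (2 ^ j * r)) = UNIV"
  proof -
    have "y \<in> (\<Union>j. ball x (2 ^ j * r))" for y
    proof -
      obtain j where "dist x y / r < 2 ^ j" using real_arch_pow[of 2] by auto
      then show ?thesis using r by (auto simp: field_simps)
    qed
    then show ?thesis by blast
  qed
  moreover have "emeasure \<mu> (ball x (2 ^ j * r)) = 0" for j
    using ball_pow2[of r x j] r by (simp add: zero_less_iff_neq_zero)
  then have "emeasure \<mu> (\<Union>j. ball x (2 ^ j * r)) = 0"
    by (intro emeasure_UN_eq_0) (auto simp: sets_mu)
  ultimately show False using doubling by (simp add: doubling_def)
qed

lemma sigma_finite_mu: "sigma_finite_measure \<mu>"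
proof
  show "\<exists>A. countable A \<and> A \<subseteq> sets \<mu> \<and> \<Union>A = space \<mu> \<and> (\<forall>a\<in>A. emeasure \<mu> a \<noteq> \<infinity>)"
  proof (intro exI conjI)
    let ?A = "range (\<lambda>j::nat. ball 0 (real j) :: (real^'n) set)"
    show "countable ?A" by simp
    show "?A \<subseteq> sets \<mu>" by (auto simp: sets_mu)
    have "x \<in> \<Union>?A" for x
      using reals_Archimedean2[of "norm x"] by auto
    then show "\<Union>?A = space \<mu>" by auto
    show "\<forall>a\<in>?A. emeasure \<mu> a \<noteq> \<infinity>" using ball_finite by (auto simp: less_top)
  qed
qed

sublocale \<mu>: sigma_finite_measure \<mu> by (rule sigma_finite_mu)
sublocale \<mu>L: pair_sigma_finite \<mu> lborel ..
lemma sigma_finite_prod: "sigma_finite_measure (\<mu> \<Otimes>\<^sub>M lborel :: ((real^'n) \<times> real) measure)"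
  by unfold_locales

sublocale \<mu>\<mu>L: pair_sigma_finite \<mu> "\<mu> \<Otimes>\<^sub>M lborel" ..

lemma norm_le_of_coords:
  fixes v :: "real^'n"
  assumes "\<And>i. \<bar>v $ i\<bar> \<le> c"
  shows "norm v \<le> real n * c"
proof -
  have "norm v \<le> (\<Sum>i\<in>UNIV. \<bar>v $ i\<bar>)" by (rule norm_le_l1_cart)
  also have "\<dots> \<le> (\<Sum>i\<in>(UNIV::'n set). c)" using assms by (intro sum_mono)
  finally show ?thesis by (simp add: n)
qed

lemma nat_less_pow2: "real n < 2 ^ n"
  by (rule of_nat_less_two_power)

lemma triple_subset_ball: "triple k (x :: real^'n) \<subseteq> ball x (3 * real n * side k)"
proof
  fix y assume "y \<in> triple k x"
  then have "norm (y - x) \<le> real n * (2 * side k)"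
    by (intro norm_le_of_coords) (use triple_near[of y k x x] in simp)
  also have "\<dots> < 3 * real n * side k" by (simp add: n)
  finally show "y \<in> ball x (3 * real n * side k)" by (simp add: dist_norm norm_minus_commute)
qed

lemma triple_finite: "emeasure \<mu> (triple k x) < \<infinity>"
  using emeasure_mono[OF triple_subset_ball[of k x], of \<mu>] ball_finite by (metis borel_open borel_sets_mu le_less_trans open_ball)

definition triple_power_const where "triple_power_const = C\<^sub>\<mu> * (3 * real n) powr m"

lemma triple_power_const_nonneg: "0 \<le> triple_power_const"
  using const_nonneg by (simp add: triple_power_const_def)

lemma triple_power: "emeasure \<mu> (triple k x) \<le> ennreal (triple_power_const * side k powr m)"
proof -
  have "emeasure \<mu> (triple k x) \<le> emeasure \<mu> (ball x (3 * real n * side k))"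
    by (intro emeasure_mono triple_subset_ball) simp
  also have "\<dots> \<le> ennreal (C\<^sub>\<mu> * (3 * real n * side k) powr m)"
    using power unfolding power_bound_def by (simp add: n)
  finally show ?thesis by (simp add: triple_power_const_def powr_mult mult.assoc)
qed

lemma ball_subset_cell: "\<exists>c. ball c (side k / 2) \<subseteq> cell k (x :: real^'n) \<and> (\<forall>i. \<bar>c $ i - x $ i\<bar> \<le> side k)"
proof (intro exI conjI allI)
  let ?c = "(\<chi> i. (real_of_int (idx k x $ i) + 1 / 2) * side k) :: real^'n"
  show "\<bar>?c $ i - x $ i\<bar> \<le> side k" for i
    using idx_bounds[where k = k and x = x and i = i] by (simp add: algebra_simps abs_le_iff)
  show "ball ?c (side k / 2) \<subseteq> cell k x"
  proof
    fix y assume "y \<in> ball ?c (side k / 2)"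
    then have "norm (y - ?c) < side k / 2" by (simp add: dist_norm norm_minus_commute)
    then have c: "\<bar>y $ i - ?c $ i\<bar> < side k / 2" for i
      using component_le_norm_cart[of "y - ?c" i] by (auto intro: le_less_trans)
    have "\<lfloor>y $ i / side k\<rfloor> = idx k x $ i" for i
    proof (rule floor_unique)
      have "\<bar>y $ i - (real_of_int (idx k x $ i) + 1 / 2) * side k\<bar> < side k / 2" using c[of i] by simp
      then have "\<bar>y $ i - real_of_int (idx k x $ i) * side k - side k / 2\<bar> < side k / 2"
        by (simp add: algebra_simps)
      then have "real_of_int (idx k x $ i) * side k \<le> y $ i" "y $ i < (real_of_int (idx k x $ i) + 1) * side k"
        unfolding distrib_right mult_1_left by linarith+
      then show "real_of_int (idx k x $ i) \<le> y $ i / side k" "y $ i / side k < real_of_int (idx k x $ i) + 1"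
        by (simp_all add: pos_le_divide_eq pos_divide_less_eq)
    qed
    then show "y \<in> cell k x" by (simp add: cell_def vec_eq_iff idx_def)
  qed
qed

definition dbl where "dbl N = C\<^sub>d ^ (N + 3 + n)"

lemma dbl_nonneg: "0 \<le> dbl N" using const_nonneg by (simp add: dbl_def)

text \<open>A cell contains a ball of half its side; \<open>N + 3 + n\<close> doublings of it cover the triple of the \<open>N\<close>-th
  ancestor, because \<open>6 n 2\<^sup>N < 2\<^bsup>N+3+n\<^esup>\<close>.\<close>

lemma triple_le_cell: "emeasure \<mu> (triple (k - int N) x) \<le> ennreal (dbl N) * emeasure \<mu> (cell k x)"
proof -
  obtain c where c: "ball c (side k / 2) \<subseteq> cell k x" "\<And>i. \<bar>c $ i - x $ i\<bar> \<le> side k"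
    using ball_subset_cell by blast
  have "triple (k - int N) x \<subseteq> ball c (2 ^ (N + 3 + n) * (side k / 2))"
  proof
    fix y assume y: "y \<in> triple (k - int N) x"
    have "\<bar>y $ i - c $ i\<bar> \<le> 3 * (2 ^ N * side k)" for i
    proof -
      have "1 * side k \<le> 2 ^ N * side k" by (intro mult_right_mono) auto
      moreover have "\<bar>y $ i - x $ i\<bar> \<le> 2 * (2 ^ N * side k)"
        using triple_near[OF y self_in_cell, of i] by (simp add: side_minus_nat mult.commute)
      ultimately show ?thesis using c(2)[of i] by linarith
    qed
    then have "norm (y - c) \<le> real n * (3 * (2 ^ N * side k))"
      by (intro norm_le_of_coords) simp
    also have "\<dots> < 2 ^ n * (4 * (2 ^ N * side k))"
      by (rule mult_strict_mono) (auto simp: nat_less_pow2)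
    also have "\<dots> = 2 ^ (N + 3 + n) * (side k / 2)" by (simp add: power_add)
    finally show "y \<in> ball c (2 ^ (N + 3 + n) * (side k / 2))" by (simp add: dist_norm norm_minus_commute)
  qed
  then have "emeasure \<mu> (triple (k - int N) x) \<le> emeasure \<mu> (ball c (2 ^ (N + 3 + n) * (side k / 2)))"
    by (intro emeasure_mono) auto
  also have "\<dots> \<le> ennreal (C\<^sub>d ^ (N + 3 + n)) * emeasure \<mu> (ball c (side k / 2))"
    by (rule ball_pow2) simp
  also have "\<dots> \<le> ennreal (dbl N) * emeasure \<mu> (cell k x)"
    unfolding dbl_def by (intro mult_left_mono emeasure_mono c) auto
  finally show ?thesis .
qed

lemma cell_pos: "0 < emeasure \<mu> (cell k x)"
proof -
  obtain c where "ball c (side k / 2) \<subseteq> cell k x" using ball_subset_cell by blast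
  then have "emeasure \<mu> (ball c (side k / 2)) \<le> emeasure \<mu> (cell k x)" by (intro emeasure_mono) auto
  then show ?thesis using ball_pos[of "side k / 2" c] by (auto intro: less_le_trans)
qed

lemma cell_finite: "emeasure \<mu> (cell k x) < \<infinity>"
  using emeasure_mono[OF cell_subset_triple[of k x], of \<mu>] triple_finite[of k x] by (simp add: le_less_trans)

lemma triple_pos: "0 < emeasure \<mu> (triple k x)"
  using emeasure_mono[OF cell_subset_triple[of k x], of \<mu>] cell_pos[of k x] by (simp add: less_le_trans)

definition dens :: "(real^'n \<Rightarrow> complex) \<Rightarrow> (real^'n) \<times> real \<Rightarrow> ennreal" where
  "dens f = (\<lambda>(y, t). ennreal ((norm (theta \<mu> s t f y))\<^sup>2 / t powr (m + 1)) * indicator {0<..} t)"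

lemma theta_measurable:
  assumes [measurable]: "f \<in> borel_measurable borel"
  shows "(\<lambda>(y, t). indicator {0<..} t *\<^sub>R theta \<mu> s t f y) \<in> borel_measurable (\<mu> \<Otimes>\<^sub>M lborel)"
proof -
  define s' where "s' = (\<lambda>p. indicator ({0<..} \<times> UNIV \<times> UNIV) p *\<^sub>R (case p of (t, x, y) \<Rightarrow> s t x y) :: complex)"
  have s': "s' \<in> borel_measurable borel"
    using kernel unfolding measurable_kernel_def set_borel_measurable_def s'_def .
  have "(\<lambda>q. (snd (fst q), fst (fst q), snd q)) \<in> measurable ((\<mu> \<Otimes>\<^sub>M lborel) \<Otimes>\<^sub>M \<mu>) (borel \<Otimes>\<^sub>M (borel \<Otimes>\<^sub>M borel))"
    by measurable
  then have map: "(\<lambda>q. (snd (fst q), fst (fst q), snd q)) \<in> measurable ((\<mu> \<Otimes>\<^sub>M lborel) \<Otimes>\<^sub>M \<mu>) borel"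
    by (simp add: borel_prod)
  have [measurable]: "(\<lambda>q. s' (snd (fst q), fst (fst q), snd q)) \<in> borel_measurable ((\<mu> \<Otimes>\<^sub>M lborel) \<Otimes>\<^sub>M \<mu>)"
    by (rule measurable_compose[OF map s'])
  have "(\<lambda>p. \<integral>z. s' (snd p, fst p, z) * f z \<partial>\<mu>) \<in> borel_measurable (\<mu> \<Otimes>\<^sub>M lborel)"
    by (rule \<mu>.borel_measurable_lebesgue_integral) (simp add: case_prod_beta', measurable)
  moreover have "(\<lambda>p. \<integral>z. s' (snd p, fst p, z) * f z \<partial>\<mu>) = (\<lambda>(y, t). indicator {0<..} t *\<^sub>R theta \<mu> s t f y)"
    by (auto simp: fun_eq_iff s'_def theta_def indicator_def)
  ultimately show ?thesis by simp
qed

lemma dens_measurable [measurable]: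
  assumes [measurable]: "f \<in> borel_measurable borel"
  shows "dens f \<in> borel_measurable (\<mu> \<Otimes>\<^sub>M lborel)"
proof -
  have [measurable]: "(\<lambda>q. indicator {0<..} (snd q) *\<^sub>R theta \<mu> s (snd q) f (fst q)) \<in> borel_measurable (\<mu> \<Otimes>\<^sub>M lborel)"
    using theta_measurable[OF assms] by (simp add: case_prod_beta')
  have "dens f = (\<lambda>q. ennreal ((norm (indicator {0<..} (snd q) *\<^sub>R theta \<mu> s (snd q) f (fst q)))\<^sup>2 / snd q powr (m + 1)))"
    by (auto simp: dens_def fun_eq_iff indicator_def)
  also have "\<dots> \<in> borel_measurable (\<mu> \<Otimes>\<^sub>M lborel)" by measurable
  finally show ?thesis .
qed

text \<open>The square of the square function; the cut-off \<open>t > 0\<close> is part of \<open>dens\<close>.\<close>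

definition Ssq :: "(real^'n \<Rightarrow> complex) \<Rightarrow> real^'n \<Rightarrow> ennreal" where
  "Ssq f x = (\<integral>\<^sup>+q. dens f q * indicator {q. dist x (fst q) < snd q} q \<partial>(\<mu> \<Otimes>\<^sub>M lborel))"

lemma conical_S_eq: "conical_S \<mu> m s f x = epowr (Ssq f x) (1 / 2)"
  unfolding conical_S_def Ssq_def
  by (rule arg_cong[where f = "\<lambda>z. epowr z (1 / 2)"], rule nn_integral_cong)
    (auto simp: dens_def upward_cone_def indicator_def split: prod.splits)

lemma cone_measurable [measurable]:
  "(\<lambda>p. indicator {q. dist (fst p) (fst q) < snd q} (snd p) :: ennreal) \<in> borel_measurable (\<mu> \<Otimes>\<^sub>M (\<mu> \<Otimes>\<^sub>M lborel))"
proof -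
  have "(\<lambda>p. if dist (fst p) (fst (snd p)) < snd (snd p) then 1 else 0 :: ennreal) \<in> borel_measurable (\<mu> \<Otimes>\<^sub>M (\<mu> \<Otimes>\<^sub>M lborel))"
    by measurable
  then show ?thesis by (simp add: indicator_def)
qed

lemma Ssq_measurable [measurable]:
  assumes [measurable]: "f \<in> borel_measurable borel"
  shows "Ssq f \<in> borel_measurable borel"
proof -
  have "(\<lambda>x. \<integral>\<^sup>+q. dens f q * indicator {q. dist x (fst q) < snd q} q \<partial>(\<mu> \<Otimes>\<^sub>M lborel)) \<in> borel_measurable \<mu>"
    by (rule sigma_finite_measure.borel_measurable_nn_integral[OF sigma_finite_prod]) (simp add: case_prod_beta', measurable)
  then show ?thesis by (simp add: Ssq_def[abs_def] measurable_cong_sets[OF sets_mu])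
qed

text \<open>The dyadic version of the cone above \<open>x\<close>: its slices are the triples of the cells around \<open>x\<close>.\<close>

definition box :: "int \<Rightarrow> real^'n \<Rightarrow> ((real^'n) \<times> real) set" where
  "box k x = triple k x \<times> {side k / 2<..side k}"

definition energy :: "(real^'n \<Rightarrow> complex) \<Rightarrow> int \<Rightarrow> real^'n \<Rightarrow> ennreal" where
  "energy f k x = (\<integral>\<^sup>+q. dens f q * indicator (box k x) q \<partial>(\<mu> \<Otimes>\<^sub>M lborel))"

definition Dsq :: "(real^'n \<Rightarrow> complex) \<Rightarrow> int \<Rightarrow> real^'n \<Rightarrow> ennreal" where
  "Dsq f k x = (\<Sum>j. energy f (k + int j) x)"

lemma box_measurable [measurable]: "box k x \<in> sets (\<mu> \<Otimes>\<^sub>M lborel)"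
  unfolding box_def by (intro pair_measureI) auto

lemma energy_cong: "idx k x = idx k y \<Longrightarrow> energy f k x = energy f k y"
  by (simp add: energy_def box_def triple_cong[of k x y])

lemma measurable_box_indicator [measurable]:
  "(\<lambda>p. indicator (box k (fst p)) (snd p) :: ennreal) \<in> borel_measurable (\<mu> \<Otimes>\<^sub>M (\<mu> \<Otimes>\<^sub>M lborel))"
proof -
  have "(\<lambda>p. indicator (box k (fst p)) (snd p) :: ennreal) = (\<lambda>p. if (\<forall>i. (real_of_int (idx k (fst p) $ i) - 1) * side k \<le> fst (snd p) $ i \<and>
      fst (snd p) $ i \<le> (real_of_int (idx k (fst p) $ i) + 2) * side k) \<and> side k / 2 < snd (snd p) \<and> snd (snd p) \<le> side k then 1 else 0)"
    by (auto simp: fun_eq_iff box_def mem_triple indicator_def)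
  also have "\<dots> \<in> borel_measurable (\<mu> \<Otimes>\<^sub>M (\<mu> \<Otimes>\<^sub>M lborel))" by measurable
  finally show ?thesis .
qed

lemma energy_measurable [measurable]:
  assumes [measurable]: "f \<in> borel_measurable borel"
  shows "energy f k \<in> borel_measurable borel"
proof -
  have "(\<lambda>x. \<integral>\<^sup>+q. dens f q * indicator (box k x) q \<partial>(\<mu> \<Otimes>\<^sub>M lborel)) \<in> borel_measurable \<mu>"
    by (rule sigma_finite_measure.borel_measurable_nn_integral[OF sigma_finite_prod]) (simp add: case_prod_beta', measurable)
  then show ?thesis by (simp add: energy_def[abs_def] measurable_cong_sets[OF sets_mu])
qed

lemma Dsq_measurable [measurable]:
  assumes [measurable]: "f \<in> borel_measurable borel"
  shows "Dsq f k \<in> borel_measurable borel"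
  unfolding Dsq_def[abs_def] by measurable

lemma dyadic_scale:
  assumes "0 < t" "t \<le> side k"
  shows "\<exists>j. side (k + int j) / 2 < t \<and> t \<le> side (k + int j)"
proof -
  have side: "side (k + int j) = side k / 2 ^ j" for j
    by (simp add: side_def powr_diff powr_realpow powr_minus field_simps powr_add)
  define P where "P = (\<lambda>j. side (k + int j) / 2 < t)"
  have "\<exists>j. P j"
  proof -
    obtain j where "side k / t < 2 ^ j" using real_arch_pow[of 2] by auto
    then have "P j" using assms by (simp add: P_def side field_simps)
    then show ?thesis ..
  qed
  then have L: "P (LEAST j. P j)" by (rule LeastI_ex)
  show ?thesis
  proof (cases "LEAST j. P j")
    case 0
    then show ?thesis using L assms by (intro exI[of _ 0]) (auto simp: P_def)
  next
    case (Suc j)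
    then have "\<not> P j" using not_less_Least[of j P] by simp
    then have "t \<le> side (k + int (Suc j))"
      unfolding P_def side[of j] side[of "Suc j"] by (simp add: mult.commute)
    then show ?thesis using L Suc by (intro exI[of _ "Suc j"]) (auto simp: P_def)
  qed
qed

lemma Ssq_truncated_le_Dsq:
  assumes [measurable]: "f \<in> borel_measurable borel"
  shows "(\<integral>\<^sup>+q. dens f q * indicator {q. dist x (fst q) < snd q \<and> snd q \<le> side k} q \<partial>(\<mu> \<Otimes>\<^sub>M lborel)) \<le> Dsq f k x"
proof -
  have "(\<integral>\<^sup>+q. dens f q * indicator {q. dist x (fst q) < snd q \<and> snd q \<le> side k} q \<partial>(\<mu> \<Otimes>\<^sub>M lborel))
    \<le> (\<integral>\<^sup>+q. (\<Sum>j. dens f q * indicator (box (k + int j) x) q) \<partial>(\<mu> \<Otimes>\<^sub>M lborel))"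
  proof (rule nn_integral_mono)
    fix q :: "(real^'n) \<times> real"
    show "dens f q * indicator {q. dist x (fst q) < snd q \<and> snd q \<le> side k} q \<le> (\<Sum>j. dens f q * indicator (box (k + int j) x) q)"
    proof (cases "dist x (fst q) < snd q \<and> snd q \<le> side k")
      case True
      then have "0 < snd q" using zero_le_dist[of x "fst q"] by linarith
      then obtain j where j: "side (k + int j) / 2 < snd q" "snd q \<le> side (k + int j)"
        using dyadic_scale[of "snd q" k] True by blast
      have "fst q \<in> triple (k + int j) x"
      proof (rule mem_triple_of_near)
        fix i
        have "\<bar>fst q $ i - x $ i\<bar> \<le> dist x (fst q)"
          using component_le_norm_cart[of "fst q - x" i] by (simp add: dist_norm norm_minus_commute)
        then show "\<bar>fst q $ i - x $ i\<bar> \<le> side (k + int j)" using True j by linarith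
      qed
      then have "q \<in> box (k + int j) x" using j by (simp add: box_def mem_Times_iff)
      then have "dens f q = dens f q * indicator (box (k + int j) x) q" by simp
      also have "\<dots> \<le> (\<Sum>j. dens f q * indicator (box (k + int j) x) q)"
        by (rule le_suminf_ennreal)
      finally show ?thesis using True by simp
    qed simp
  qed
  also have "\<dots> = Dsq f k x"
    unfolding Dsq_def energy_def by (rule nn_integral_suminf) measurable
  finally show ?thesis .
qed

end

context conical
begin

lemma doubling_const_ge_1: "1 \<le> C\<^sub>d"
proof -
  obtain b where b: "emeasure \<mu> (ball 0 2) = ennreal b" "0 < b"
    using ball_finite[of 0 2] ball_pos[of 2 0] by (cases "emeasure \<mu> (ball 0 2)") auto
  have "emeasure \<mu> (ball 0 (2 * 1)) \<le> ennreal C\<^sub>d * emeasure \<mu> (ball 0 1)"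
    using doubling unfolding doubling_def by (metis zero_less_one)
  also have "\<dots> \<le> ennreal C\<^sub>d * emeasure \<mu> (ball 0 2)"
    by (intro mult_left_mono emeasure_mono) auto
  finally have "ennreal b \<le> ennreal (C\<^sub>d * b)" using b const_nonneg by (simp add: ennreal_mult)
  then have "1 * b \<le> C\<^sub>d * b" using b const_nonneg by (subst (asm) ennreal_le_iff) auto
  then show ?thesis using b by (subst (asm) mult_le_cancel_right_pos) auto
qed

text \<open>The doubling constant for all comparisons of a ball with sets whose points have coordinates within twenty
  radii of its centre; twenty suffices for the triple of a grandparent.\<close>

definition dbl_ball where "dbl_ball = C\<^sub>d ^ (5 + n)"

lemma dbl_ball_pos [simp]: "0 < dbl_ball" "0 \<le> dbl_ball" "dbl_ball \<noteq> 0"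
  using doubling_const_ge_1 by (simp_all add: dbl_ball_def)

text \<open>\<open>20 n < 2\<^bsup>5+n\<^esup>\<close>, which explains the number of doublings.\<close>

lemma emeasure_le_dbl_ball:
  assumes t: "0 < t" and X: "\<And>z i. z \<in> X \<Longrightarrow> \<bar>z $ i - y $ i\<bar> \<le> 20 * t"
  shows "emeasure \<mu> X \<le> ennreal dbl_ball * emeasure \<mu> (ball y t)"
proof -
  have "X \<subseteq> ball y (2 ^ (5 + n) * t)"
  proof
    fix z assume "z \<in> X"
    then have "norm (z - y) \<le> real n * (20 * t)"
      by (intro norm_le_of_coords) (use X in simp)
    also have "\<dots> < 2 ^ n * (32 * t)"
      using t by (intro mult_strict_mono[of "real n"]) (auto simp: nat_less_pow2)
    also have "\<dots> = 2 ^ (5 + n) * t" by (simp add: power_add)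
    finally show "z \<in> ball y (2 ^ (5 + n) * t)" by (simp add: dist_norm norm_minus_commute)
  qed
  then have "emeasure \<mu> X \<le> emeasure \<mu> (ball y (2 ^ (5 + n) * t))" by (intro emeasure_mono) auto
  also have "\<dots> \<le> ennreal dbl_ball * emeasure \<mu> (ball y t)"
    unfolding dbl_ball_def using t by (rule ball_pow2)
  finally show ?thesis .
qed

lemma side_minus_2: "side (k - 2) = 4 * side k"
  using side_minus_nat[of k 2] by simp

lemma weak_type_level:
  assumes f: "integrable \<mu> f" and t: "0 < t"
  shows "ennreal t * emeasure \<mu> {x. ennreal t < conical_S \<mu> m s f x} \<le> ennreal C\<^sub>w * (\<integral>\<^sup>+x. ennreal (norm (f x)) \<partial>\<mu>)"
proof -
  have "ennreal t * emeasure \<mu> {x \<in> space \<mu>. ennreal t < conical_S \<mu> m s f x} \<le> weak_L1_norm \<mu> (conical_S \<mu> m s f)"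
    unfolding weak_L1_norm_def by (rule SUP_upper2[of t]) (use t in auto)
  also have "\<dots> \<le> ennreal C\<^sub>w * (\<integral>\<^sup>+x. ennreal (norm (f x)) \<partial>\<mu>)"
    using weak_type f unfolding weak_type_1_1_def by blast
  finally show ?thesis by simp
qed

lemma measurable_box_indicator_fixed [measurable]:
  "(\<lambda>x. indicator (box k x) q :: ennreal) \<in> borel_measurable borel"
proof -
  have "{x. q \<in> box k x} \<in> sets borel" unfolding box_def mem_Times_iff mem_triple by measurable
  moreover have "(\<lambda>x. indicator (box k x) q :: ennreal) = indicator {x. q \<in> box k x}"
    by (auto simp: fun_eq_iff indicator_def)
  ultimately show ?thesis by simp
qed

text \<open>In the application \<open>Om\<close> is the set where the conical square function is large; \<open>E\<close> is the set where
  \<open>Om\<close> fills a fixed portion of some triple. For \<open>x\<close> outside \<open>E\<close> every ball that belongs to a box above \<open>x\<close> has at least half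
  of its measure outside \<open>Om\<close>. Integrating over \<open>x\<close> first, every \<open>(y, t)\<close> is therefore seen by the boxes
  above the complement of \<open>E\<close> no more than by the cones above the complement of \<open>Om\<close>, up to a constant.\<close>

lemma change_of_aperture:
  fixes k0 :: int
  assumes f [measurable]: "f \<in> borel_measurable borel" and O [measurable]: "Om \<in> sets borel"
  defines "E \<equiv> {x. \<exists>k\<in>{k0 - 2..}. ennreal (1 / (2 * dbl_ball)) * emeasure \<mu> (triple k x)
      \<le> (\<integral>\<^sup>+y. indicator Om y * indicator (triple k x) y \<partial>\<mu>)}"
  shows "(\<integral>\<^sup>+x. Dsq f k0 x * indicator (- E) x \<partial>\<mu>)
    \<le> ennreal (2 * dbl_ball) * (\<integral>\<^sup>+x. Ssq f x * indicator (- Om) x \<partial>\<mu>)"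
proof -
  have E [measurable]: "E \<in> sets borel"
    unfolding E_def by (rule maximal_weak_type_pointwise(1)) (auto simp: sets_mu)
  have half: "emeasure \<mu> (ball y t) \<le> 2 * emeasure \<mu> (ball y t - Om)"
    if x: "x \<notin> E" and y: "y \<in> triple k x" and k: "k0 \<le> k" and t: "side k / 2 < t" "t \<le> side k" for x y t k
  proof -
    have t0: "0 < t" using t side_pos(1)[of k] by linarith
    have sub: "ball y t \<subseteq> triple (k - 2) x"
    proof
      fix z assume "z \<in> ball y t"
      have "\<bar>z $ i - x $ i\<bar> \<le> side (k - 2)" for i
      proof -
        have "\<bar>z $ i - y $ i\<bar> < t"
          using \<open>z \<in> ball y t\<close> component_le_norm_cart[of "z - y" i]
          by (auto simp: dist_norm norm_minus_commute intro: le_less_trans)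
        then show ?thesis
          using triple_near[OF y self_in_cell, of i] t side_minus_2[of k] side_pos(1)[of k] by linarith
      qed
      then show "z \<in> triple (k - 2) x" by (rule mem_triple_of_near)
    qed
    have "emeasure \<mu> (ball y t \<inter> Om) \<le> emeasure \<mu> (Om \<inter> triple (k - 2) x)"
      using sub by (intro emeasure_mono) auto
    also have "\<dots> = (\<integral>\<^sup>+y. indicator Om y * indicator (triple (k - 2) x) y \<partial>\<mu>)"
      by (simp add: indicator_inter_arith[symmetric])
    also have "\<dots> \<le> ennreal (1 / (2 * dbl_ball)) * emeasure \<mu> (triple (k - 2) x)"
      using x k unfolding E_def by (auto simp: not_le intro: less_imp_le)
    also have "\<dots> \<le> ennreal (1 / (2 * dbl_ball)) * (ennreal dbl_ball * emeasure \<mu> (ball y t))"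
    proof (intro mult_left_mono emeasure_le_dbl_ball t0)
      fix z i assume "z \<in> triple (k - 2) x"
      then show "\<bar>z $ i - y $ i\<bar> \<le> 20 * t"
        using triple_near[OF _ self_in_cell, of z "k - 2" x i] triple_near[OF y self_in_cell, of i] t side_minus_2[of k]
        by linarith
    qed simp
    also have "\<dots> = ennreal (1 / 2) * emeasure \<mu> (ball y t)"
    proof -
      have "ennreal (1 / (2 * dbl_ball)) * ennreal dbl_ball = ennreal (1 / 2)"
        using dbl_ball_pos by (subst ennreal_mult[symmetric]) auto
      then show ?thesis by (simp only: mult.assoc[symmetric])
    qed
    finally have le: "emeasure \<mu> (ball y t \<inter> Om) \<le> ennreal (1 / 2) * emeasure \<mu> (ball y t)" .
    obtain a where a: "emeasure \<mu> (ball y t) = ennreal a" "0 \<le> a"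
      using ball_finite[of y t] by (cases "emeasure \<mu> (ball y t)") auto
    have "emeasure \<mu> (ball y t) = emeasure \<mu> (ball y t \<inter> Om) + emeasure \<mu> (ball y t - Om)"
      by (subst plus_emeasure) (auto intro!: arg_cong[where f = "emeasure \<mu>"])
    moreover obtain b where b: "emeasure \<mu> (ball y t - Om) = ennreal b" "0 \<le> b"
      using calculation a by (cases "emeasure \<mu> (ball y t - Om)") auto
    moreover obtain c where c: "emeasure \<mu> (ball y t \<inter> Om) = ennreal c" "0 \<le> c"
      using calculation a by (cases "emeasure \<mu> (ball y t \<inter> Om)") auto
    ultimately have "ennreal a = ennreal (c + b)" using a by simp
    then have "a = c + b" by (subst (asm) ennreal_inj) (use a(2) b(2) c(2) in auto)
    moreover have "c \<le> a / 2"
    proof -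
      have "ennreal (1 / 2) * ennreal a = ennreal (a / 2)" using a by (subst ennreal_mult[symmetric]) auto
      then have "ennreal c \<le> ennreal (a / 2)" using le unfolding a(1) c(1) by simp
      then show ?thesis using a by simp
    qed
    ultimately have "a \<le> 2 * b" by simp
    then have "ennreal a \<le> ennreal (2 * b)" by (rule ennreal_leI)
    then show ?thesis using a b by (simp add: ennreal_mult)
  qed
  let ?I = "\<lambda>j. {q :: (real^'n) \<times> real. side (k0 + int j) / 2 < snd q \<and> snd q \<le> side (k0 + int j)}"
  have I_sets: "?I j \<in> sets (\<mu> \<Otimes>\<^sub>M lborel)" for j
  proof -
    have "?I j = UNIV \<times> {side (k0 + int j) / 2<..side (k0 + int j)}" by auto
    then show ?thesis by (simp add: pair_measureI)
  qed
  let ?K = "\<lambda>q. \<integral>\<^sup>+x. indicator {q. dist x (fst q) < snd q} q * indicator (- Om) x \<partial>\<mu>"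
  have slice: "(\<integral>\<^sup>+x. indicator (box (k0 + int j) x) q * indicator (- E) x \<partial>\<mu>)
      \<le> ennreal (2 * dbl_ball) * (indicator (?I j) q * ?K q)" for j q
  proof (cases "q \<in> ?I j")
    case False
    then have "indicator (box (k0 + int j) x) q = (0::ennreal)" for x by (auto simp: box_def mem_Times_iff)
    then show ?thesis by simp
  next
    case True
    let ?k = "k0 + int j" and ?y = "fst q" and ?t = "snd q"
    have t0: "0 < ?t" using True side_pos(1)[of ?k] by (auto intro: less_trans)
    let ?X = "{x. ?y \<in> triple ?k x \<and> x \<notin> E}"
    have X: "?X \<in> sets borel" unfolding mem_triple by measurable
    have "(\<integral>\<^sup>+x. indicator (box ?k x) q * indicator (- E) x \<partial>\<mu>) = (\<integral>\<^sup>+x. indicator ?X x \<partial>\<mu>)"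
      using True by (intro nn_integral_cong) (auto simp: box_def mem_Times_iff indicator_def)
    also have "\<dots> = emeasure \<mu> ?X" using X by simp
    also have "\<dots> \<le> ennreal (2 * dbl_ball) * emeasure \<mu> (ball ?y ?t - Om)"
    proof (cases "?X = {}")
      case False
      then obtain x0 where x0: "?y \<in> triple ?k x0" "x0 \<notin> E" by blast
      have "emeasure \<mu> ?X \<le> ennreal dbl_ball * emeasure \<mu> (ball ?y ?t)"
      proof (rule emeasure_le_dbl_ball[OF t0])
        fix x i assume "x \<in> ?X"
        then show "\<bar>x $ i - ?y $ i\<bar> \<le> 20 * ?t"
          using triple_near[OF _ self_in_cell, of ?y ?k x i] True by auto
      qed
      also have "\<dots> \<le> ennreal dbl_ball * (2 * emeasure \<mu> (ball ?y ?t - Om))"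
        using True by (intro mult_left_mono half[OF x0(2,1)]) auto
      also have "\<dots> = ennreal (2 * dbl_ball) * emeasure \<mu> (ball ?y ?t - Om)"
      proof -
        have "ennreal (2 * dbl_ball) = 2 * ennreal dbl_ball" using dbl_ball_pos by (subst ennreal_mult) auto
        then show ?thesis by (simp only: mult_ac)
      qed
      finally show ?thesis .
    qed (simp only: emeasure_empty zero_le)
    also have "emeasure \<mu> (ball ?y ?t - Om) = (\<integral>\<^sup>+x. indicator (ball ?y ?t - Om) x \<partial>\<mu>)" by simp
    also have "\<dots> = ?K q"
      by (intro nn_integral_cong) (auto simp: indicator_def dist_commute)
    finally show ?thesis using True by simp
  qed
  let ?P = "\<mu> \<Otimes>\<^sub>M (lborel :: real measure)"
  have "(\<integral>\<^sup>+x. Dsq f k0 x * indicator (- E) x \<partial>\<mu>)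
    = (\<integral>\<^sup>+x. (\<Sum>j. energy f (k0 + int j) x * indicator (- E) x) \<partial>\<mu>)"
    by (simp add: Dsq_def ennreal_suminf_multc)
  also have "\<dots> = (\<Sum>j. \<integral>\<^sup>+x. energy f (k0 + int j) x * indicator (- E) x \<partial>\<mu>)"
    by (rule nn_integral_suminf) measurable
  also have "\<dots> \<le> (\<Sum>j. ennreal (2 * dbl_ball) * (\<integral>\<^sup>+q. dens f q * indicator (?I j) q *
      ?K q \<partial>?P))"
  proof (rule suminf_le)
    fix j
    have "(\<integral>\<^sup>+x. energy f (k0 + int j) x * indicator (- E) x \<partial>\<mu>)
      = (\<integral>\<^sup>+x. (\<integral>\<^sup>+q. dens f q * (indicator (box (k0 + int j) x) q * indicator (- E) x) \<partial>?P) \<partial>\<mu>)"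
      unfolding energy_def by (intro nn_integral_cong) (simp add: nn_integral_multc[symmetric] mult.assoc)
    also have "\<dots> = (\<integral>\<^sup>+q. (\<integral>\<^sup>+x. dens f q * (indicator (box (k0 + int j) x) q * indicator (- E) x) \<partial>\<mu>) \<partial>?P)"
      by (rule \<mu>\<mu>L.Fubini'[symmetric]) (simp add: case_prod_beta', measurable)
    also have "\<dots> \<le> (\<integral>\<^sup>+q. ennreal (2 * dbl_ball) * (dens f q * indicator (?I j) q *
      ?K q) \<partial>?P)"
    proof (rule nn_integral_mono)
      fix q :: "(real^'n) \<times> real"
      have "(\<integral>\<^sup>+x. dens f q * (indicator (box (k0 + int j) x) q * indicator (- E) x) \<partial>\<mu>)
        = dens f q * (\<integral>\<^sup>+x. indicator (box (k0 + int j) x) q * indicator (- E) x \<partial>\<mu>)"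
        by (rule nn_integral_cmult) measurable
      also have "\<dots> \<le> dens f q * (ennreal (2 * dbl_ball) * (indicator (?I j) q * ?K q))"
        by (intro mult_left_mono slice) simp
      finally show "(\<integral>\<^sup>+x. dens f q * (indicator (box (k0 + int j) x) q * indicator (- E) x) \<partial>\<mu>)
        \<le> ennreal (2 * dbl_ball) * (dens f q * indicator (?I j) q *
          ?K q)"
        by (simp only: mult_ac)
    qed
    also have "\<dots> = ennreal (2 * dbl_ball) * (\<integral>\<^sup>+q. dens f q * indicator (?I j) q *
      ?K q \<partial>?P)"
    proof (rule nn_integral_cmult)
      have [measurable]: "(\<lambda>q. \<integral>\<^sup>+x. indicator {q. dist x (fst q) < snd q} q * indicator (- Om) x \<partial>\<mu>) \<in> borel_measurable ?P"
        by (rule \<mu>.borel_measurable_nn_integral) (simp add: case_prod_beta', measurable)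
      have [measurable]: "(\<lambda>q. indicator (?I j) q :: ennreal) \<in> borel_measurable ?P"
        by (rule borel_measurable_indicator[OF I_sets])
      show "(\<lambda>q. dens f q * indicator (?I j) q *
        ?K q) \<in> borel_measurable ?P"
        by measurable
    qed
    finally show "(\<integral>\<^sup>+x. energy f (k0 + int j) x * indicator (- E) x \<partial>\<mu>) \<le> \<dots>" .
  qed auto
  also have "\<dots> = ennreal (2 * dbl_ball) * (\<Sum>j. \<integral>\<^sup>+q. dens f q * indicator (?I j) q *
      ?K q \<partial>?P)"
    by (rule ennreal_suminf_cmult)
  also have "\<dots> \<le> ennreal (2 * dbl_ball) * (\<integral>\<^sup>+x. Ssq f x * indicator (- Om) x \<partial>\<mu>)"
  proof (rule mult_left_mono)
    have [measurable]: "(\<lambda>q. \<integral>\<^sup>+x. indicator {q. dist x (fst q) < snd q} q * indicator (- Om) x \<partial>\<mu>) \<in> borel_measurable ?P"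
      by (rule \<mu>.borel_measurable_nn_integral) (simp add: case_prod_beta', measurable)
    have [measurable]: "(\<lambda>q. indicator (?I j) q :: ennreal) \<in> borel_measurable ?P" for j
      by (rule borel_measurable_indicator[OF I_sets])
    have "(\<Sum>j. \<integral>\<^sup>+q. dens f q * indicator (?I j) q *
      ?K q \<partial>?P)
      = (\<integral>\<^sup>+q. (\<Sum>j. dens f q * indicator (?I j) q *
      ?K q) \<partial>?P)"
      by (rule nn_integral_suminf[symmetric]) measurable
    also have "\<dots> \<le> (\<integral>\<^sup>+q. dens f q * ?K q \<partial>?P)"
    proof (rule nn_integral_mono)
      fix q :: "(real^'n) \<times> real"
      have disj: "disjoint_family ?I"
      proof -
        have *: "?I i \<inter> ?I j = {}" if "i < j" for i j
        proof -
          have "side (k0 + int j) \<le> side (k0 + int i + 1)" using that by (intro side_antimono) auto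
          also have "\<dots> = side (k0 + int i) / 2" using side_minus_1[of "k0 + int i + 1"] by simp
          finally show ?thesis by auto
        qed
        show ?thesis
          unfolding disjoint_family_on_def
        proof (intro ballI impI)
          fix i j :: nat assume "i \<noteq> j"
          then consider "i < j" | "j < i" by linarith
          then show "?I i \<inter> ?I j = {}"
          proof cases
            case 2
            show ?thesis by (subst Int_commute) (rule *[OF 2])
          qed (rule *)
        qed
      qed
      have "(\<Sum>j. indicator (?I j) q :: ennreal) \<le> 1"
        using suminf_indicator[OF disj, of q] by (simp add: indicator_def)
      then have "dens f q * ?K q * (\<Sum>j. indicator (?I j) q)
        \<le> dens f q * ?K q * 1"
        by (intro mult_left_mono) auto
      then show "(\<Sum>j. dens f q * indicator (?I j) q * ?K q)
        \<le> dens f q * ?K q"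
        by (simp only: ennreal_suminf_cmult[symmetric] mult_ac mult_1_right mult_1_left)
    qed
    also have "\<dots> = (\<integral>\<^sup>+q. (\<integral>\<^sup>+x. dens f q * (indicator {q. dist x (fst q) < snd q} q * indicator (- Om) x) \<partial>\<mu>) \<partial>?P)"
      by (intro nn_integral_cong nn_integral_cmult[symmetric]) (auto simp: indicator_def intro!: measurable_If)
    also have "\<dots> = (\<integral>\<^sup>+x. (\<integral>\<^sup>+q. dens f q * (indicator {q. dist x (fst q) < snd q} q * indicator (- Om) x) \<partial>?P) \<partial>\<mu>)"
      by (rule \<mu>\<mu>L.Fubini') (simp add: case_prod_beta', measurable)
    also have "\<dots> = (\<integral>\<^sup>+x. Ssq f x * indicator (- Om) x \<partial>\<mu>)"
    proof (rule nn_integral_cong)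
      fix x
      show "(\<integral>\<^sup>+q. dens f q * (indicator {q. dist x (fst q) < snd q} q * indicator (- Om) x) \<partial>?P) = Ssq f x * indicator (- Om) x"
        by (cases "x \<in> Om") (auto simp: Ssq_def)
    qed
    finally show "(\<Sum>j. \<integral>\<^sup>+q. dens f q * indicator (?I j) q *
      ?K q \<partial>?P) \<le> (\<integral>\<^sup>+x. Ssq f x * indicator (- Om) x \<partial>\<mu>)" .
  qed simp
  finally show ?thesis .
qed

text \<open>Layer by layer the weak type gives \<open>t \<mu>(t < S f) \<le> C \<parallel>f\<parallel>\<^sub>1\<close>, and only heights \<open>t \<le> l\<close> contribute.\<close>

lemma Ssq_below_level:
  assumes f: "integrable \<mu> f" and [measurable]: "f \<in> borel_measurable borel" and l: "0 < l"
  shows "(\<integral>\<^sup>+x. Ssq f x * indicator (- {x. ennreal l < conical_S \<mu> m s f x}) x \<partial>\<mu>)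
    \<le> ennreal (2 * l) * (ennreal C\<^sub>w * (\<integral>\<^sup>+x. ennreal (norm (f x)) \<partial>\<mu>))"
proof -
  let ?N = "ennreal C\<^sub>w * (\<integral>\<^sup>+x. ennreal (norm (f x)) \<partial>\<mu>)"
  let ?S = "conical_S \<mu> m s f"
  have [measurable]: "?S \<in> borel_measurable borel" by (simp add: conical_S_eq[abs_def])
  define v where "v = (\<lambda>x. ?S x * indicator (- {x. ennreal l < ?S x}) x)"
  have [measurable]: "v \<in> borel_measurable borel" unfolding v_def by measurable
  have "(\<integral>\<^sup>+x. Ssq f x * indicator (- {x. ennreal l < ?S x}) x \<partial>\<mu>) = (\<integral>\<^sup>+x. epowr (v x) 2 \<partial>\<mu>)"
    by (intro nn_integral_cong) (auto simp: v_def conical_S_eq epowr_epowr indicator_def)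
  also have "\<dots> = (\<integral>\<^sup>+t. ennreal (2 * t powr (2 - 1)) * indicator {0<..} t * emeasure \<mu> {x \<in> space \<mu>. ennreal t < v x} \<partial>lborel)"
    by (rule nn_integral_layer_cake) (use sigma_finite_mu in auto)
  also have "\<dots> \<le> (\<integral>\<^sup>+t. 2 * ?N * indicator {0..l} t \<partial>lborel)"
  proof (rule nn_integral_mono)
    fix t :: real
    show "ennreal (2 * t powr (2 - 1)) * indicator {0<..} t * emeasure \<mu> {x \<in> space \<mu>. ennreal t < v x} \<le> 2 * ?N * indicator {0..l} t"
    proof (cases "0 < t \<and> t \<le> l")
      case True
      have "ennreal t * emeasure \<mu> {x \<in> space \<mu>. ennreal t < v x} \<le> ennreal t * emeasure \<mu> {x. ennreal t < ?S x}"
        by (intro mult_left_mono emeasure_mono) (auto simp: v_def indicator_def split: if_splits)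
      also have "\<dots> \<le> ?N" using True by (intro weak_type_level f) auto
      finally have "2 * (ennreal t * emeasure \<mu> {x \<in> space \<mu>. ennreal t < v x}) \<le> 2 * ?N" by (rule mult_left_mono) simp
      then show ?thesis using True by (simp add: ennreal_mult mult.assoc)
    next
      case False
      have "v x \<le> ennreal t" if "\<not> t \<le> l" for x
      proof -
        have "ennreal l \<le> ennreal t" using that by (intro ennreal_leI) simp
        then show ?thesis by (auto simp: v_def indicator_def not_less intro: order_trans)
      qed
      then have "\<not> t \<le> l \<Longrightarrow> {x \<in> space \<mu>. ennreal t < v x} = {}" by (auto simp: not_less)
      then show ?thesis using False by (cases "t \<le> l") auto
    qed
  qed
  also have "\<dots> = 2 * ?N * ennreal l" using l by (simp add: nn_integral_cmult_indicator)
  also have "\<dots> = ennreal (2 * l) * ?N" using l by (simp add: ennreal_mult mult_ac)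
  finally show ?thesis .
qed

definition weak_const where "weak_const = C\<^sub>w * (2 * 4 ^ n * dbl_ball + 4 * dbl_ball)"

lemma weak_const_nonneg: "0 \<le> weak_const"
  using const_nonneg dbl_ball_pos by (auto simp: weak_const_def)

text \<open>The exceptional set of the change of aperture is as small as the level set of the conical square
  function; off it Chebyshev's inequality is applied to the mean-square estimate.\<close>

lemma Dsq_weak_type:
  assumes f: "integrable \<mu> f" and [measurable]: "f \<in> borel_measurable borel" and l: "0 < l"
  shows "ennreal l * emeasure \<mu> {x. ennreal (l\<^sup>2) < Dsq f k0 x} \<le> ennreal weak_const * (\<integral>\<^sup>+x. ennreal (norm (f x)) \<partial>\<mu>)"
proof -
  let ?N = "\<integral>\<^sup>+x. ennreal (norm (f x)) \<partial>\<mu>"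
  let ?S = "conical_S \<mu> m s f"
  have [measurable]: "?S \<in> borel_measurable borel" by (simp add: conical_S_eq[abs_def])
  define Om where "Om = {x. ennreal l < ?S x}"
  have Om [measurable]: "Om \<in> sets borel" unfolding Om_def by measurable
  define E where "E = {x. \<exists>k\<in>{k0 - 2..}. ennreal (1 / (2 * dbl_ball)) * emeasure \<mu> (triple k x)
      \<le> (\<integral>\<^sup>+y. indicator Om y * indicator (triple k x) y \<partial>\<mu>)}"
  have E [measurable]: "E \<in> sets borel"
    unfolding E_def by (rule maximal_weak_type_pointwise(1)) (auto simp: sets_mu)
  have "ennreal (1 / (2 * dbl_ball)) * emeasure \<mu> E \<le> 4 ^ CARD('n) * (\<integral>\<^sup>+x. indicator Om x \<partial>\<mu>)"
    unfolding E_def by (rule maximal_weak_type_pointwise(2)) (auto simp: sets_mu)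
  then have "ennreal (2 * dbl_ball) * (ennreal (1 / (2 * dbl_ball)) * emeasure \<mu> E) \<le> ennreal (2 * dbl_ball) * (4 ^ n * emeasure \<mu> Om)"
    by (intro mult_left_mono) (auto simp: n)
  moreover have "ennreal (2 * dbl_ball) * (ennreal (1 / (2 * dbl_ball)) * emeasure \<mu> E) = emeasure \<mu> E"
  proof -
    have "ennreal (2 * dbl_ball) * ennreal (1 / (2 * dbl_ball)) = 1"
      using dbl_ball_pos by (subst ennreal_mult[symmetric]) auto
    then show ?thesis by (simp only: mult.assoc[symmetric] mult_1_left)
  qed
  ultimately have "ennreal l * emeasure \<mu> E \<le> ennreal l * (ennreal (2 * dbl_ball) * (4 ^ n * emeasure \<mu> Om))"
    by (intro mult_left_mono) auto
  also have "\<dots> = ennreal (2 * 4 ^ n * dbl_ball) * (ennreal l * emeasure \<mu> Om)"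
  proof -
    have "ennreal (2 * 4 ^ n * dbl_ball) = ennreal (4 ^ n) * ennreal (2 * dbl_ball)"
      using dbl_ball_pos by (subst ennreal_mult[symmetric]) auto
    moreover have "ennreal (4 ^ n) = 4 ^ n" by (metis ennreal_numeral ennreal_power zero_le_numeral)
    ultimately show ?thesis by (simp only: mult_ac)
  qed
  also have "\<dots> \<le> ennreal (2 * 4 ^ n * dbl_ball) * (ennreal C\<^sub>w * ?N)"
    unfolding Om_def by (intro mult_left_mono weak_type_level f l) simp
  finally have 1: "ennreal l * emeasure \<mu> E \<le> ennreal (2 * 4 ^ n * dbl_ball) * (ennreal C\<^sub>w * ?N)" .
  let ?X = "{x. ennreal (l\<^sup>2) < Dsq f k0 x} - E"
  have "ennreal (l\<^sup>2) * emeasure \<mu> ?X = (\<integral>\<^sup>+x. ennreal (l\<^sup>2) * indicator ?X x \<partial>\<mu>)"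
    by (subst nn_integral_cmult_indicator) auto
  also have "\<dots> \<le> (\<integral>\<^sup>+x. Dsq f k0 x * indicator (- E) x \<partial>\<mu>)"
    by (intro nn_integral_mono) (auto simp: indicator_def)
  also have "\<dots> \<le> ennreal (2 * dbl_ball) * (\<integral>\<^sup>+x. Ssq f x * indicator (- Om) x \<partial>\<mu>)"
    unfolding E_def by (rule change_of_aperture) auto
  also have "\<dots> \<le> ennreal (2 * dbl_ball) * (ennreal (2 * l) * (ennreal C\<^sub>w * ?N))"
    unfolding Om_def by (intro mult_left_mono Ssq_below_level f l) auto
  finally have "ennreal l * (ennreal l * emeasure \<mu> ?X) \<le> ennreal l * (ennreal (4 * dbl_ball) * (ennreal C\<^sub>w * ?N))"
  proof -
    assume *: "ennreal (l\<^sup>2) * emeasure \<mu> ?X \<le> ennreal (2 * dbl_ball) * (ennreal (2 * l) * (ennreal C\<^sub>w * ?N))"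
    have "ennreal (l\<^sup>2) = ennreal l * ennreal l" using l by (simp add: power2_eq_square ennreal_mult)
    moreover have "ennreal (2 * dbl_ball) * ennreal (2 * l) = ennreal l * ennreal (4 * dbl_ball)"
      using l dbl_ball_pos by (subst (1 2) ennreal_mult[symmetric]) auto
    ultimately show ?thesis using * by (simp only: mult.assoc[symmetric])
  qed
  then have 2: "ennreal l * emeasure \<mu> ?X \<le> ennreal (4 * dbl_ball) * (ennreal C\<^sub>w * ?N)"
    using l by (simp add: ennreal_mult_le_mult_iff)
  have "ennreal l * emeasure \<mu> {x. ennreal (l\<^sup>2) < Dsq f k0 x} \<le> ennreal l * (emeasure \<mu> E + emeasure \<mu> ?X)"
  proof (rule mult_left_mono)
    have "emeasure \<mu> {x. ennreal (l\<^sup>2) < Dsq f k0 x} \<le> emeasure \<mu> (E \<union> ?X)" by (intro emeasure_mono) auto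
    also have "\<dots> \<le> emeasure \<mu> E + emeasure \<mu> ?X" by (intro emeasure_subadditive) auto
    finally show "emeasure \<mu> {x. ennreal (l\<^sup>2) < Dsq f k0 x} \<le> emeasure \<mu> E + emeasure \<mu> ?X" .
  qed simp
  also have "\<dots> \<le> ennreal (2 * 4 ^ n * dbl_ball) * (ennreal C\<^sub>w * ?N) + ennreal (4 * dbl_ball) * (ennreal C\<^sub>w * ?N)"
    unfolding distrib_left by (intro add_mono 1 2)
  also have "\<dots> = ennreal weak_const * ?N"
  proof -
    have "ennreal weak_const = ennreal C\<^sub>w * ennreal (2 * 4 ^ n * dbl_ball + 4 * dbl_ball)"
      unfolding weak_const_def using const_nonneg dbl_ball_pos by (intro ennreal_mult) auto
    also have "ennreal (2 * 4 ^ n * dbl_ball + 4 * dbl_ball) = ennreal (2 * 4 ^ n * dbl_ball) + ennreal (4 * dbl_ball)"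
      using dbl_ball_pos by (intro ennreal_plus) auto
    finally show ?thesis by (simp only: distrib_right distrib_left mult_ac)
  qed
  finally show ?thesis .
qed

end

section \<open>Averages with tails, and the stopping cells\<close>

lemma le_of_ennreal_mult_le:
  assumes "0 < a" "ennreal a * X \<le> ennreal b" "0 \<le> b"
  shows "X \<le> ennreal (b / a)"
proof (cases X)
  case (real r)
  then have "a * r \<le> b" using assms by (simp add: ennreal_mult[symmetric])
  then show ?thesis using assms real by (simp add: field_simps ennreal_leI)
next
  case top
  then show ?thesis using assms by (simp add: ennreal_mult_top top_unique)
qed

lemma ennreal_2_mult: "0 \<le> a \<Longrightarrow> ennreal (2 * a) = 2 * ennreal a"
  by (subst ennreal_mult) auto

lemma ennreal_mult3: "0 \<le> a \<Longrightarrow> 0 \<le> b \<Longrightarrow> 0 \<le> c \<Longrightarrow> ennreal a * (ennreal b * ennreal c) = ennreal (a * (b * c))"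
  by (simp add: ennreal_mult)

lemma box_coefficient:
  fixes a d sd T m :: real
  assumes "0 < sd"
  shows "(a * d ^ j)\<^sup>2 / (sd / 2) powr (m + 1) * (T * sd powr m * (sd / 2)) = a\<^sup>2 * T * 2 powr m * (d\<^sup>2) ^ j"
proof -
  have cancel: "X / (P / Q * h) * (T * P * h) = X * T * Q" if "0 < P" "0 < Q" "0 < h" for X P Q h :: real
    using that by (simp add: field_simps)
  have "(sd / 2) powr (m + 1) = sd powr m / 2 powr m * (sd / 2)"
    using assms by (simp add: powr_add powr_divide)
  moreover have "(a * d ^ j)\<^sup>2 = a\<^sup>2 * (d\<^sup>2) ^ j"
    by (simp only: power_mult_distrib power_mult[symmetric] mult.commute)
  ultimately show ?thesis
    using cancel[of "sd powr m" "2 powr m" "sd / 2" "a\<^sup>2 * (d\<^sup>2) ^ j"] assms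
    by (simp only: mult_ac) simp
qed

text \<open>With \<open>u = 2\<^bsup>i+1\<^esup>\<close> this is \<open>4\<^sup>m (u sd)\<^bsup>-a\<^esup>\<close> on both sides, up to the common factors.\<close>

lemma tail_coefficient:
  fixes c T t sd m a :: real
  assumes "0 < t" "0 < sd"
  shows "c * t powr a / (2 ^ (i + 1) * sd) powr (m + a) * (T * (sd * 2 ^ (i + 3)) powr m)
    = c * T * 4 powr (m + a) * (t / sd) powr a * (2 powr (- a)) ^ (i + 3)"
proof -
  define u :: real where "u = 2 ^ (i + 1)"
  have u: "0 < u" "2 ^ (i + 3) = 4 * u" by (simp_all add: u_def power_add)
  have "(2 powr (- a)) ^ (i + 3) = (2 ^ (i + 3)) powr (- a)"
    by (simp add: powr_powr powr_realpow[symmetric] mult.commute)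
  also have "\<dots> = 4 powr (- a) * u powr (- a)" using u by (simp add: powr_mult)
  finally have g: "(2 powr (- a)) ^ (i + 3) = 4 powr (- a) * u powr (- a)" .
  have "(sd * 2 ^ (i + 3)) powr m = 4 powr m * (u * sd) powr m"
    using u assms by (simp add: powr_mult mult_ac)
  moreover have "(u * sd) powr (m + a) = (u * sd) powr m * (u powr a * sd powr a)"
    using u assms by (simp add: powr_add powr_mult)
  moreover have "(u * sd) powr m \<noteq> 0" using u assms by simp
  moreover have "4 powr (m + a) * 4 powr (- a) = (4 powr m :: real)" by (simp add: powr_add[symmetric])
  moreover have "(t / sd) powr a = t powr a / sd powr a" using assms by (simp add: powr_divide)
  ultimately show ?thesis
    unfolding g u_def[symmetric] by (simp add: powr_minus field_simps)
qed

context conical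
begin

definition decay :: real where "decay = 2 powr (- \<alpha>)"

lemma decay [simp]: "0 < decay" "0 \<le> decay" "decay < 1" "decay \<noteq> 0" "decay \<le> 1"
proof -
  have "2 powr (- \<alpha>) < 2 powr 0" using \<alpha> by (intro powr_less_mono) auto
  then show "decay < 1" "decay \<le> 1" by (simp_all add: decay_def)
qed (auto simp: decay_def)

definition mass :: "(real^'n \<Rightarrow> complex) \<Rightarrow> int \<Rightarrow> real^'n \<Rightarrow> ennreal" where
  "mass f k x = (\<integral>\<^sup>+y. ennreal (norm (f y)) * indicator (triple k x) y \<partial>\<mu>)"

definition avg :: "(real^'n \<Rightarrow> complex) \<Rightarrow> int \<Rightarrow> real^'n \<Rightarrow> real" where
  "avg f k x = enn2real (mass f k x) / enn2real (emeasure \<mu> (triple k x))"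

text \<open>The geometric weights are those with which the kernel sees the ancestors of a cell, so the averages far
  away enter with the decay exponent of the size condition.\<close>

definition tail_avg :: "(real^'n \<Rightarrow> complex) \<Rightarrow> int \<Rightarrow> real^'n \<Rightarrow> real" where
  "tail_avg f k x = (\<Sum>i. decay ^ i * avg f (k - int i) x)"

definition inner_part :: "int \<Rightarrow> real^'n \<Rightarrow> (real^'n \<Rightarrow> complex) \<Rightarrow> real^'n \<Rightarrow> complex" where
  "inner_part k x f = (\<lambda>z. f z * indicator (triple k x) z)"

definition outer_part :: "int \<Rightarrow> real^'n \<Rightarrow> (real^'n \<Rightarrow> complex) \<Rightarrow> real^'n \<Rightarrow> complex" where
  "outer_part k x f = (\<lambda>z. f z * indicator (- triple k x) z)"

definition tail_const where "tail_const = C\<^sub>s * triple_power_const * 4 powr (m + \<alpha>)"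

definition tail_sq_const where
  "tail_sq_const = tail_const\<^sup>2 * triple_power_const * 2 powr m / (1 - decay\<^sup>2)"

lemma tail_const_nonneg: "0 \<le> tail_const"
  using const_nonneg triple_power_const_nonneg by (simp add: tail_const_def)

lemma decay_sq: "decay\<^sup>2 < 1"
  using power_strict_mono[of decay 1 2] by simp

lemma tail_sq_const_nonneg: "0 \<le> tail_sq_const"
  using decay_sq triple_power_const_nonneg by (simp add: tail_sq_const_def)

text \<open>Large enough for three purposes: to absorb the far part of \<open>f\<close>, and to make each of the two reasons for
  being bad occur on at most a quarter of the cell.\<close>

definition stop_const where
  "stop_const = 1 + 4 * tail_sq_const + 8 * weak_const * dbl 2 / decay\<^sup>2 + 4 * 4 ^ n * dbl 0"

lemma stop_const:
  "1 \<le> stop_const" "4 * tail_sq_const \<le> stop_const\<^sup>2"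
  "8 * weak_const * dbl 2 / decay\<^sup>2 \<le> stop_const" "4 * 4 ^ n * dbl 0 \<le> stop_const"
proof -
  have nn: "0 \<le> tail_sq_const" "0 \<le> 8 * weak_const * dbl 2 / decay\<^sup>2" "0 \<le> 4 * 4 ^ n * dbl 0"
    using tail_sq_const_nonneg weak_const_nonneg dbl_nonneg[of 2] dbl_nonneg[of 0] by auto
  show 1: "1 \<le> stop_const" and "8 * weak_const * dbl 2 / decay\<^sup>2 \<le> stop_const" and "4 * 4 ^ n * dbl 0 \<le> stop_const"
    unfolding stop_const_def using nn by linarith+
  have "4 * tail_sq_const \<le> stop_const" unfolding stop_const_def using nn by linarith
  also have "\<dots> \<le> stop_const\<^sup>2" using 1 by (simp add: power2_eq_square mult_le_cancel_left1)
  finally show "4 * tail_sq_const \<le> stop_const\<^sup>2" .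
qed

text \<open>The second alternative plays the role of a maximal function; it is what later relates the tail averages of
  cells between two stopping levels to that of the earlier stopping cell.\<close>

definition bad :: "(real^'n \<Rightarrow> complex) \<Rightarrow> int \<Rightarrow> real^'n \<Rightarrow> bool" where
  "bad f k y \<longleftrightarrow> ennreal ((stop_const * tail_avg f k y)\<^sup>2) < Dsq f k y \<or> (\<exists>j. stop_const * tail_avg f k y < avg f (k + int j) y)"

text \<open>\<open>stop f k0 x j\<close> is the last stopping level up to the \<open>j\<close>-th below \<open>k0\<close> on the chain of cells that contain
  \<open>x\<close>: a new stopping cell is declared as soon as all of its points are bad for the current one. The level
  \<open>j\<close> is a stopping level if and only if \<open>stop f k0 x j = j\<close>.\<close>

primrec stop :: "(real^'n \<Rightarrow> complex) \<Rightarrow> int \<Rightarrow> real^'n \<Rightarrow> nat \<Rightarrow> nat" where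
  "stop f k0 x 0 = 0"
| "stop f k0 x (Suc j) = (if \<forall>y\<in>cell (k0 + int (Suc j)) x. bad f (k0 + int (stop f k0 x j)) y then Suc j else stop f k0 x j)"

lemma mass_cong: "idx k x = idx k y \<Longrightarrow> mass f k x = mass f k y"
  by (simp add: mass_def triple_cong[of k x y])

lemma avg_cong: "idx k x = idx k y \<Longrightarrow> avg f k x = avg f k y"
  by (simp add: avg_def mass_cong[of k x y] triple_cong[of k x y])

lemma tail_avg_cong: "idx k x = idx k y \<Longrightarrow> tail_avg f k x = tail_avg f k y"
  unfolding tail_avg_def by (intro suminf_cong arg_cong2[where f = "(*)"] refl avg_cong) (auto intro: idx_coarser)

lemma avg_nonneg [simp]: "0 \<le> avg f k x"
  by (simp add: avg_def)

lemma kernel_section_measurable: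
  assumes "0 < t"
  shows "(\<lambda>z. s t y z) \<in> borel_measurable borel"
proof -
  define s' where "s' = (\<lambda>p. indicator ({0<..} \<times> UNIV \<times> UNIV) p *\<^sub>R (case p of (t, x, y) \<Rightarrow> s t x y) :: complex)"
  have s': "s' \<in> borel_measurable borel"
    using kernel unfolding measurable_kernel_def set_borel_measurable_def s'_def .
  have "(\<lambda>z. (t, y, z)) \<in> measurable borel (borel \<Otimes>\<^sub>M (borel \<Otimes>\<^sub>M borel))" by measurable
  then have "(\<lambda>z. (t, y, z)) \<in> measurable borel (borel :: (real \<times> (real^'n) \<times> (real^'n)) measure)" by (simp add: borel_prod)
  from measurable_compose[OF this s'] show ?thesis using assms by (simp add: s'_def)
qed

lemma kernel_bound: "0 < t \<Longrightarrow> norm (s t y z) \<le> C\<^sub>s * (t powr \<alpha> / (t + dist y z) powr (m + \<alpha>))"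
  using size unfolding size_condition_def by blast

lemma stop_le: "stop f k0 x j \<le> j"
  by (induction j) auto

lemma stop_between: "stop f k0 x j \<le> i \<Longrightarrow> i \<le> j \<Longrightarrow> stop f k0 x i = stop f k0 x j"
proof (induction j)
  case (Suc j)
  show ?case
  proof (cases "i = Suc j")
    case False
    then have "i \<le> j" using Suc.prems by simp
    then show ?thesis using Suc by (auto split: if_splits)
  qed simp
qed simp

lemma stop_idem: "stop f k0 x (stop f k0 x j) = stop f k0 x j"
  by (rule stop_between) (auto simp: stop_le)

lemma stop_mono: "i \<le> j \<Longrightarrow> stop f k0 x i \<le> stop f k0 x j"
proof (rule ccontr)
  assume "i \<le> j" "\<not> stop f k0 x i \<le> stop f k0 x j"
  then show False using stop_between[of f k0 x j i] stop_le[of f k0 x i] by simp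
qed

lemma stop_cong: "idx (k0 + int j) x = idx (k0 + int j) y \<Longrightarrow> stop f k0 x j = stop f k0 y j"
proof (induction j)
  case (Suc j)
  then have "idx (k0 + int j) x = idx (k0 + int j) y" by (intro idx_coarser[OF Suc.prems]) simp
  then show ?case using Suc.IH cell_cong[OF Suc.prems] by simp
qed simp

end

locale conical_function = conical \<mu> s m \<alpha> C\<^sub>\<mu> C\<^sub>s C\<^sub>d C\<^sub>w n
  for \<mu> :: "(real^'n) measure" and s m \<alpha> C\<^sub>\<mu> C\<^sub>s C\<^sub>d C\<^sub>w n +
  fixes f :: "real^'n \<Rightarrow> complex"
  assumes f: "integrable \<mu> f" and f_borel [measurable]: "f \<in> borel_measurable borel"
begin

lemma integral_f_finite: "(\<integral>\<^sup>+x. ennreal (norm (f x)) \<partial>\<mu>) < \<infinity>"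
  using f by (simp add: integrable_iff_bounded)

lemma mass_finite: "mass f k x < \<infinity>"
proof -
  have "mass f k x \<le> (\<integral>\<^sup>+x. ennreal (norm (f x)) \<partial>\<mu>)"
    unfolding mass_def by (intro nn_integral_mono) (auto simp: indicator_def)
  then show ?thesis using integral_f_finite by (rule le_less_trans)
qed

lemma emeasure_triple_real: "emeasure \<mu> (triple k x) = ennreal (enn2real (emeasure \<mu> (triple k x)))"
    "0 < enn2real (emeasure \<mu> (triple k x))"
  using triple_finite[of k x] triple_pos[of k x] by (auto simp: enn2real_positive_iff less_top)

lemma mass_eq: "mass f k x = ennreal (avg f k x) * emeasure \<mu> (triple k x)"
proof -
  have "avg f k x * enn2real (emeasure \<mu> (triple k x)) = enn2real (mass f k x)"
    using emeasure_triple_real(2)[of k x] by (simp add: avg_def)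
  then have "ennreal (avg f k x) * ennreal (enn2real (emeasure \<mu> (triple k x))) = ennreal (enn2real (mass f k x))"
    by (simp add: ennreal_mult[symmetric])
  then show ?thesis using mass_finite[of k x] emeasure_triple_real(1)[of k x] by (simp add: less_top)
qed

lemma mass_mono: "j \<le> k \<Longrightarrow> mass f k x \<le> mass f j x"
  unfolding mass_def using triple_mono[of j k x] by (intro nn_integral_mono) (auto simp: indicator_def)

lemma avg_le_ancestor: "avg f k x \<le> dbl N * avg f (k - int N) x"
proof -
  have "ennreal (avg f k x) * emeasure \<mu> (triple k x) \<le> ennreal (avg f (k - int N) x) * emeasure \<mu> (triple (k - int N) x)"
    using mass_mono[of "k - int N" k x] by (simp add: mass_eq)
  also have "\<dots> \<le> ennreal (avg f (k - int N) x) * (ennreal (dbl N) * emeasure \<mu> (triple k x))"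
    using order_trans[OF triple_le_cell mult_left_mono[OF emeasure_mono[OF cell_subset_triple]]]
    by (intro mult_left_mono) auto
  also have "\<dots> = ennreal (dbl N * avg f (k - int N) x) * emeasure \<mu> (triple k x)"
    by (simp add: ennreal_mult' dbl_nonneg mult_ac)
  finally have "ennreal (avg f k x * enn2real (emeasure \<mu> (triple k x)))
      \<le> ennreal (dbl N * avg f (k - int N) x * enn2real (emeasure \<mu> (triple k x)))"
    using emeasure_triple_real[of k x] dbl_nonneg[of N] by (subst (1 2) ennreal_mult) auto
  then show ?thesis using emeasure_triple_real(2)[of k x] dbl_nonneg[of N]
    by (subst (asm) ennreal_le_iff) auto
qed

lemma tail_avg_summable: "summable (\<lambda>i. decay ^ i * avg f (k - int i) x)"
proof (rule summable_comparison_test)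
  define M where "M = enn2real (\<integral>\<^sup>+x. ennreal (norm (f x)) \<partial>\<mu>) / enn2real (emeasure \<mu> (triple k x))"
  show "summable (\<lambda>i. decay ^ i * M)" by (intro summable_mult2 summable_geometric) simp
  have le: "avg f (k - int i) x \<le> M" for i
    unfolding avg_def M_def
  proof (rule frac_le)
    show "enn2real (mass f (k - int i) x) \<le> enn2real (\<integral>\<^sup>+x. ennreal (norm (f x)) \<partial>\<mu>)"
      unfolding mass_def
      by (intro enn2real_mono nn_integral_mono) (use integral_f_finite in \<open>auto simp: indicator_def\<close>)
    show "enn2real (emeasure \<mu> (triple k x)) \<le> enn2real (emeasure \<mu> (triple (k - int i) x))"
      by (intro enn2real_mono emeasure_mono triple_mono) (use triple_finite in auto)
  qed (use emeasure_triple_real(2) in auto)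
  have "norm (decay ^ i * avg f (k - int i) x) \<le> decay ^ i * M" for i
  proof -
    have "norm (decay ^ i * avg f (k - int i) x) = decay ^ i * avg f (k - int i) x" by (simp add: abs_mult)
    also have "\<dots> \<le> decay ^ i * M" by (intro mult_left_mono le) simp
    finally show ?thesis .
  qed
  then show "\<exists>N. \<forall>i\<ge>N. norm (decay ^ i * avg f (k - int i) x) \<le> decay ^ i * M" by blast
qed

lemma tail_avg_nonneg [simp]: "0 \<le> tail_avg f k x"
  unfolding tail_avg_def by (intro suminf_nonneg tail_avg_summable) auto

lemma tail_avg_ge: "decay ^ i * avg f (k - int i) x \<le> tail_avg f k x"
  unfolding tail_avg_def using sum_le_suminf[OF tail_avg_summable, of "{i}" k x] by simp

lemma tail_avg_split: "tail_avg f k x = (\<Sum>i<N. decay ^ i * avg f (k - int i) x) + decay ^ N * tail_avg f (k - int N) x"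
proof -
  have "tail_avg f k x = (\<Sum>i. decay ^ (i + N) * avg f (k - int (i + N)) x) + (\<Sum>i<N. decay ^ i * avg f (k - int i) x)"
    unfolding tail_avg_def by (rule suminf_split_initial_segment[OF tail_avg_summable])
  also have "(\<Sum>i. decay ^ (i + N) * avg f (k - int (i + N)) x) = decay ^ N * tail_avg f (k - int N) x"
    unfolding tail_avg_def by (subst suminf_mult[symmetric, OF tail_avg_summable])
      (simp add: power_add algebra_simps)
  finally show ?thesis by simp
qed

lemma tail_avg_pos:
  assumes "(\<integral>\<^sup>+x. ennreal (norm (f x)) \<partial>\<mu>) \<noteq> 0"
  shows "0 < tail_avg f k x"
proof (rule ccontr)
  assume "\<not> 0 < tail_avg f k x"
  then have "tail_avg f k x = 0" using tail_avg_nonneg[of k x] by linarith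
  then have "decay ^ i * avg f (k - int i) x \<le> 0" for i using tail_avg_ge[of i k x] by simp
  then have "avg f (k - int i) x = 0" for i
    using avg_nonneg[of f "k - int i" x] zero_less_power[OF decay(1), of i]
    by (metis linorder_not_less mult_pos_pos order_antisym)
  then have "mass f (k - int i) x = 0" for i by (simp add: mass_eq)
  then have "AE y in \<mu>. ennreal (norm (f y)) * indicator (triple (k - int i) x) y = 0" for i
    unfolding mass_def by (subst (asm) nn_integral_0_iff_AE) auto
  then have "AE y in \<mu>. \<forall>i. ennreal (norm (f y)) * indicator (triple (k - int i) x) y = 0"
    unfolding AE_all_countable by (rule allI)
  then have "AE y in \<mu>. ennreal (norm (f y)) = 0"
  proof eventually_elim
    case (elim y)
    obtain j where "y \<in> triple (k - int j) x" using mem_triple_ancestor[of y k x] by blast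
    then show ?case using elim[rule_format, of j] by simp
  qed
  then have "(\<integral>\<^sup>+x. ennreal (norm (f x)) \<partial>\<mu>) = 0" by (subst nn_integral_0_iff_AE) auto
  then show False using assms by simp
qed

text \<open>A point \<open>z\<close> outside the triple of the grandparent belongs to a first larger triple, of level \<open>k - (i + 3)\<close>
  say. It is then at distance at least \<open>2\<^bsup>i+1\<^esup>\<close> sides from \<open>y\<close>, so the kernel is at most \<open>c i\<close> there, and the
  power bound turns the mass of that triple into its average.\<close>

lemma theta_tail:
  assumes y: "y \<in> triple k x" and t: "0 < t"
  shows "ennreal (norm (theta \<mu> s t (outer_part (k - 2) x f) y)) \<le> ennreal (tail_const * (t / side k) powr \<alpha> * tail_avg f k x)"
proof -
  define c where "c = (\<lambda>i. C\<^sub>s * t powr \<alpha> / (2 ^ (i + 1) * side k) powr (m + \<alpha>))"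
  have c: "0 \<le> c i" for i using const_nonneg by (simp add: c_def)
  have [measurable]: "(\<lambda>z. s t y z) \<in> borel_measurable borel" by (rule kernel_section_measurable[OF t])
  have "ennreal (norm (theta \<mu> s t (outer_part (k - 2) x f) y)) \<le> (\<integral>\<^sup>+z. ennreal (norm (s t y z * outer_part (k - 2) x f z)) \<partial>\<mu>)"
  proof (cases "integrable \<mu> (\<lambda>z. s t y z * outer_part (k - 2) x f z)")
    case True
    then show ?thesis unfolding theta_def by (rule integral_norm_bound_ennreal)
  next
    case False
    then show ?thesis by (simp add: theta_def not_integrable_integral_eq)
  qed
  also have "\<dots> \<le> (\<integral>\<^sup>+z. (\<Sum>i. ennreal (c i) * (ennreal (norm (f z)) * indicator (triple (k - int (i + 3)) x) z)) \<partial>\<mu>)"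
  proof (rule nn_integral_mono)
    fix z
    let ?F = "\<lambda>i. ennreal (c i) * (ennreal (norm (f z)) * indicator (triple (k - int (i + 3)) x) z)"
    show "ennreal (norm (s t y z * outer_part (k - 2) x f z)) \<le> (\<Sum>i. ?F i)"
    proof (cases "z \<in> triple (k - 2) x")
      case True
      then show ?thesis by (simp add: outer_part_def)
    next
      case False
      define P where "P = (\<lambda>i. z \<in> triple (k - int (i + 3)) x)"
      obtain j0 where "\<forall>j\<ge>j0. z \<in> triple (k - int j) x" using mem_triple_ancestor by blast
      then have "P j0" unfolding P_def by (metis le_add1)
      then have L: "P (LEAST i. P i)" by (rule LeastI)
      define i where "i = (LEAST i. P i)"
      have "z \<notin> triple (k - int (i + 2)) x"
      proof (cases i)
        case 0
        then show ?thesis using False by simp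
      next
        case (Suc i')
        then have "\<not> P i'" using not_less_Least[of i' P] by (simp add: i_def)
        then show ?thesis using Suc by (simp add: P_def add.commute)
      qed
      then obtain a where a: "\<not> \<bar>z $ a - x $ a\<bar> \<le> side (k - int (i + 2))" using mem_triple_of_near by blast
      have "2 ^ (i + 1) * side k \<le> dist y z"
      proof -
        have "1 * side k \<le> 2 ^ i * side k" by (intro mult_right_mono) auto
        moreover have "\<bar>y $ a - x $ a\<bar> \<le> 2 * side k" by (rule triple_near[OF y self_in_cell])
        moreover have "side (k - int (i + 2)) = 4 * (2 ^ i * side k)" by (subst side_minus_nat) (simp add: power_add)
        moreover have "\<bar>(y - z) $ a\<bar> \<le> dist y z" using component_le_norm_cart[of "y - z" a] by (simp add: dist_norm)
        ultimately have "2 * (2 ^ i * side k) \<le> dist y z" using a by (simp only: vector_minus_component)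
        then show ?thesis by simp
      qed
      then have "(2 ^ (i + 1) * side k) powr (m + \<alpha>) \<le> (t + dist y z) powr (m + \<alpha>)"
        using m \<alpha> t by (intro powr_mono2) auto
      then have "C\<^sub>s * (t powr \<alpha> / (t + dist y z) powr (m + \<alpha>)) \<le> C\<^sub>s * (t powr \<alpha> / (2 ^ (i + 1) * side k) powr (m + \<alpha>))"
        using const_nonneg t by (intro mult_left_mono divide_left_mono) (auto intro!: mult_pos_pos)
      then have "norm (s t y z) \<le> c i" using kernel_bound[OF t, of y z] by (simp add: c_def)
      then have "norm (s t y z * outer_part (k - 2) x f z) \<le> c i * norm (f z)"
        using False by (simp add: outer_part_def norm_mult mult_right_mono)
      then have "ennreal (norm (s t y z * outer_part (k - 2) x f z)) \<le> ennreal (c i) * ennreal (norm (f z))"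
        using c by (simp add: ennreal_leI flip: ennreal_mult)
      also have "\<dots> = ?F i" using L by (simp add: P_def i_def)
      also have "\<dots> \<le> (\<Sum>i. ?F i)" by (rule le_suminf_ennreal)
      finally show ?thesis .
    qed
  qed
  also have "\<dots> = (\<Sum>i. ennreal (c i) * mass f (k - int (i + 3)) x)"
    unfolding mass_def by (subst nn_integral_suminf) (auto intro!: suminf_cong nn_integral_cmult)
  also have "\<dots> \<le> (\<Sum>i. ennreal (tail_const * (t / side k) powr \<alpha> * (decay ^ (i + 3) * avg f (k - int (i + 3)) x)))"
  proof (rule suminf_le)
    fix i
    have "ennreal (c i) * mass f (k - int (i + 3)) x \<le> ennreal (c i) * (ennreal (avg f (k - int (i + 3)) x) *
        ennreal (triple_power_const * side (k - int (i + 3)) powr m))"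
      unfolding mass_eq by (intro mult_left_mono triple_power) auto
    also have "\<dots> = ennreal (c i * (triple_power_const * (side k * 2 ^ (i + 3)) powr m) * avg f (k - int (i + 3)) x)"
      unfolding side_minus_nat using c triple_power_const_nonneg by (simp add: mult_ac flip: ennreal_mult)
    also have "c i * (triple_power_const * (side k * 2 ^ (i + 3)) powr m) = tail_const * (t / side k) powr \<alpha> * decay ^ (i + 3)"
      unfolding c_def tail_const_def decay_def by (rule tail_coefficient[OF t]) simp
    finally show "ennreal (c i) * mass f (k - int (i + 3)) x
      \<le> ennreal (tail_const * (t / side k) powr \<alpha> * (decay ^ (i + 3) * avg f (k - int (i + 3)) x))"
      by (simp add: mult.assoc)
  qed auto
  also have "\<dots> = ennreal (\<Sum>i. tail_const * (t / side k) powr \<alpha> * (decay ^ (i + 3) * avg f (k - int (i + 3)) x))"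
  proof (rule suminf_ennreal2)
    show "summable (\<lambda>i. tail_const * (t / side k) powr \<alpha> * (decay ^ (i + 3) * avg f (k - int (i + 3)) x))"
      using summable_ignore_initial_segment[OF tail_avg_summable, of 3 k x] by (rule summable_mult)
  qed (use tail_const_nonneg in auto)
  also have "\<dots> \<le> ennreal (tail_const * (t / side k) powr \<alpha> * tail_avg f k x)"
  proof (rule ennreal_leI)
    have "(\<Sum>i. decay ^ (i + 3) * avg f (k - int (i + 3)) x) \<le> tail_avg f k x"
      unfolding tail_avg_def suminf_split_initial_segment[OF tail_avg_summable, of k x 3] by (simp add: sum_nonneg)
    then have "tail_const * (t / side k) powr \<alpha> * (\<Sum>i. decay ^ (i + 3) * avg f (k - int (i + 3)) x)
      \<le> tail_const * (t / side k) powr \<alpha> * tail_avg f k x"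
      using tail_const_nonneg by (intro mult_left_mono) auto
    then show "(\<Sum>i. tail_const * (t / side k) powr \<alpha> * (decay ^ (i + 3) * avg f (k - int (i + 3)) x))
      \<le> tail_const * (t / side k) powr \<alpha> * tail_avg f k x"
      by (subst suminf_mult) (use summable_ignore_initial_segment[OF tail_avg_summable, of 3 k x] in auto)
  qed
  finally show ?thesis .
qed

text \<open>The factor \<open>(t / side k)\<^sup>\<alpha>\<close> of the kernel makes the energies decay geometrically in the level.\<close>

lemma Dsq_tail:
  assumes z: "z \<in> cell k x"
  shows "Dsq (outer_part (k - 2) x f) k z \<le> ennreal (tail_sq_const * (tail_avg f k x)\<^sup>2)"
proof -
  have side_j: "side (k + int j) = side k * (1 / 2) ^ j" for j
    by (simp add: side_def powr_diff powr_add powr_realpow powr_minus field_simps)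
  let ?a = "tail_const * tail_avg f k x"
  have "energy (outer_part (k - 2) x f) (k + int j) z \<le> ennreal (?a\<^sup>2 * triple_power_const * 2 powr m * (decay\<^sup>2) ^ j)" for j
  proof -
    let ?sd = "side (k + int j)"
    have ratio: "(?sd / side k) powr \<alpha> = decay ^ j"
    proof -
      have "(?sd / side k) powr \<alpha> = ((1 / 2) ^ j) powr \<alpha>" by (simp add: side_j)
      also have "\<dots> = 2 powr (- \<alpha> * real j)" 
        by (simp add: powr_realpow[symmetric] powr_powr powr_minus[symmetric] powr_divide mult.commute)
          (simp add: powr_minus_divide mult.commute)
      also have "\<dots> = decay ^ j" by (simp add: decay_def powr_powr powr_realpow[symmetric] mult.commute)
      finally show ?thesis .
    qed
    have "dens (outer_part (k - 2) x f) q * indicator (box (k + int j) z) q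
        \<le> ennreal ((?a * decay ^ j)\<^sup>2 / (?sd / 2) powr (m + 1)) * indicator (box (k + int j) z) q" for q
    proof (cases "q \<in> box (k + int j) z")
      case True
      obtain y t where q: "q = (y, t)" by (cases q)
      have y: "y \<in> triple k x" and t: "?sd / 2 < t" "t \<le> ?sd"
      proof -
        have "y \<in> triple (k + int j) z" using True q by (simp add: box_def)
        then have "y \<in> triple k z" using triple_mono[of k "k + int j" z] by auto
        then show "y \<in> triple k x" using z triple_cong[of k z x] by (simp add: cell_def)
      qed (use True q in \<open>auto simp: box_def\<close>)
      have t0: "0 < t" using t side_pos(1)[of "k + int j"] by linarith
      have "ennreal (norm (theta \<mu> s t (outer_part (k - 2) x f) y)) \<le> ennreal (tail_const * (t / side k) powr \<alpha> * tail_avg f k x)"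
        by (rule theta_tail[OF y t0])
      then have "norm (theta \<mu> s t (outer_part (k - 2) x f) y) \<le> tail_const * (t / side k) powr \<alpha> * tail_avg f k x"
        using tail_const_nonneg by (subst (asm) ennreal_le_iff) auto
      also have "\<dots> \<le> tail_const * (?sd / side k) powr \<alpha> * tail_avg f k x"
        using tail_const_nonneg t t0 \<alpha> by (intro mult_right_mono mult_left_mono powr_mono2 divide_right_mono) auto
      finally have "norm (theta \<mu> s t (outer_part (k - 2) x f) y) \<le> ?a * decay ^ j" unfolding ratio by (simp add: mult_ac)
      then have "(norm (theta \<mu> s t (outer_part (k - 2) x f) y))\<^sup>2 / t powr (m + 1) \<le> (?a * decay ^ j)\<^sup>2 / (?sd / 2) powr (m + 1)"
        using t t0 m by (intro frac_le power_mono powr_mono2) auto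
      then show ?thesis using True t0 q by (simp add: dens_def ennreal_leI)
    qed simp
    then have "energy (outer_part (k - 2) x f) (k + int j) z
      \<le> (\<integral>\<^sup>+q. ennreal ((?a * decay ^ j)\<^sup>2 / (?sd / 2) powr (m + 1)) * indicator (box (k + int j) z) q \<partial>(\<mu> \<Otimes>\<^sub>M lborel))"
      unfolding energy_def by (intro nn_integral_mono)
    also have "\<dots> = ennreal ((?a * decay ^ j)\<^sup>2 / (?sd / 2) powr (m + 1)) * (emeasure \<mu> (triple (k + int j) z) * ennreal (?sd / 2))"
      by (subst nn_integral_cmult_indicator) (auto simp: box_def \<mu>L.M2.emeasure_pair_measure_Times)
    also have "\<dots> \<le> ennreal ((?a * decay ^ j)\<^sup>2 / (?sd / 2) powr (m + 1)) * (ennreal (triple_power_const * ?sd powr m) * ennreal (?sd / 2))"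
      by (intro mult_left_mono mult_right_mono triple_power) auto
    also have "\<dots> = ennreal ((?a * decay ^ j)\<^sup>2 / (?sd / 2) powr (m + 1) * (triple_power_const * ?sd powr m * (?sd / 2)))"
      using triple_power_const_nonneg by (intro ennreal_mult3) auto
    also have "(?a * decay ^ j)\<^sup>2 / (?sd / 2) powr (m + 1) * (triple_power_const * ?sd powr m * (?sd / 2))
      = ?a\<^sup>2 * triple_power_const * 2 powr m * (decay\<^sup>2) ^ j"
      by (rule box_coefficient) simp
    finally show ?thesis .
  qed
  then have "Dsq (outer_part (k - 2) x f) k z \<le> (\<Sum>j. ennreal (?a\<^sup>2 * triple_power_const * 2 powr m * (decay\<^sup>2) ^ j))"
    unfolding Dsq_def by (intro suminf_le) auto
  also have "\<dots> = ennreal (\<Sum>j. ?a\<^sup>2 * triple_power_const * 2 powr m * (decay\<^sup>2) ^ j)"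
    using triple_power_const_nonneg decay_sq by (intro suminf_ennreal2) (auto intro!: summable_mult summable_geometric)
  also have "(\<Sum>j. ?a\<^sup>2 * triple_power_const * 2 powr m * (decay\<^sup>2) ^ j) = tail_sq_const * (tail_avg f k x)\<^sup>2"
    using decay_sq by (subst suminf_mult) (auto simp: suminf_geometric tail_sq_const_def power_mult_distrib summable_geometric)
  finally show ?thesis .
qed

lemma kernel_integrable:
  assumes t: "0 < t" and h: "integrable \<mu> h" "h \<in> borel_measurable borel"
  shows "integrable \<mu> (\<lambda>z. s t y z * h z)"
proof (rule Bochner_Integration.integrable_bound)
  have [measurable]: "(\<lambda>z. s t y z) \<in> borel_measurable borel" by (rule kernel_section_measurable[OF t])
  have [measurable]: "h \<in> borel_measurable borel" by fact
  define K where "K = C\<^sub>s * (t powr \<alpha> / t powr (m + \<alpha>))"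
  show "integrable \<mu> (\<lambda>z. K * norm (h z))" using h by (intro integrable_mult_right integrable_norm)
  show "(\<lambda>z. s t y z * h z) \<in> borel_measurable \<mu>" by measurable
  have K: "norm (s t y z) \<le> K" for z
  proof -
    have "t + dist y z \<noteq> 0" using t zero_le_dist[of y z] by linarith
    then have "C\<^sub>s * (t powr \<alpha> / (t + dist y z) powr (m + \<alpha>)) \<le> K"
      unfolding K_def using t m \<alpha> const_nonneg
      by (intro mult_left_mono divide_left_mono powr_mono2) (auto intro!: mult_pos_pos)
    then show ?thesis using kernel_bound[OF t, of y z] by linarith
  qed
  show "AE z in \<mu>. norm (s t y z * h z) \<le> norm (K * norm (h z))"
  proof (rule AE_I2)
    fix z
    have "norm (s t y z * h z) \<le> K * norm (h z)" using K by (simp add: norm_mult mult_right_mono)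
    then show "norm (s t y z * h z) \<le> norm (K * norm (h z))" by (simp only: real_norm_def)
  qed
qed

lemma inner_outer_integrable: "integrable \<mu> (inner_part k x f)" "integrable \<mu> (outer_part k x f)"
  "inner_part k x f \<in> borel_measurable borel" "outer_part k x f \<in> borel_measurable borel"
proof -
  show m1: "inner_part k x f \<in> borel_measurable borel" and m2: "outer_part k x f \<in> borel_measurable borel"
    unfolding inner_part_def outer_part_def by measurable
  show "integrable \<mu> (inner_part k x f)" "integrable \<mu> (outer_part k x f)"
    by (rule Bochner_Integration.integrable_bound[OF f];
        use m1 m2 in \<open>auto simp: inner_part_def outer_part_def indicator_def measurable_cong_sets[OF sets_mu]\<close>)+
qed

lemma Dsq_split: "Dsq f k y \<le> 2 * Dsq (inner_part j x f) k y + 2 * Dsq (outer_part j x f) k y"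
proof -
  note [measurable] = inner_outer_integrable(3,4)[of j x]
  have dens: "dens f q \<le> 2 * dens (inner_part j x f) q + 2 * dens (outer_part j x f) q" for q
  proof (cases "0 < snd q")
    case True
    let ?a = "theta \<mu> s (snd q) (inner_part j x f) (fst q)" and ?b = "theta \<mu> s (snd q) (outer_part j x f) (fst q)"
    have "theta \<mu> s (snd q) f (fst q) = ?a + ?b"
    proof -
      have i: "integrable \<mu> (\<lambda>z. s (snd q) (fst q) z * inner_part j x f z)" "integrable \<mu> (\<lambda>z. s (snd q) (fst q) z * outer_part j x f z)"
        by (rule kernel_integrable[OF True]; rule inner_outer_integrable)+
      have "s (snd q) (fst q) z * f z = s (snd q) (fst q) z * inner_part j x f z + s (snd q) (fst q) z * outer_part j x f z" for z
        by (simp add: inner_part_def outer_part_def indicator_def)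
      then show ?thesis unfolding theta_def using Bochner_Integration.integral_add[OF i] by simp
    qed
    then have "norm (theta \<mu> s (snd q) f (fst q)) \<le> norm ?a + norm ?b" by (simp add: norm_triangle_ineq)
    then have "(norm (theta \<mu> s (snd q) f (fst q)))\<^sup>2 \<le> (norm ?a + norm ?b)\<^sup>2" by (intro power_mono) auto
    also have "\<dots> \<le> 2 * (norm ?a)\<^sup>2 + 2 * (norm ?b)\<^sup>2"
      using sum_squares_bound[of "norm ?a" "norm ?b"] by (simp add: power2_sum)
    finally have "(norm (theta \<mu> s (snd q) f (fst q)))\<^sup>2 / snd q powr (m + 1)
      \<le> 2 * ((norm ?a)\<^sup>2 / snd q powr (m + 1)) + 2 * ((norm ?b)\<^sup>2 / snd q powr (m + 1))"
      by (simp add: add_divide_distrib[symmetric] divide_right_mono)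
    then have "ennreal ((norm (theta \<mu> s (snd q) f (fst q)))\<^sup>2 / snd q powr (m + 1))
      \<le> ennreal (2 * ((norm ?a)\<^sup>2 / snd q powr (m + 1)) + 2 * ((norm ?b)\<^sup>2 / snd q powr (m + 1)))"
      by (rule ennreal_leI)
    also have "\<dots> = 2 * ennreal ((norm ?a)\<^sup>2 / snd q powr (m + 1)) + 2 * ennreal ((norm ?b)\<^sup>2 / snd q powr (m + 1))"
      by (subst ennreal_plus) (simp_all only: ennreal_2_mult mult_nonneg_nonneg divide_nonneg_nonneg zero_le_power2 powr_ge_zero zero_le_numeral)
    finally show ?thesis using True by (simp add: dens_def case_prod_beta')
  qed (simp add: dens_def case_prod_beta')
  have "energy f i y \<le> 2 * energy (inner_part j x f) i y + 2 * energy (outer_part j x f) i y" for i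
  proof -
    have "energy f i y \<le> (\<integral>\<^sup>+q. 2 * (dens (inner_part j x f) q * indicator (box i y) q) + 2 * (dens (outer_part j x f) q * indicator (box i y) q) \<partial>(\<mu> \<Otimes>\<^sub>M lborel))"
      unfolding energy_def by (intro nn_integral_mono) (use dens in \<open>auto simp: indicator_def\<close>)
    also have "\<dots> = 2 * energy (inner_part j x f) i y + 2 * energy (outer_part j x f) i y"
      unfolding energy_def by (subst nn_integral_add) (auto simp: nn_integral_cmult)
    finally show ?thesis .
  qed
  then have "Dsq f k y \<le> (\<Sum>i. 2 * energy (inner_part j x f) (k + int i) y + 2 * energy (outer_part j x f) (k + int i) y)"
    unfolding Dsq_def by (intro suminf_le) auto
  also have "\<dots> = (\<Sum>i. 2 * energy (inner_part j x f) (k + int i) y) + (\<Sum>i. 2 * energy (outer_part j x f) (k + int i) y)"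
    by (rule suminf_add[symmetric]) auto
  also have "\<dots> = 2 * Dsq (inner_part j x f) k y + 2 * Dsq (outer_part j x f) k y"
    by (simp add: Dsq_def ennreal_suminf_cmult)
  finally show ?thesis .
qed

end

section \<open>Pointwise domination along the stopping cells\<close>

lemma sum_split_at:
  fixes g :: "nat \<Rightarrow> 'a :: comm_monoid_add"
  assumes "k \<le> J"
  shows "(\<Sum>i\<le>J. g i) = (\<Sum>i<k. g i) + (\<Sum>i\<in>{k..J}. g i)"
proof -
  have "{..J} = {..<k} \<union> {k..J}" using assms by auto
  moreover have "{..<k} \<inter> {k..J} = {}" by auto
  ultimately show ?thesis using sum.union_disjoint[of "{..<k}" "{k..J}" g] by simp
qed

text \<open>If each summand is controlled by its own main part and by the summand of an earlier index, with
  a small factor, and no index is used too often, then the square sum of the main parts controls the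
  whole square sum.\<close>

lemma square_sum_absorption:
  fixes a g :: "nat \<Rightarrow> real" and \<rho> :: "nat \<Rightarrow> nat"
  assumes S: "finite S" and nonneg: "\<And>k. 0 \<le> a k" "\<And>k. 0 \<le> g k" "0 \<le> q" "0 \<le> e"
    and small: "\<And>k. k \<in> S \<Longrightarrow> k < N \<Longrightarrow> a k \<le> g k + e"
    and large: "\<And>k. k \<in> S \<Longrightarrow> N \<le> k \<Longrightarrow> a k \<le> g k + q * a (\<rho> k)" "\<And>k. k \<in> S \<Longrightarrow> N \<le> k \<Longrightarrow> \<rho> k \<in> S"
    and fibres: "\<And>i. i \<in> S \<Longrightarrow> card {k\<in>S. N \<le> k \<and> \<rho> k = i} \<le> N"
    and q: "2 * real N * q\<^sup>2 \<le> 1 / 2"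
  shows "(\<Sum>k\<in>S. (a k)\<^sup>2) \<le> 4 * (\<Sum>k\<in>S. (g k)\<^sup>2) + 4 * real N * e\<^sup>2"
proof -
  have sq: "(x + y)\<^sup>2 \<le> 2 * x\<^sup>2 + 2 * y\<^sup>2" for x y :: real
    using sum_squares_bound[of x y] by (simp add: power2_sum)
  let ?L = "{k\<in>S. N \<le> k}" and ?M = "{k\<in>S. k < N}"
  have "(\<Sum>k\<in>S. (a k)\<^sup>2) \<le> (\<Sum>k\<in>S. 2 * (g k)\<^sup>2 + (if k < N then 2 * e\<^sup>2 else 2 * q\<^sup>2 * (a (\<rho> k))\<^sup>2))"
  proof (rule sum_mono)
    fix k assume k: "k \<in> S"
    show "(a k)\<^sup>2 \<le> 2 * (g k)\<^sup>2 + (if k < N then 2 * e\<^sup>2 else 2 * q\<^sup>2 * (a (\<rho> k))\<^sup>2)"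
    proof (cases "k < N")
      case True
      have "(a k)\<^sup>2 \<le> (g k + e)\<^sup>2" using small[OF k True] nonneg by (intro power_mono) auto
      then show ?thesis using sq[of "g k" e] True by simp
    next
      case False
      have "(a k)\<^sup>2 \<le> (g k + q * a (\<rho> k))\<^sup>2" using large(1)[OF k] False nonneg by (intro power_mono) auto
      then show ?thesis using sq[of "g k" "q * a (\<rho> k)"] False by (simp add: power_mult_distrib)
    qed
  qed
  also have "\<dots> = 2 * (\<Sum>k\<in>S. (g k)\<^sup>2) + (\<Sum>k\<in>?M. 2 * e\<^sup>2) + (\<Sum>k\<in>?L. 2 * q\<^sup>2 * (a (\<rho> k))\<^sup>2)"
  proof -
    have "(\<Sum>k\<in>S. if k < N then 2 * e\<^sup>2 else 2 * q\<^sup>2 * (a (\<rho> k))\<^sup>2) = (\<Sum>k\<in>?M. 2 * e\<^sup>2) + (\<Sum>k\<in>?L. 2 * q\<^sup>2 * (a (\<rho> k))\<^sup>2)"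
      using S by (subst sum.If_cases) (auto simp: Int_def not_less)
    then show ?thesis by (simp add: sum.distrib sum_distrib_left)
  qed
  also have "(\<Sum>k\<in>?M. 2 * e\<^sup>2) \<le> 2 * real N * e\<^sup>2"
  proof -
    have "card ?M \<le> card {..<N}" by (intro card_mono) auto
    then have "real (card ?M) * (2 * e\<^sup>2) \<le> real N * (2 * e\<^sup>2)" by (intro mult_right_mono) auto
    then show ?thesis by simp
  qed
  also have "(\<Sum>k\<in>?L. 2 * q\<^sup>2 * (a (\<rho> k))\<^sup>2) \<le> 1 / 2 * (\<Sum>k\<in>S. (a k)\<^sup>2)"
  proof -
    have "(\<Sum>k\<in>?L. (a (\<rho> k))\<^sup>2) = (\<Sum>i\<in>S. \<Sum>k\<in>{k\<in>?L. \<rho> k = i}. (a (\<rho> k))\<^sup>2)"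
      using S large(2) by (intro sum.group[symmetric]) auto
    also have "\<dots> = (\<Sum>i\<in>S. real (card {k\<in>S. N \<le> k \<and> \<rho> k = i}) * (a i)\<^sup>2)"
    proof (rule sum.cong[OF refl])
      fix i
      have "{k\<in>?L. \<rho> k = i} = {k\<in>S. N \<le> k \<and> \<rho> k = i}" by auto
      then show "(\<Sum>k\<in>{k\<in>?L. \<rho> k = i}. (a (\<rho> k))\<^sup>2) = real (card {k\<in>S. N \<le> k \<and> \<rho> k = i}) * (a i)\<^sup>2"
        by simp
    qed
    also have "\<dots> \<le> (\<Sum>i\<in>S. real N * (a i)\<^sup>2)"
      using fibres by (intro sum_mono mult_right_mono) auto
    finally have "2 * q\<^sup>2 * (\<Sum>k\<in>?L. (a (\<rho> k))\<^sup>2) \<le> 2 * q\<^sup>2 * (\<Sum>i\<in>S. real N * (a i)\<^sup>2)"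
      by (intro mult_left_mono) auto
    also have "\<dots> = (2 * real N * q\<^sup>2) * (\<Sum>i\<in>S. (a i)\<^sup>2)" by (simp add: sum_distrib_left mult_ac)
    also have "\<dots> \<le> 1 / 2 * (\<Sum>i\<in>S. (a i)\<^sup>2)" using q by (intro mult_right_mono sum_nonneg) auto
    finally show ?thesis by (simp only: sum_distrib_left[symmetric])
  qed
  finally show ?thesis by simp
qed

context conical
begin

lemma dbl_mono: "M \<le> N \<Longrightarrow> dbl M \<le> dbl N"
  unfolding dbl_def using doubling_const_ge_1 by (intro power_increasing) auto

definition chain_const where "chain_const = stop_const / (1 - decay) + 1"

lemma chain_const_nonneg: "0 \<le> chain_const"
  using stop_const(1) decay(3) by (simp add: chain_const_def)

text \<open>\<open>depth\<close> is the number of ancestors whose averages are kept; the smallness is that of the remaining tail,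
  which is used at most \<open>depth\<close> times.\<close>

lemma depth_exists: "\<exists>N::nat. 1 \<le> N \<and> 2 * real N * (decay ^ N * chain_const)\<^sup>2 \<le> 1 / 2"
proof -
  have "(\<lambda>N. real N * (decay\<^sup>2) ^ N) \<longlonglongrightarrow> 0"
    by (rule powser_times_n_limit_0) (use decay_sq in simp)
  then have "(\<lambda>N. 2 * chain_const\<^sup>2 * (real N * (decay\<^sup>2) ^ N)) \<longlonglongrightarrow> 2 * chain_const\<^sup>2 * 0"
    by (intro tendsto_intros)
  then have "eventually (\<lambda>N. 2 * chain_const\<^sup>2 * (real N * (decay\<^sup>2) ^ N) < 1 / 2) sequentially"
    by (rule order_tendstoD(2)) simp
  then have "eventually (\<lambda>N. 1 \<le> N \<and> 2 * chain_const\<^sup>2 * (real N * (decay\<^sup>2) ^ N) < 1 / 2) sequentially"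
    by (intro eventually_conj eventually_ge_at_top)
  then obtain N where N: "1 \<le> N" "2 * chain_const\<^sup>2 * (real N * (decay\<^sup>2) ^ N) < 1 / 2"
    by (auto simp: eventually_sequentially)
  have "(decay ^ N * chain_const)\<^sup>2 = chain_const\<^sup>2 * (decay\<^sup>2) ^ N"
    by (simp add: power_mult_distrib power_mult[symmetric] mult.commute)
  then have "2 * real N * (decay ^ N * chain_const)\<^sup>2 = 2 * chain_const\<^sup>2 * (real N * (decay\<^sup>2) ^ N)" by (simp only: mult_ac)
  then have "2 * real N * (decay ^ N * chain_const)\<^sup>2 \<le> 1 / 2" using N(2) by linarith
  then show ?thesis using N(1) by blast
qed

definition depth :: nat where
  "depth = (SOME N. 1 \<le> N \<and> 2 * real N * (decay ^ N * chain_const)\<^sup>2 \<le> 1 / 2)"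

definition main_const where "main_const = 4 * (stop_const * (real depth * dbl depth))\<^sup>2"

definition top_const where "top_const = 4 * real depth * stop_const\<^sup>2"

lemma depth: "1 \<le> depth" "2 * real depth * (decay ^ depth * chain_const)\<^sup>2 \<le> 1 / 2"
  using someI_ex[OF depth_exists] by (simp_all add: depth_def)

end

context conical_function
begin

text \<open>Both ways of being bad are rare: the square function by its weak type (1,1) and the tail estimate,
  the averages by the maximal theorem.\<close>

lemma bad_small:
  assumes pos: "0 < tail_avg f k x"
  shows "\<exists>X\<in>sets borel. (\<forall>y\<in>cell k x. bad f k y \<longrightarrow> y \<in> X) \<and> emeasure \<mu> (cell k x) \<le> 2 * emeasure \<mu> (cell k x - X)"
proof -
  let ?K = stop_const and ?a = "tail_avg f k x"
  define l where "l = ?K * ?a"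
  have K: "0 < ?K" using stop_const(1) by linarith
  have l: "0 < l" using K pos by (simp add: l_def)
  obtain c where c: "emeasure \<mu> (cell k x) = ennreal c" "0 < c"
    using cell_finite[of k x] cell_pos[of k x] by (cases "emeasure \<mu> (cell k x)") auto
  note [measurable] = inner_outer_integrable(3,4)
  have mass_le: "mass f (k - int N) x \<le> ennreal (avg f (k - int N) x * (dbl N * c))" for N
  proof -
    have "mass f (k - int N) x \<le> ennreal (avg f (k - int N) x) * (ennreal (dbl N) * ennreal c)"
      unfolding mass_eq using triple_le_cell[of k N x] c by (intro mult_left_mono) auto
    also have "\<dots> = ennreal (avg f (k - int N) x * (dbl N * c))"
      using c dbl_nonneg by (intro ennreal_mult3) auto
    finally show ?thesis .
  qed
  define X1 where "X1 = {y. ennreal ((l / 2)\<^sup>2) < Dsq (inner_part (k - 2) x f) k y}"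
  have X1 [measurable]: "X1 \<in> sets borel" unfolding X1_def by measurable
  have "ennreal (l / 2) * emeasure \<mu> X1 \<le> ennreal weak_const * (\<integral>\<^sup>+y. ennreal (norm (inner_part (k - 2) x f y)) \<partial>\<mu>)"
    unfolding X1_def by (rule Dsq_weak_type[OF inner_outer_integrable(1,3)]) (use l in simp)
  also have "(\<integral>\<^sup>+y. ennreal (norm (inner_part (k - 2) x f y)) \<partial>\<mu>) = mass f (k - int 2) x"
    unfolding mass_def by (intro nn_integral_cong) (auto simp: inner_part_def indicator_def)
  also have "ennreal weak_const * mass f (k - int 2) x \<le> ennreal weak_const * ennreal (avg f (k - int 2) x * (dbl 2 * c))"
    by (intro mult_left_mono mass_le) simp
  also have "\<dots> = ennreal (weak_const * (avg f (k - int 2) x * (dbl 2 * c)))"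
    using weak_const_nonneg c dbl_nonneg[of 2] by (intro ennreal_mult[symmetric]) auto
  also have "\<dots> \<le> ennreal (l / 8 * c)"
  proof (rule ennreal_leI)
    have "avg f (k - int 2) x \<le> ?a / decay\<^sup>2"
      using tail_avg_ge[of 2 k x] by (simp add: pos_le_divide_eq mult.commute)
    then have "weak_const * (avg f (k - int 2) x * (dbl 2 * c)) \<le> weak_const * (?a / decay\<^sup>2 * (dbl 2 * c))"
      using weak_const_nonneg dbl_nonneg[of 2] c by (intro mult_left_mono mult_right_mono) auto
    also have "\<dots> = (8 * weak_const * dbl 2 / decay\<^sup>2) * (?a / 8 * c)" by simp
    also have "\<dots> \<le> ?K * (?a / 8 * c)" using pos c by (intro mult_right_mono stop_const) auto
    finally show "weak_const * (avg f (k - int 2) x * (dbl 2 * c)) \<le> l / 8 * c" by (simp add: l_def)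
  qed
  finally have "emeasure \<mu> X1 \<le> ennreal (l / 8 * c / (l / 2))"
    using l c by (intro le_of_ennreal_mult_le) auto
  then have m1: "emeasure \<mu> X1 \<le> ennreal (c / 4)" using l by simp
  define g where "g = (\<lambda>y. ennreal (norm (f y)) * indicator (triple k x) y)"
  have g [measurable]: "g \<in> borel_measurable borel" unfolding g_def by measurable
  define X2 where "X2 = {y. \<exists>j\<in>UNIV. ennreal l * emeasure \<mu> (triple j y) \<le> (\<integral>\<^sup>+z. g z * indicator (triple j y) z \<partial>\<mu>)}"
  have X2 [measurable]: "X2 \<in> sets borel" unfolding X2_def by (rule maximal_weak_type_pointwise(1)[OF sets_mu g])
  have "ennreal l * emeasure \<mu> X2 \<le> 4 ^ CARD('n) * (\<integral>\<^sup>+z. g z \<partial>\<mu>)"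
    unfolding X2_def by (rule maximal_weak_type_pointwise(2)[OF sets_mu g])
  also have "(\<integral>\<^sup>+z. g z \<partial>\<mu>) = mass f (k - int 0) x" by (simp add: g_def mass_def)
  also have "4 ^ CARD('n) * mass f (k - int 0) x \<le> 4 ^ CARD('n) * ennreal (avg f (k - int 0) x * (dbl 0 * c))"
    by (intro mult_left_mono mass_le) simp
  also have "\<dots> = ennreal (4 ^ n * (avg f k x * (dbl 0 * c)))"
    using c dbl_nonneg[of 0] by (subst ennreal_mult) (auto simp: n ennreal_power[symmetric])
  also have "\<dots> \<le> ennreal (l / 4 * c)"
  proof (rule ennreal_leI)
    have "avg f k x \<le> ?a" using tail_avg_ge[of 0 k x] by simp
    then have "4 ^ n * (avg f k x * (dbl 0 * c)) \<le> 4 ^ n * (?a * (dbl 0 * c))"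
      using dbl_nonneg[of 0] c by (intro mult_left_mono mult_right_mono) auto
    also have "\<dots> = (4 * 4 ^ n * dbl 0) * (?a / 4 * c)" by simp
    also have "\<dots> \<le> ?K * (?a / 4 * c)" using pos c by (intro mult_right_mono stop_const) auto
    finally show "4 ^ n * (avg f k x * (dbl 0 * c)) \<le> l / 4 * c" by (simp add: l_def)
  qed
  finally have "emeasure \<mu> X2 \<le> ennreal (l / 4 * c / l)"
    using l c by (intro le_of_ennreal_mult_le) auto
  then have m2: "emeasure \<mu> X2 \<le> ennreal (c / 4)" using l by simp
  have "y \<in> X1 \<union> X2" if y: "y \<in> cell k x" and b: "bad f k y" for y
  proof (rule ccontr)
    assume "y \<notin> X1 \<union> X2"
    then have y1: "Dsq (inner_part (k - 2) x f) k y \<le> ennreal ((l / 2)\<^sup>2)" and y2: "y \<notin> X2" by (auto simp: X1_def not_less)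
    have idx: "idx k y = idx k x" using y by (simp add: cell_def)
    have Ay: "tail_avg f k y = ?a" by (rule tail_avg_cong[OF idx])
    have "Dsq f k y \<le> 2 * Dsq (inner_part (k - 2) x f) k y + 2 * Dsq (outer_part (k - 2) x f) k y" by (rule Dsq_split)
    also have "\<dots> \<le> 2 * ennreal ((l / 2)\<^sup>2) + 2 * ennreal (tail_sq_const * ?a\<^sup>2)"
      by (intro add_mono mult_left_mono y1 Dsq_tail y) auto
    also have "\<dots> = ennreal (2 * (l / 2)\<^sup>2 + 2 * (tail_sq_const * ?a\<^sup>2))"
      using tail_sq_const_nonneg by (subst ennreal_plus) (auto simp: ennreal_2_mult)
    also have "\<dots> \<le> ennreal (l\<^sup>2)"
    proof (rule ennreal_leI)
      have "(4 * tail_sq_const) * ?a\<^sup>2 \<le> ?K\<^sup>2 * ?a\<^sup>2" by (intro mult_right_mono stop_const) auto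
      then have "4 * (tail_sq_const * ?a\<^sup>2) \<le> l\<^sup>2" by (simp add: l_def power_mult_distrib mult.assoc)
      then show "2 * (l / 2)\<^sup>2 + 2 * (tail_sq_const * ?a\<^sup>2) \<le> l\<^sup>2" by (simp add: power_divide)
    qed
    finally have "\<not> ennreal ((?K * tail_avg f k y)\<^sup>2) < Dsq f k y" by (simp add: Ay l_def not_less)
    then obtain j where j: "l < avg f (k + int j) y" using b by (auto simp: bad_def Ay l_def)
    have "ennreal l * emeasure \<mu> (triple (k + int j) y) \<le> mass f (k + int j) y"
      unfolding mass_eq using j l by (intro mult_right_mono ennreal_leI) auto
    also have "\<dots> = (\<integral>\<^sup>+z. g z * indicator (triple (k + int j) y) z \<partial>\<mu>)"
    proof -
      have "triple (k + int j) y \<subseteq> triple k x" using triple_mono[of k "k + int j" y] triple_cong[OF idx] by simp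
      then show ?thesis unfolding mass_def g_def by (intro nn_integral_cong) (auto simp: indicator_def)
    qed
    finally have "y \<in> X2" by (auto simp: X2_def)
    then show False using y2 by simp
  qed
  moreover have "emeasure \<mu> (cell k x) \<le> 2 * emeasure \<mu> (cell k x - (X1 \<union> X2))"
  proof -
    let ?d = "emeasure \<mu> (cell k x - (X1 \<union> X2))"
    have "emeasure \<mu> (cell k x) \<le> emeasure \<mu> ((cell k x - (X1 \<union> X2)) \<union> (X1 \<union> X2))"
      by (intro emeasure_mono) auto
    also have "\<dots> \<le> ?d + emeasure \<mu> (X1 \<union> X2)" by (intro emeasure_subadditive) auto
    also have "emeasure \<mu> (X1 \<union> X2) \<le> emeasure \<mu> X1 + emeasure \<mu> X2" by (intro emeasure_subadditive) auto
    also have "\<dots> \<le> ennreal (c / 4) + ennreal (c / 4)" by (intro add_mono m1 m2)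
    also have "\<dots> = ennreal (c / 2)" using c by (subst ennreal_plus[symmetric]) auto
    finally have le: "ennreal c \<le> ?d + ennreal (c / 2)" using c by (simp add: add_left_mono)
    show ?thesis
    proof (cases ?d)
      case (real d)
      then have "ennreal c \<le> ennreal (d + c / 2)" using le c by (subst ennreal_plus) auto
      then have "c \<le> 2 * d" using real c by (subst (asm) ennreal_le_iff) auto
      then have "ennreal c \<le> ennreal (2 * d)" by (rule ennreal_leI)
      then show ?thesis using real c by (simp add: ennreal_2_mult)
    next
      case top
      then show ?thesis by (simp add: ennreal_mult_top)
    qed
  qed
  ultimately show ?thesis by (intro bexI[of _ "X1 \<union> X2"] conjI ballI impI) auto
qed

context
  assumes nz: "(\<integral>\<^sup>+x. ennreal (norm (f x)) \<partial>\<mu>) \<noteq> 0"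
begin

text \<open>The current cell is not bad throughout: either it has just become a stopping cell, of which at most half
  is bad, or the recursion would have stopped there.\<close>

lemma good_point: "\<exists>y\<in>cell (k0 + int j) x. \<not> bad f (k0 + int (stop f k0 x j)) y"
proof -
  have any: "\<exists>y\<in>cell k x. \<not> bad f k y" for k x
  proof (rule ccontr)
    assume all: "\<not> ?thesis"
    obtain X where X: "\<forall>y\<in>cell k x. bad f k y \<longrightarrow> y \<in> X" "emeasure \<mu> (cell k x) \<le> 2 * emeasure \<mu> (cell k x - X)"
      using bad_small[OF tail_avg_pos[OF nz], of k x] by blast
    then have "cell k x - X = {}" using all by blast
    then have "emeasure \<mu> (cell k x) \<le> 2 * emeasure \<mu> {}" using X(2) by (simp only:)
    then show False using cell_pos[of k x] by simp
  qed
  show ?thesis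
  proof (cases j)
    case 0
    then show ?thesis using any by simp
  next
    case (Suc i)
    show ?thesis
    proof (cases "stop f k0 x j = j")
      case True
      then show ?thesis using any by simp
    next
      case False
      then show ?thesis using Suc by (auto split: if_splits)
    qed
  qed
qed

text \<open>From one stopping level to the next the energies are those of a good point in the last cell of the run,
  because energies are constant on cells.\<close>

lemma stopping_domination:
  "(\<Sum>i\<le>J. energy f (k0 + int i) x) \<le> (\<Sum>i | i \<le> J \<and> stop f k0 x i = i. ennreal ((stop_const * tail_avg f (k0 + int i) x)\<^sup>2))"
proof -
  define c where "c = (\<lambda>i. ennreal ((stop_const * tail_avg f (k0 + int i) x)\<^sup>2))"
  let ?s = "\<lambda>J. stop f k0 x J"
  have run: "(\<Sum>i\<in>{?s J..J}. energy f (k0 + int i) x) \<le> c (?s J)" for J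
  proof -
    obtain y where y: "y \<in> cell (k0 + int J) x" "\<not> bad f (k0 + int (?s J)) y"
      using good_point[of k0 J x] by (elim bexE) (rule that)
    have yx: "idx (k0 + int i) y = idx (k0 + int i) x" if "i \<le> J" for i
      by (rule idx_coarser[of "k0 + int J" y x]) (use y(1) that in \<open>auto simp: cell_def\<close>)
    have "(\<Sum>i\<in>{?s J..J}. energy f (k0 + int i) x) = (\<Sum>i\<in>{?s J..J}. energy f (k0 + int i) y)"
      by (intro sum.cong refl energy_cong) (simp add: yx)
    also have "\<dots> = (\<Sum>i<Suc J - ?s J. energy f (k0 + int (?s J) + int i) y)"
      using stop_le[of f k0 x J] by (intro sum.reindex_bij_witness[of _ "\<lambda>i. ?s J + i" "\<lambda>i. i - ?s J"]) (auto simp: add.assoc)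
    also have "\<dots> \<le> Dsq f (k0 + int (?s J)) y" unfolding Dsq_def by (intro sum_le_suminf) auto
    also have "\<dots> \<le> ennreal ((stop_const * tail_avg f (k0 + int (?s J)) y)\<^sup>2)" using y(2) by (simp add: bad_def not_less)
    also have "tail_avg f (k0 + int (?s J)) y = tail_avg f (k0 + int (?s J)) x" by (intro tail_avg_cong yx stop_le)
    finally show ?thesis by (simp only: c_def)
  qed
  have before: "(\<Sum>i<?s J. energy f (k0 + int i) x) \<le> (\<Sum>i | i < ?s J \<and> ?s i = i. c i)" for J
  proof (induction J)
    case (Suc J)
    show ?case
    proof (cases "?s (Suc J) = Suc J")
      case True
      have "(\<Sum>i<Suc J. energy f (k0 + int i) x) = (\<Sum>i<?s J. energy f (k0 + int i) x) + (\<Sum>i\<in>{?s J..J}. energy f (k0 + int i) x)"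
        unfolding lessThan_Suc_atMost by (rule sum_split_at[OF stop_le])
      also have "\<dots> \<le> (\<Sum>i | i < ?s J \<and> ?s i = i. c i) + c (?s J)" by (intro add_mono Suc.IH run)
      also have "\<dots> = (\<Sum>i\<in>insert (?s J) {i. i < ?s J \<and> ?s i = i}. c i)" by (simp add: add.commute)
      also have "\<dots> \<le> (\<Sum>i | i < Suc J \<and> ?s i = i. c i)"
        using stop_le[of f k0 x J] by (intro sum_mono2) (auto simp: stop_idem)
      finally show ?thesis using True by simp
    next
      case False
      then have "?s (Suc J) = ?s J" by (auto split: if_splits)
      then show ?thesis using Suc.IH by simp
    qed
  qed simp
  have "(\<Sum>i\<le>J. energy f (k0 + int i) x) = (\<Sum>i<?s J. energy f (k0 + int i) x) + (\<Sum>i\<in>{?s J..J}. energy f (k0 + int i) x)"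
    by (rule sum_split_at[OF stop_le])
  also have "\<dots> \<le> (\<Sum>i | i < ?s J \<and> ?s i = i. c i) + c (?s J)" by (intro add_mono before run)
  also have "\<dots> = (\<Sum>i\<in>insert (?s J) {i. i < ?s J \<and> ?s i = i}. c i)" by (simp add: add.commute)
  also have "\<dots> \<le> (\<Sum>i | i \<le> J \<and> ?s i = i. c i)"
    using stop_le[of f k0 x J] by (intro sum_mono2) (auto simp: stop_idem)
  finally show ?thesis by (simp only: c_def)
qed

lemma avg_le_stopping: "avg f (k0 + int j) x \<le> stop_const * tail_avg f (k0 + int (stop f k0 x j)) x"
proof -
  let ?s = "stop f k0 x j"
  obtain y where y: "y \<in> cell (k0 + int j) x" "\<not> bad f (k0 + int ?s) y"
    using good_point[of k0 j x] by (elim bexE) (rule that)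
  have yx: "idx (k0 + int i) y = idx (k0 + int i) x" if "i \<le> j" for i
    by (rule idx_coarser[of "k0 + int j" y x]) (use y(1) that in \<open>auto simp: cell_def\<close>)
  have "avg f (k0 + int ?s + int (j - ?s)) y \<le> stop_const * tail_avg f (k0 + int ?s) y"
    using y(2) by (simp add: bad_def not_less)
  moreover have "k0 + int ?s + int (j - ?s) = k0 + int j" using stop_le[of f k0 x j] by simp
  moreover have "avg f (k0 + int j) y = avg f (k0 + int j) x" by (intro avg_cong yx) simp
  moreover have "tail_avg f (k0 + int ?s) y = tail_avg f (k0 + int ?s) x" by (intro tail_avg_cong yx stop_le)
  ultimately show ?thesis by simp
qed

text \<open>The averages between a cell and its stopping ancestor are bounded by the tail average of the latter, and
  the geometric weights sum them up.\<close>

lemma tail_avg_le_stopping: "tail_avg f (k0 + int j) x \<le> chain_const * tail_avg f (k0 + int (stop f k0 x j)) x"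
proof -
  let ?s = "stop f k0 x j" and ?a = "tail_avg f (k0 + int (stop f k0 x j)) x"
  define T where "T = (\<Sum>i<j - ?s. decay ^ i * avg f (k0 + int j - int i) x)"
  have "k0 + int j - int (j - ?s) = k0 + int ?s" using stop_le[of f k0 x j] by simp
  then have eq: "tail_avg f (k0 + int j) x = T + decay ^ (j - ?s) * ?a"
    unfolding T_def using tail_avg_split[of "k0 + int j" x "j - ?s"] by simp
  have "T \<le> (\<Sum>i<j - ?s. decay ^ i * (stop_const * ?a))"
    unfolding T_def
  proof (intro sum_mono mult_left_mono)
    fix i assume i: "i \<in> {..<j - ?s}"
    then have eq: "k0 + int j - int i = k0 + int (j - i)" by auto
    have "stop f k0 x (j - i) = ?s" using i by (intro stop_between) auto
    then show "avg f (k0 + int j - int i) x \<le> stop_const * ?a"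
      unfolding eq using avg_le_stopping[of k0 "j - i" x] by simp
  qed simp
  then have T: "T \<le> (\<Sum>i<j - ?s. decay ^ i) * (stop_const * ?a)" unfolding sum_distrib_right .
  have "(\<Sum>i<j - ?s. decay ^ i) \<le> (\<Sum>i. decay ^ i)" by (intro sum_le_suminf summable_geometric) auto
  then have "(\<Sum>i<j - ?s. decay ^ i) \<le> 1 / (1 - decay)" by (simp add: suminf_geometric)
  then have "(\<Sum>i<j - ?s. decay ^ i) * (stop_const * ?a) \<le> 1 / (1 - decay) * (stop_const * ?a)"
    using stop_const(1) by (intro mult_right_mono) auto
  moreover have "decay ^ (j - ?s) * ?a \<le> 1 * ?a" by (intro mult_right_mono power_le_one) auto
  moreover have "chain_const * ?a = 1 / (1 - decay) * (stop_const * ?a) + 1 * ?a"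
    by (simp add: chain_const_def distrib_right)
  ultimately show ?thesis using eq T by linarith
qed

text \<open>If two of these indices were \<open>N\<close> or more apart, the smaller one would be a stopping time after \<open>i\<close> that
  the larger one meets first on its way back.\<close>

lemma anchor_fibres:
  assumes N: "1 \<le> N"
  shows "card {k. k \<le> J \<and> stop f k0 x k = k \<and> N \<le> k \<and> stop f k0 x (k - N) = i} \<le> N"
proof (cases "{k. k \<le> J \<and> stop f k0 x k = k \<and> N \<le> k \<and> stop f k0 x (k - N) = i} = {}")
  case False
  let ?F = "{k. k \<le> J \<and> stop f k0 x k = k \<and> N \<le> k \<and> stop f k0 x (k - N) = i}"
  have fin: "finite ?F" by simp
  define k1 where "k1 = Min ?F"
  have k1: "k1 \<in> ?F" unfolding k1_def using fin False by (rule Min_in)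
  have "k \<in> {k1..<k1 + N}" if k: "k \<in> ?F" for k
  proof -
    have "k1 \<le> k" unfolding k1_def using fin k by (rule Min_le)
    moreover have "k < k1 + N"
    proof (rule ccontr)
      assume "\<not> k < k1 + N"
      then have "k1 \<le> k - N" by simp
      then have "stop f k0 x k1 \<le> stop f k0 x (k - N)" by (rule stop_mono)
      then have "k1 \<le> i" using k k1 by simp
      moreover have "i \<le> k1 - N" using k1 stop_le[of f k0 x "k1 - N"] by auto
      ultimately show False using N k1 by auto
    qed
    ultimately show ?thesis by simp
  qed
  then have "?F \<subseteq> {k1..<k1 + N}" by blast
  then have "card ?F \<le> card {k1..<k1 + N}" by (intro card_mono) auto
  then show ?thesis by simp
next
  case True
  show ?thesis unfolding True by simp
qed

text \<open>The tail average of a stopping cell splits into the averages over its first \<open>depth\<close> ancestors and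
  \<open>decay\<close> to the power \<open>depth\<close> times the tail average of the \<open>depth\<close>-th ancestor. The latter is at most
  \<open>chain_const\<close> times the tail average of the stopping cell above that ancestor, or is bounded by the tail
  average of the top cell if the ancestor lies above the top.\<close>

lemma sparse_domination:
  "(\<Sum>i\<le>J. energy f (k0 + int i) x) \<le> ennreal (top_const * (tail_avg f k0 x)\<^sup>2) +
     (\<Sum>i | i \<le> J \<and> stop f k0 x i = i. ennreal (main_const * (avg f (k0 + int i - int depth) x)\<^sup>2))"
proof -
  let ?S = "{i. i \<le> J \<and> stop f k0 x i = i}"
  let ?N = depth
  define a where "a = (\<lambda>k. tail_avg f (k0 + int k) x)"
  define g where "g = (\<lambda>k. \<Sum>i<?N. decay ^ i * avg f (k0 + int k - int i) x)"
  have split: "a k = g k + decay ^ ?N * tail_avg f (k0 + int k - int ?N) x" for k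
    unfolding a_def g_def by (rule tail_avg_split)
  have "(\<Sum>k\<in>?S. (a k)\<^sup>2) \<le> 4 * (\<Sum>k\<in>?S. (g k)\<^sup>2) + 4 * real ?N * (a 0)\<^sup>2"
  proof (rule square_sum_absorption[where \<rho> = "\<lambda>k. stop f k0 x (k - ?N)" and q = "decay ^ ?N * chain_const"])
    show "finite ?S" by simp
    show "0 \<le> a k" for k by (simp add: a_def)
    show "0 \<le> a 0" by (simp add: a_def)
    show "0 \<le> g k" for k unfolding g_def by (intro sum_nonneg) auto
    show "0 \<le> decay ^ ?N * chain_const" using chain_const_nonneg by simp
    show "2 * real ?N * (decay ^ ?N * chain_const)\<^sup>2 \<le> 1 / 2" by (rule depth(2))
  next
    fix k assume "k \<in> ?S" "k < ?N"
    have "decay ^ (?N - k) * tail_avg f (k0 - int (?N - k)) x \<le> tail_avg f k0 x"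
      unfolding tail_avg_split[of k0 x "?N - k"] by (simp add: sum_nonneg)
    then have le: "decay ^ k * (decay ^ (?N - k) * tail_avg f (k0 - int (?N - k)) x) \<le> 1 * tail_avg f k0 x"
      by (intro mult_mono power_le_one) auto
    have e1: "decay ^ k * decay ^ (?N - k) = decay ^ ?N" using \<open>k < ?N\<close> by (simp add: power_add[symmetric])
    have e2: "k0 - int (?N - k) = k0 + int k - int ?N" using \<open>k < ?N\<close> by simp
    have "decay ^ ?N * tail_avg f (k0 + int k - int ?N) x \<le> a 0"
      using le unfolding e2 mult.assoc[symmetric] e1 a_def by simp
    then show "a k \<le> g k + a 0" using split[of k] by simp
  next
    fix k assume "k \<in> ?S" "?N \<le> k"
    then have e: "k0 + int k - int ?N = k0 + int (k - ?N)" by simp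
    have "decay ^ ?N * tail_avg f (k0 + int k - int ?N) x \<le> decay ^ ?N * (chain_const * a (stop f k0 x (k - ?N)))"
      unfolding e a_def by (intro mult_left_mono tail_avg_le_stopping) simp
    then show "a k \<le> g k + decay ^ ?N * chain_const * a (stop f k0 x (k - ?N))" using split[of k] by simp
    have "stop f k0 x (k - ?N) \<le> J" using stop_le[of f k0 x "k - ?N"] \<open>k \<in> ?S\<close> by auto
    then show "stop f k0 x (k - ?N) \<in> ?S" by (simp add: stop_idem)
  next
    fix i
    have "{k \<in> ?S. ?N \<le> k \<and> stop f k0 x (k - ?N) = i} = {k. k \<le> J \<and> stop f k0 x k = k \<and> ?N \<le> k \<and> stop f k0 x (k - ?N) = i}"
      by auto
    then show "card {k \<in> ?S. ?N \<le> k \<and> stop f k0 x (k - ?N) = i} \<le> ?N"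
      using anchor_fibres[OF depth(1), of J k0 x i] by simp
  qed
  moreover have "g k \<le> real ?N * dbl ?N * avg f (k0 + int k - int ?N) x" for k
  proof -
    have "g k \<le> (\<Sum>i<?N. dbl ?N * avg f (k0 + int k - int ?N) x)"
      unfolding g_def
    proof (rule sum_mono)
      fix i assume i: "i \<in> {..<?N}"
      have "decay ^ i * avg f (k0 + int k - int i) x \<le> 1 * avg f (k0 + int k - int i) x"
        by (intro mult_right_mono power_le_one) auto
      also have "\<dots> \<le> dbl (?N - i) * avg f (k0 + int k - int i - int (?N - i)) x"
        using avg_le_ancestor by simp
      also have "k0 + int k - int i - int (?N - i) = k0 + int k - int ?N" using i by auto
      also have "dbl (?N - i) * avg f (k0 + int k - int ?N) x \<le> dbl ?N * avg f (k0 + int k - int ?N) x"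
        by (intro mult_right_mono dbl_mono) auto
      finally show "decay ^ i * avg f (k0 + int k - int i) x \<le> dbl ?N * avg f (k0 + int k - int ?N) x" .
    qed
    then show ?thesis by simp
  qed
  then have "(g k)\<^sup>2 \<le> (real ?N * dbl ?N * avg f (k0 + int k - int ?N) x)\<^sup>2" for k
    by (intro power_mono) (auto simp: g_def intro!: sum_nonneg)
  then have "(\<Sum>k\<in>?S. (g k)\<^sup>2) \<le> (\<Sum>k\<in>?S. (real ?N * dbl ?N)\<^sup>2 * (avg f (k0 + int k - int ?N) x)\<^sup>2)"
    by (intro sum_mono) (simp add: power_mult_distrib)
  ultimately have "(\<Sum>k\<in>?S. (a k)\<^sup>2) \<le> 4 * (\<Sum>k\<in>?S. (real ?N * dbl ?N)\<^sup>2 * (avg f (k0 + int k - int ?N) x)\<^sup>2) + 4 * real ?N * (a 0)\<^sup>2"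
    by linarith
  then have "stop_const\<^sup>2 * (\<Sum>k\<in>?S. (a k)\<^sup>2)
      \<le> stop_const\<^sup>2 * (4 * (\<Sum>k\<in>?S. (real ?N * dbl ?N)\<^sup>2 * (avg f (k0 + int k - int ?N) x)\<^sup>2) + 4 * real ?N * (a 0)\<^sup>2)"
    by (intro mult_left_mono) auto
  also have "\<dots> = top_const * (tail_avg f k0 x)\<^sup>2 + (\<Sum>k\<in>?S. main_const * (avg f (k0 + int k - int ?N) x)\<^sup>2)"
    by (simp add: a_def top_const_def main_const_def power_mult_distrib sum_distrib_left algebra_simps)
  finally have le: "(\<Sum>k\<in>?S. (stop_const * a k)\<^sup>2) \<le> \<dots>" by (simp add: power_mult_distrib sum_distrib_left)
  have "(\<Sum>i\<le>J. energy f (k0 + int i) x) \<le> (\<Sum>k\<in>?S. ennreal ((stop_const * a k)\<^sup>2))"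
    unfolding a_def by (rule stopping_domination)
  also have "\<dots> = ennreal (\<Sum>k\<in>?S. (stop_const * a k)\<^sup>2)" by (intro sum_ennreal) auto
  also have "\<dots> \<le> ennreal (top_const * (tail_avg f k0 x)\<^sup>2 + (\<Sum>k\<in>?S. main_const * (avg f (k0 + int k - int ?N) x)\<^sup>2))"
    using le by (rule ennreal_leI)
  also have "\<dots> = ennreal (top_const * (tail_avg f k0 x)\<^sup>2) + ennreal (\<Sum>k\<in>?S. main_const * (avg f (k0 + int k - int ?N) x)\<^sup>2)"
    by (intro ennreal_plus sum_nonneg) (auto simp: top_const_def main_const_def)
  also have "ennreal (\<Sum>k\<in>?S. main_const * (avg f (k0 + int k - int ?N) x)\<^sup>2) = (\<Sum>k\<in>?S. ennreal (main_const * (avg f (k0 + int k - int ?N) x)\<^sup>2))"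
    by (intro sum_ennreal[symmetric]) (auto simp: main_const_def)
  finally show ?thesis .
qed

end

end

section \<open>Weighted estimates for the square function\<close>

lemma finite_idx_image: "finite (idx k ` cell j (x :: real^'n))"
proof -
  let ?a = "- \<lceil>(norm x + real CARD('n) * (2 * side j)) / side k\<rceil> - 1" and ?b = "\<lceil>(norm x + real CARD('n) * (2 * side j)) / side k\<rceil>"
  have "idx k y \<in> (\<lambda>g. \<chi> i. g i) ` (UNIV \<rightarrow>\<^sub>E {?a..?b})" if y: "y \<in> cell j x" for y
  proof
    show "idx k y = (\<chi> i. idx k y $ i)" by simp
    show "(\<lambda>i. idx k y $ i) \<in> UNIV \<rightarrow>\<^sub>E {?a..?b}"
    proof (intro PiE_I)
      fix i
      have "\<bar>y $ i - x $ i\<bar> \<le> 2 * side j"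
        using triple_near[of y j x x i] y cell_subset_triple by auto
      moreover have "\<bar>x $ i\<bar> \<le> norm x" by (rule component_le_norm_cart)
      moreover have "1 * (2 * side j) \<le> real CARD('n) * (2 * side j)"
        by (intro mult_right_mono) (auto simp: Suc_leI)
      ultimately have "\<bar>y $ i\<bar> \<le> norm x + real CARD('n) * (2 * side j)" by linarith
      then have "\<bar>y $ i / side k\<bar> \<le> (norm x + real CARD('n) * (2 * side j)) / side k"
        by (simp add: abs_div divide_right_mono)
      moreover have "idx k y $ i = \<lfloor>y $ i / side k\<rfloor>" by (simp add: idx_def)
      ultimately show "idx k y $ i \<in> {?a..?b}" unfolding atLeastAtMost_iff by linarith
    qed auto
  qed
  then have "idx k ` cell j x \<subseteq> (\<lambda>g. \<chi> i. g i) ` (UNIV \<rightarrow>\<^sub>E {?a..?b})" by blast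
  moreover have "finite ((\<lambda>g. \<chi> i. g i) ` ((UNIV :: 'n set) \<rightarrow>\<^sub>E {?a..?b}) :: (int^'n) set)"
    by (intro finite_imageI finite_PiE) auto
  ultimately show ?thesis by (rule finite_subset)
qed

lemma power2_powr_half: "0 \<le> a \<Longrightarrow> (a\<^sup>2) powr (q / 2) = a powr (q :: real)"
proof (cases "a = 0")
  case False
  assume "0 \<le> a"
  then have "a\<^sup>2 = a powr 2" using False by (simp add: powr_numeral)
  then show ?thesis by (simp only: powr_powr) simp
qed simp

text \<open>Preimages are countable unions of cells.\<close>

lemma measurable_idx_function:
  fixes h :: "real^'n \<Rightarrow> ennreal"
  assumes "\<And>x y. idx k x = idx k y \<Longrightarrow> h x = h y"
  shows "h \<in> borel_measurable borel"
proof (rule measurableI)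
  fix X :: "ennreal set" assume "X \<in> sets borel"
  have "h -` X = (\<Union>z\<in>{z. h (corner k z) \<in> X}. cell k (corner k z))"
  proof (intro set_eqI iffI)
    fix x assume x: "x \<in> h -` X"
    have "h (corner k (idx k x)) = h x" by (rule assms) simp
    then show "x \<in> (\<Union>z\<in>{z. h (corner k z) \<in> X}. cell k (corner k z))"
      using x by (intro UN_I[of "idx k x"]) (auto simp: cell_def)
  next
    fix x assume "x \<in> (\<Union>z\<in>{z. h (corner k z) \<in> X}. cell k (corner k z))"
    then obtain z where "h (corner k z) \<in> X" "idx k x = idx k (corner k z)" by (auto simp: cell_def)
    then show "x \<in> h -` X" using assms[of x "corner k z"] by simp
  qed
  also have "\<dots> \<in> sets borel" by (intro sets.countable_UN'') (auto intro: countableI_type)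
  finally show "h -` X \<inter> space borel \<in> sets borel" by simp
qed simp

text \<open>Powers with exponent at least one are superadditive; this is the embedding of \<open>\<ell>\<^sup>r\<close> into \<open>\<ell>\<^sup>2\<close> for
  \<open>r \<le> 2\<close>.\<close>

lemma sum_epowr_le_epowr_sum:
  fixes x :: "'i \<Rightarrow> ennreal"
  assumes S: "finite S" and t: "1 \<le> t"
  shows "(\<Sum>i\<in>S. epowr (x i) t) \<le> epowr (\<Sum>i\<in>S. x i) t"
  using S
proof (induction S)
  case (insert i S)
  have add: "epowr a t + epowr b t \<le> epowr (a + b) t" for a b :: ennreal
  proof (cases "t = 1")
    case False
    then have t1: "0 < t - 1" using t by simp
    have split: "epowr c t = c * epowr c (t - 1)" for c using epowr_add[of 1 "t - 1" c] t1 by simp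
    have "epowr a t + epowr b t = a * epowr a (t - 1) + b * epowr b (t - 1)" by (simp only: split)
    also have "\<dots> \<le> a * epowr (a + b) (t - 1) + b * epowr (a + b) (t - 1)"
      using t1 by (intro add_mono mult_left_mono epowr_mono) auto
    also have "\<dots> = epowr (a + b) t" by (simp only: split distrib_right)
    finally show ?thesis .
  qed simp
  have "(\<Sum>i\<in>insert i S. epowr (x i) t) \<le> epowr (x i) t + epowr (\<Sum>i\<in>S. x i) t"
    using insert by (simp add: add_left_mono)
  also have "\<dots> \<le> epowr (\<Sum>i\<in>insert i S. x i) t" using add insert by simp
  finally show ?case .
qed (use t in simp)

lemma nn_integral_linear2:
  assumes "P \<in> borel_measurable M" "Q \<in> borel_measurable M"
  shows "(\<integral>\<^sup>+x. a * (b * P x + d * Q x) \<partial>M) = a * (b * (\<integral>\<^sup>+x. P x \<partial>M) + d * (\<integral>\<^sup>+x. Q x \<partial>M))"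
  using assms by (simp add: nn_integral_cmult nn_integral_add)

text \<open>Weights that are positive everywhere, with the characteristic replaced by a real bound for it. The
  triples are the only cubes on which the \<open>A\<^sub>p\<close> condition is applied.\<close>

locale conical_weight = conical \<mu> s m \<alpha> C\<^sub>\<mu> C\<^sub>s C\<^sub>d C\<^sub>w n
  for \<mu> :: "(real^'n) measure" and s m \<alpha> C\<^sub>\<mu> C\<^sub>s C\<^sub>d C\<^sub>w n +
  fixes w :: "real^'n \<Rightarrow> real" and p Aw :: real
  assumes p: "1 < p" and w_borel [measurable]: "w \<in> borel_measurable borel" and wpos: "\<And>x. 0 < w x"
    and w_fin: "\<And>k x. (\<integral>\<^sup>+y. ennreal (w y) * indicator (triple k x) y \<partial>\<mu>) < \<infinity>"
    and Aw: "0 \<le> Aw"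
    and Ap: "\<And>k x. ((\<integral>\<^sup>+y. ennreal (w y) * indicator (triple k x) y \<partial>\<mu>) / emeasure \<mu> (triple k x)) *
       epowr ((\<integral>\<^sup>+y. ennreal (w y powr (- 1 / (p - 1))) * indicator (triple k x) y \<partial>\<mu>)
         / emeasure \<mu> (triple k x)) (p - 1) \<le> ennreal Aw"

context conical
begin

definition sparse_factor where
  "sparse_factor p = sparse_const n p (min 2 (p - 1)) (2 * dbl depth)"

definition cell_const where
  "cell_const p = 2 powr (p / 2) * (top_const powr (p / 2) * (1 / (1 - decay)) powr p + main_const powr (p / 2))
     * sparse_factor p powr (p / min 2 (p - 1))"

end

context conical_weight
begin

definition r where "r = min 2 (p - 1)"

lemma r: "0 < r" "r \<le> p - 1" "r \<le> 2" "r < p"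
  using p by (auto simp: r_def)

abbreviation X where "X f \<equiv> (\<integral>\<^sup>+x. epowr (ennreal (norm (f x :: complex))) p * ennreal (w x) \<partial>\<mu>)"

lemma sparse_factor_nonneg: "0 \<le> sparse_factor p"
  by (simp add: sparse_factor_def sparse_const_def)

lemma sparse_bound:
  fixes k :: "'i \<Rightarrow> int" and c :: "'i \<Rightarrow> real^'n"
  assumes I: "finite I"
    and E: "\<And>i. i \<in> I \<Longrightarrow> E i \<in> sets borel" "\<And>i. i \<in> I \<Longrightarrow> E i \<subseteq> cell (k i) (c i)" "disjoint_family_on E I"
    and sparse: "\<And>i. i \<in> I \<Longrightarrow> emeasure \<mu> (triple (k i) (c i)) \<le> ennreal (2 * dbl depth) * emeasure \<mu> (E i)"
    and f: "conical_function \<mu> s m \<alpha> C\<^sub>\<mu> C\<^sub>s C\<^sub>d C\<^sub>w n f" and X: "X f < \<infinity>"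
  shows "(\<integral>\<^sup>+x. epowr (\<Sum>i\<in>I. epowr (ennreal (avg f (k i) (c i))) r * indicator (cell (k i) (c i)) x) (p / r) * ennreal (w x) \<partial>\<mu>)
     \<le> ennreal ((Aw * sparse_factor p) powr (p / r)) * X f"
proof -
  interpret F: conical_function \<mu> s m \<alpha> C\<^sub>\<mu> C\<^sub>s C\<^sub>d C\<^sub>w n f by (rule f)
  have avg_eq: "(\<integral>\<^sup>+y. ennreal (norm (f y)) * indicator (triple k x) y \<partial>\<mu>) / emeasure \<mu> (triple k x) = ennreal (avg f k x)" for k x
  proof -
    have "mass f k x / emeasure \<mu> (triple k x) = ennreal (avg f k x)"
      unfolding F.mass_eq using triple_pos[of k x] triple_finite[of k x]
      by (intro ennreal_mult_divide_eq) (auto simp: less_top)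
    then show ?thesis by (simp add: mass_def)
  qed
  have "(\<integral>\<^sup>+x. epowr (\<Sum>i\<in>I. epowr ((\<integral>\<^sup>+y. ennreal (norm (f y)) * indicator (triple (k i) (c i)) y \<partial>\<mu>) / emeasure \<mu> (triple (k i) (c i))) r
        * indicator (cell (k i) (c i)) x) (p / r) * ennreal (w x) \<partial>\<mu>)
     \<le> ennreal ((Aw * sparse_const CARD('n) p r (2 * dbl depth)) powr (p / r)) * X f"
    by (rule sparse_weighted_bound[OF sets_mu sigma_finite_mu I w_borel wpos w_fin triple_finite triple_pos r(1,2) Aw _ Ap E])
      (use dbl_nonneg sparse X in auto)
  then show ?thesis unfolding avg_eq n[symmetric] unfolding r_def sparse_factor_def[symmetric] .
qed

end

locale conical_weight_function = conical_weight \<mu> s m \<alpha> C\<^sub>\<mu> C\<^sub>s C\<^sub>d C\<^sub>w n w p Aw + conical_function \<mu> s m \<alpha> C\<^sub>\<mu> C\<^sub>s C\<^sub>d C\<^sub>w n f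
  for \<mu> :: "(real^'n) measure" and s m \<alpha> C\<^sub>\<mu> C\<^sub>s C\<^sub>d C\<^sub>w n w p Aw f +
  assumes Xfin: "X f < \<infinity>"
begin

abbreviation Y where "Y \<equiv> ennreal ((Aw * sparse_factor p) powr (p / r)) * X f"

lemma dbl_0_le: "dbl 0 \<le> 2 * dbl depth"
  using dbl_mono[of 0 depth] dbl_nonneg[of depth] by linarith

text \<open>The sparse bound for a family that consists of a single cell.\<close>

lemma top_average_bound:
  "ennreal (avg f (k - int i) x powr p) * (\<integral>\<^sup>+y. ennreal (w y) * indicator (cell k x) y \<partial>\<mu>) \<le> Y"
proof -
  have "ennreal (avg f (k - int i) x powr p) * (\<integral>\<^sup>+y. ennreal (w y) * indicator (cell k x) y \<partial>\<mu>)
    = (\<integral>\<^sup>+y. ennreal (avg f (k - int i) x powr p) * (ennreal (w y) * indicator (cell k x) y) \<partial>\<mu>)"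
    by (rule nn_integral_cmult[symmetric]) measurable
  also have "\<dots> \<le> (\<integral>\<^sup>+y. epowr (\<Sum>j\<in>{()}. epowr (ennreal (avg f (k - int i) x)) r * indicator (cell (k - int i) x) y) (p / r) * ennreal (w y) \<partial>\<mu>)"
  proof (rule nn_integral_mono)
    fix y
    show "ennreal (avg f (k - int i) x powr p) * (ennreal (w y) * indicator (cell k x) y)
      \<le> epowr (\<Sum>j\<in>{()}. epowr (ennreal (avg f (k - int i) x)) r * indicator (cell (k - int i) x) y) (p / r) * ennreal (w y)"
    proof (cases "y \<in> cell k x")
      case True
      then have "y \<in> cell (k - int i) x" using cell_mono[of "k - int i" k x] by auto
      then show ?thesis using True r p by (simp add: epowr_ennreal powr_powr)
    qed simp
  qed
  also have "\<dots> \<le> Y"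
  proof (rule sparse_bound)
    show "emeasure \<mu> (triple (k - int i) x) \<le> ennreal (2 * dbl depth) * emeasure \<mu> (cell (k - int i) x)"
      using triple_le_cell[of "k - int i" 0 x] dbl_0_le
      by (simp add: order_trans[OF _ mult_right_mono[OF ennreal_leI]])
    show "conical_function \<mu> s m \<alpha> C\<^sub>\<mu> C\<^sub>s C\<^sub>d C\<^sub>w n f" by (rule conical_function_axioms)
    show "X f < \<infinity>" by (rule Xfin)
  qed (auto simp: disjoint_family_on_def)
  finally show ?thesis .
qed

lemma top_term_bound:
  "ennreal (tail_avg f k x powr p) * (\<integral>\<^sup>+y. ennreal (w y) * indicator (cell k x) y \<partial>\<mu>) \<le> ennreal ((1 / (1 - decay)) powr p) * Y"
proof -
  let ?W = "\<integral>\<^sup>+y. ennreal (w y) * indicator (cell k x) y \<partial>\<mu>"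
  have "?W \<le> (\<integral>\<^sup>+y. ennreal (w y) * indicator (triple k x) y \<partial>\<mu>)"
    using cell_subset_triple[of k x] by (intro nn_integral_mono) (auto simp: indicator_def)
  then obtain W where W: "?W = ennreal W" "0 \<le> W" using w_fin[of k x] by (cases ?W) (auto simp: top_unique)
  obtain y where y: "Y = ennreal y" "0 \<le> y"
    using Xfin by (cases "X f") (auto simp: ennreal_mult[symmetric])
  show ?thesis
  proof (cases "W = 0")
    case False
    then have W0: "0 < W" using W by simp
    define c where "c = (y / W) powr (1 / p)"
    have "avg f (k - int i) x \<le> c" for i
    proof -
      have "ennreal (avg f (k - int i) x powr p * W) \<le> ennreal y"
        using top_average_bound[of k i x] W y by (simp add: ennreal_mult)
      then have "avg f (k - int i) x powr p \<le> y / W" using y W0 by (simp add: pos_le_divide_eq)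
      then have "(avg f (k - int i) x powr p) powr (1 / p) \<le> c" unfolding c_def using p by (intro powr_mono2) auto
      then show ?thesis using p by (simp add: powr_powr)
    qed
    then have "tail_avg f k x \<le> (\<Sum>i. decay ^ i * c)"
      unfolding tail_avg_def by (intro suminf_le mult_left_mono tail_avg_summable summable_mult2 summable_geometric) auto
    also have "\<dots> = 1 / (1 - decay) * c"
      by (subst suminf_mult2[symmetric]) (auto simp: suminf_geometric summable_geometric)
    finally have "tail_avg f k x powr p \<le> (1 / (1 - decay) * c) powr p" using p by (intro powr_mono2) auto
    also have "\<dots> = (1 / (1 - decay)) powr p * (y / W)"
      using p y W0 decay(3) by (simp add: powr_mult c_def powr_powr powr_divide)
    finally have "tail_avg f k x powr p * W \<le> (1 / (1 - decay)) powr p * (y / W) * W" using W by (intro mult_right_mono) auto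
    also have "\<dots> = (1 / (1 - decay)) powr p * y" using W0 by simp
    finally have "ennreal (tail_avg f k x powr p * W) \<le> ennreal ((1 / (1 - decay)) powr p * y)" by (rule ennreal_leI)
    then show ?thesis unfolding W y using W y by (simp add: ennreal_mult)
  qed (simp add: W)
qed

context
  assumes nz: "(\<integral>\<^sup>+x. ennreal (norm (f x)) \<partial>\<mu>) \<noteq> 0"
begin

text \<open>The private part of a stopping cell consists of points that are not bad and fills at least half of the
  cell. Such points are never stopped again, so they belong to no later stopping cell. Averages
  are taken over the triple of the \<open>depth\<close>-th ancestor, whose measure is comparable.\<close>

lemma stopping_sum_bound:
  "(\<integral>\<^sup>+x. epowr (\<Sum>i | i \<le> J \<and> stop f k0 x i = i. epowr (ennreal (avg f (k0 + int i - int depth) x)) r) (p / r)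
      * indicator (cell k0 x0) x * ennreal (w x) \<partial>\<mu>) \<le> Y"
proof -
  define ctr where "ctr = (\<lambda>q :: nat \<times> (int^'n). corner (k0 + int (fst q)) (snd q))"
  define I where "I = {q. fst q \<le> J \<and> snd q \<in> idx (k0 + int (fst q)) ` cell k0 x0 \<and> stop f k0 (ctr q) (fst q) = fst q}"
  have fin: "finite I"
  proof (rule finite_subset)
    show "I \<subseteq> (\<Union>i\<le>J. {i} \<times> idx (k0 + int i) ` cell k0 x0)" by (auto simp: I_def)
    show "finite (\<Union>i\<le>J. {i} \<times> idx (k0 + int i) ` cell k0 x0)"
      by (intro finite_UN_I finite_cartesian_product finite_idx_image) auto
  qed
  have "\<forall>q. \<exists>Z. Z \<in> sets borel \<and> (\<forall>y\<in>cell (k0 + int (fst q)) (ctr q). bad f (k0 + int (fst q)) y \<longrightarrow> y \<in> Z)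
      \<and> emeasure \<mu> (cell (k0 + int (fst q)) (ctr q)) \<le> 2 * emeasure \<mu> (cell (k0 + int (fst q)) (ctr q) - Z)"
    using bad_small[OF tail_avg_pos[OF nz]] by (auto simp: Bex_def)
  then obtain Z where Z: "\<And>q. Z q \<in> sets borel"
    "\<And>q y. y \<in> cell (k0 + int (fst q)) (ctr q) \<Longrightarrow> bad f (k0 + int (fst q)) y \<Longrightarrow> y \<in> Z q"
    "\<And>q. emeasure \<mu> (cell (k0 + int (fst q)) (ctr q)) \<le> 2 * emeasure \<mu> (cell (k0 + int (fst q)) (ctr q) - Z q)"
    by metis
  define E where "E = (\<lambda>q. cell (k0 + int (fst q)) (ctr q) - Z q)"
  define kk where "kk = (\<lambda>q :: nat \<times> (int^'n). k0 + int (fst q) - int depth)"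
  have idx_ctr: "idx (k0 + int (fst q)) (ctr q) = snd q" for q by (simp add: ctr_def)
  \<comment> \<open>a point that is not bad for its stopping cell is never stopped again\<close>
  have stays: "stop f k0 y j = fst q" if q: "q \<in> I" and y: "y \<in> E q" and j: "fst q \<le> j" for q y j
    using j
  proof (induction j rule: dec_induct)
    case base
    have "stop f k0 y (fst q) = stop f k0 (ctr q) (fst q)" using y by (intro stop_cong) (auto simp: E_def cell_def)
    then show ?case using q by (simp add: I_def)
  next
    case (step j)
    have "\<not> bad f (k0 + int (fst q)) y" using y Z(2)[of y q] by (auto simp: E_def)
    then have "\<not> (\<forall>z\<in>cell (k0 + int (Suc j)) y. bad f (k0 + int (stop f k0 y j)) z)"
      using self_in_cell[of y] unfolding step.IH by blast
    then have "stop f k0 y (Suc j) = stop f k0 y j" by (simp only: stop.simps if_False)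
    then show ?case using step.IH by simp
  qed
  have disj: "disjoint_family_on E I"
    unfolding disjoint_family_on_def
  proof (intro ballI impI equals0I)
    fix q q' y assume q: "q \<in> I" "q' \<in> I" "q \<noteq> q'" and y: "y \<in> E q \<inter> E q'"
    have "stop f k0 y (max (fst q) (fst q')) = fst q" by (rule stays[OF q(1)]) (use y in auto)
    moreover have "stop f k0 y (max (fst q) (fst q')) = fst q'" by (rule stays[OF q(2)]) (use y in auto)
    ultimately have "fst q = fst q'" by simp
    moreover have "idx (k0 + int (fst q)) y = snd q" "idx (k0 + int (fst q')) y = snd q'"
      using y idx_ctr[of q] idx_ctr[of q'] by (auto simp: E_def cell_def)
    ultimately show False using q(3) by (simp add: prod_eq_iff)
  qed
  have "(\<integral>\<^sup>+x. epowr (\<Sum>i | i \<le> J \<and> stop f k0 x i = i. epowr (ennreal (avg f (k0 + int i - int depth) x)) r) (p / r)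
      * indicator (cell k0 x0) x * ennreal (w x) \<partial>\<mu>)
    \<le> (\<integral>\<^sup>+x. epowr (\<Sum>q\<in>I. epowr (ennreal (avg f (kk q) (ctr q))) r * indicator (cell (kk q) (ctr q)) x) (p / r) * ennreal (w x) \<partial>\<mu>)"
  proof (rule nn_integral_mono)
    fix x
    show "epowr (\<Sum>i | i \<le> J \<and> stop f k0 x i = i. epowr (ennreal (avg f (k0 + int i - int depth) x)) r) (p / r)
        * indicator (cell k0 x0) x * ennreal (w x)
      \<le> epowr (\<Sum>q\<in>I. epowr (ennreal (avg f (kk q) (ctr q))) r * indicator (cell (kk q) (ctr q)) x) (p / r) * ennreal (w x)"
    proof (cases "x \<in> cell k0 x0")
      case True
      let ?S = "{i. i \<le> J \<and> stop f k0 x i = i}"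
      define \<phi> where "\<phi> = (\<lambda>i. (i, idx (k0 + int i) x))"
      have idx\<phi>: "idx (k0 + int i) (ctr (\<phi> i)) = idx (k0 + int i) x" for i
        using idx_ctr[of "\<phi> i"] by (simp add: \<phi>_def)
      have \<phi>I: "\<phi> i \<in> I" if "i \<in> ?S" for i
      proof -
        have "stop f k0 (ctr (\<phi> i)) i = stop f k0 x i" by (rule stop_cong[OF idx\<phi>])
        then show ?thesis using that True by (simp add: I_def \<phi>_def)
      qed
      have inj: "inj_on \<phi> ?S" by (rule inj_onI) (simp add: \<phi>_def)
      have "(\<Sum>i\<in>?S. epowr (ennreal (avg f (k0 + int i - int depth) x)) r)
        = (\<Sum>i\<in>?S. epowr (ennreal (avg f (kk (\<phi> i)) (ctr (\<phi> i)))) r * indicator (cell (kk (\<phi> i)) (ctr (\<phi> i))) x)"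
      proof (rule sum.cong[OF refl])
        fix i
        have e: "idx (k0 + int i - int depth) (ctr (\<phi> i)) = idx (k0 + int i - int depth) x"
          by (rule idx_coarser[OF idx\<phi>]) simp
        have "kk (\<phi> i) = k0 + int i - int depth" by (simp add: kk_def \<phi>_def)
        moreover have "x \<in> cell (k0 + int i - int depth) (ctr (\<phi> i))" using e by (simp add: cell_def)
        moreover have "avg f (k0 + int i - int depth) (ctr (\<phi> i)) = avg f (k0 + int i - int depth) x"
          by (rule avg_cong[OF e])
        ultimately show "epowr (ennreal (avg f (k0 + int i - int depth) x)) r
          = epowr (ennreal (avg f (kk (\<phi> i)) (ctr (\<phi> i)))) r * indicator (cell (kk (\<phi> i)) (ctr (\<phi> i))) x" by simp
      qed
      also have "\<dots> = (\<Sum>q\<in>\<phi> ` ?S. epowr (ennreal (avg f (kk q) (ctr q))) r * indicator (cell (kk q) (ctr q)) x)"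
        by (simp only: sum.reindex[OF inj] comp_def)
      also have "\<dots> \<le> (\<Sum>q\<in>I. epowr (ennreal (avg f (kk q) (ctr q))) r * indicator (cell (kk q) (ctr q)) x)"
        using \<phi>I fin by (intro sum_mono2) auto
      finally show ?thesis using True r p by (simp add: epowr_mono mult_right_mono)
    qed simp
  qed
  also have "\<dots> \<le> Y"
  proof (rule sparse_bound[OF fin _ _ disj])
    fix q assume "q \<in> I"
    show "E q \<in> sets borel" using Z(1) by (simp add: E_def)
    have "cell (k0 + int (fst q)) (ctr q) \<subseteq> cell (kk q) (ctr q)" by (rule cell_mono) (simp add: kk_def)
    then show "E q \<subseteq> cell (kk q) (ctr q)" by (auto simp: E_def)
    have "emeasure \<mu> (triple (kk q) (ctr q)) \<le> ennreal (dbl depth) * emeasure \<mu> (cell (k0 + int (fst q)) (ctr q))"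
      unfolding kk_def by (rule triple_le_cell)
    also have "\<dots> \<le> ennreal (dbl depth) * (2 * emeasure \<mu> (E q))"
      unfolding E_def by (intro mult_left_mono Z(3)) simp
    also have "\<dots> = ennreal (2 * dbl depth) * emeasure \<mu> (E q)"
      using dbl_nonneg[of depth] by (simp only: ennreal_2_mult mult_ac)
    finally show "emeasure \<mu> (triple (kk q) (ctr q)) \<le> ennreal (2 * dbl depth) * emeasure \<mu> (E q)" .
  qed (rule conical_function_axioms, rule Xfin)
  finally show ?thesis .
qed

lemma stopping_sum_measurable:
  "(\<lambda>x. epowr (\<Sum>i | i \<le> J \<and> stop f k0 x i = i. epowr (ennreal (avg f (k0 + int i - int depth) x)) r) (p / r))
    \<in> borel_measurable borel"
proof (rule measurable_idx_function[of "k0 + int J"], rule arg_cong[where f = "\<lambda>z. epowr z (p / r)"])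
  fix x y :: "real^'n" assume eq: "idx (k0 + int J) x = idx (k0 + int J) y"
  have st: "stop f k0 x i = stop f k0 y i" if "i \<le> J" for i
    by (rule stop_cong, rule idx_coarser[OF eq]) (use that in simp)
  show "(\<Sum>i | i \<le> J \<and> stop f k0 x i = i. epowr (ennreal (avg f (k0 + int i - int depth) x)) r)
    = (\<Sum>i | i \<le> J \<and> stop f k0 y i = i. epowr (ennreal (avg f (k0 + int i - int depth) y)) r)"
  proof (rule sum.cong)
    show "{i. i \<le> J \<and> stop f k0 x i = i} = {i. i \<le> J \<and> stop f k0 y i = i}" using st by auto
    fix i assume "i \<in> {i. i \<le> J \<and> stop f k0 y i = i}"
    then have "avg f (k0 + int i - int depth) x = avg f (k0 + int i - int depth) y"
      by (intro avg_cong idx_coarser[OF eq]) auto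
    then show "epowr (ennreal (avg f (k0 + int i - int depth) x)) r = epowr (ennreal (avg f (k0 + int i - int depth) y)) r"
      by simp
  qed
qed

text \<open>The pointwise domination splits the left side into the top cell and the stopping cells.\<close>

lemma cell_bound_truncated:
  "(\<integral>\<^sup>+x. epowr (\<Sum>i\<le>J. energy f (k0 + int i) x) (p / 2) * indicator (cell k0 x0) x * ennreal (w x) \<partial>\<mu>)
    \<le> ennreal (cell_const p * Aw powr (p / r)) * X f"
proof -
  let ?h = "p / 2"
  let ?T = "\<lambda>x. epowr (\<Sum>i | i \<le> J \<and> stop f k0 x i = i. epowr (ennreal (avg f (k0 + int i - int depth) x)) r) (p / r)"
  have h: "0 < ?h" using p by simp
  have cn: "0 \<le> top_const" "0 \<le> main_const" by (auto simp: top_const_def main_const_def)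
  note [measurable] = stopping_sum_measurable
  have "(\<integral>\<^sup>+x. epowr (\<Sum>i\<le>J. energy f (k0 + int i) x) ?h * indicator (cell k0 x0) x * ennreal (w x) \<partial>\<mu>)
    \<le> (\<integral>\<^sup>+x. ennreal (2 powr ?h) * (ennreal (top_const powr ?h * tail_avg f k0 x0 powr p) * (ennreal (w x) * indicator (cell k0 x0) x)
          + ennreal (main_const powr ?h) * (?T x * indicator (cell k0 x0) x * ennreal (w x))) \<partial>\<mu>)"
  proof (rule nn_integral_mono)
    fix x
    show "epowr (\<Sum>i\<le>J. energy f (k0 + int i) x) ?h * indicator (cell k0 x0) x * ennreal (w x)
      \<le> ennreal (2 powr ?h) * (ennreal (top_const powr ?h * tail_avg f k0 x0 powr p) * (ennreal (w x) * indicator (cell k0 x0) x)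
          + ennreal (main_const powr ?h) * (?T x * indicator (cell k0 x0) x * ennreal (w x)))"
    proof (cases "x \<in> cell k0 x0")
      case True
      let ?S = "{i. i \<le> J \<and> stop f k0 x i = i}"
      let ?v = "\<lambda>i. avg f (k0 + int i - int depth) x"
      have Ax: "tail_avg f k0 x = tail_avg f k0 x0" using True by (intro tail_avg_cong) (simp add: cell_def)
      have "epowr (\<Sum>i\<le>J. energy f (k0 + int i) x) ?h
        \<le> epowr (ennreal (top_const * (tail_avg f k0 x)\<^sup>2) + (\<Sum>i\<in>?S. ennreal (main_const * (?v i)\<^sup>2))) ?h"
        using h by (intro epowr_mono sparse_domination[OF nz]) auto
      also have "\<dots> \<le> ennreal (2 powr ?h) * (epowr (ennreal (top_const * (tail_avg f k0 x)\<^sup>2)) ?h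
          + epowr (\<Sum>i\<in>?S. ennreal (main_const * (?v i)\<^sup>2)) ?h)"
        using h by (rule epowr_add_le)
      also have "epowr (ennreal (top_const * (tail_avg f k0 x)\<^sup>2)) ?h = ennreal (top_const powr ?h * tail_avg f k0 x0 powr p)"
        using cn h by (simp add: epowr_ennreal Ax powr_mult power2_powr_half)
      also have "epowr (\<Sum>i\<in>?S. ennreal (main_const * (?v i)\<^sup>2)) ?h \<le> ennreal (main_const powr ?h) * ?T x"
      proof -
        have "(\<Sum>i\<in>?S. ennreal (main_const * (?v i)\<^sup>2)) = ennreal main_const * (\<Sum>i\<in>?S. epowr (epowr (ennreal (?v i)) r) (2 / r))"
          unfolding sum_distrib_left
        proof (rule sum.cong[OF refl])
          fix i
          have "epowr (epowr (ennreal (?v i)) r) (2 / r) = ennreal ((?v i)\<^sup>2)"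
            using r(1) by (simp add: epowr_epowr epowr_2 ennreal_power)
          then show "ennreal (main_const * (?v i)\<^sup>2) = ennreal main_const * epowr (epowr (ennreal (?v i)) r) (2 / r)"
            using cn by (simp add: ennreal_mult)
        qed
        also have "\<dots> \<le> ennreal main_const * epowr (\<Sum>i\<in>?S. epowr (ennreal (?v i)) r) (2 / r)"
          using r by (intro mult_left_mono sum_epowr_le_epowr_sum) (auto simp: field_simps)
        finally have "epowr (\<Sum>i\<in>?S. ennreal (main_const * (?v i)\<^sup>2)) ?h
          \<le> epowr (ennreal main_const * epowr (\<Sum>i\<in>?S. epowr (ennreal (?v i)) r) (2 / r)) ?h"
          using h by (intro epowr_mono)
        also have "\<dots> = ennreal (main_const powr ?h) * ?T x"
          using cn h r(1) by (simp add: epowr_mult epowr_epowr epowr_ennreal)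
        finally show ?thesis .
      qed
      finally have "epowr (\<Sum>i\<le>J. energy f (k0 + int i) x) ?h
        \<le> ennreal (2 powr ?h) * (ennreal (top_const powr ?h * tail_avg f k0 x0 powr p) + ennreal (main_const powr ?h) * ?T x)"
        by (simp add: add_left_mono mult_left_mono)
      then have "epowr (\<Sum>i\<le>J. energy f (k0 + int i) x) ?h * ennreal (w x)
        \<le> ennreal (2 powr ?h) * (ennreal (top_const powr ?h * tail_avg f k0 x0 powr p) + ennreal (main_const powr ?h) * ?T x) * ennreal (w x)"
        by (rule mult_right_mono) simp
      then show ?thesis using True by (simp add: distrib_right distrib_left mult.assoc)
    qed simp
  qed
  also have "\<dots> = ennreal (2 powr ?h) * (ennreal (top_const powr ?h * tail_avg f k0 x0 powr p) * (\<integral>\<^sup>+x. ennreal (w x) * indicator (cell k0 x0) x \<partial>\<mu>)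
          + ennreal (main_const powr ?h) * (\<integral>\<^sup>+x. ?T x * indicator (cell k0 x0) x * ennreal (w x) \<partial>\<mu>))"
    by (rule nn_integral_linear2; measurable)
  also have "\<dots> \<le> ennreal (2 powr ?h) * (ennreal (top_const powr ?h) * (ennreal ((1 / (1 - decay)) powr p) * Y) + ennreal (main_const powr ?h) * Y)"
  proof (intro mult_left_mono add_mono)
    have "ennreal (top_const powr ?h * tail_avg f k0 x0 powr p) * (\<integral>\<^sup>+x. ennreal (w x) * indicator (cell k0 x0) x \<partial>\<mu>)
      = ennreal (top_const powr ?h) * (ennreal (tail_avg f k0 x0 powr p) * (\<integral>\<^sup>+x. ennreal (w x) * indicator (cell k0 x0) x \<partial>\<mu>))"
      by (simp add: ennreal_mult mult.assoc)
    also have "\<dots> \<le> ennreal (top_const powr ?h) * (ennreal ((1 / (1 - decay)) powr p) * Y)"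
      by (intro mult_left_mono top_term_bound) simp
    finally show "ennreal (top_const powr ?h * tail_avg f k0 x0 powr p) * (\<integral>\<^sup>+x. ennreal (w x) * indicator (cell k0 x0) x \<partial>\<mu>)
      \<le> ennreal (top_const powr ?h) * (ennreal ((1 / (1 - decay)) powr p) * Y)" .
  qed (use stopping_sum_bound in auto)
  also have "\<dots> = ennreal (cell_const p * Aw powr (p / r)) * X f"
  proof -
    define a b c d where "a = 2 powr ?h" and "b = top_const powr ?h" and "c = (1 / (1 - decay)) powr p" and "d = main_const powr ?h"
    define e where "e = (Aw * sparse_factor p) powr (p / r)"
    have nn: "0 \<le> a" "0 \<le> b" "0 \<le> c" "0 \<le> d" "0 \<le> e" by (simp_all add: a_def b_def c_def d_def e_def)
    have "ennreal a * (ennreal b * (ennreal c * (ennreal e * X f)) + ennreal d * (ennreal e * X f))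
      = ennreal a * (ennreal b * ennreal c + ennreal d) * ennreal e * X f"
      by (simp only: distrib_left distrib_right mult.assoc)
    also have "ennreal a * (ennreal b * ennreal c + ennreal d) * ennreal e = ennreal (a * (b * c + d) * e)"
      using nn by (simp add: ennreal_mult)
    also have "a * (b * c + d) * e = cell_const p * Aw powr (p / r)"
      using Aw sparse_factor_nonneg by (simp add: a_def b_def c_def d_def e_def cell_const_def powr_mult r_def)
    finally show ?thesis unfolding a_def b_def c_def d_def e_def .
  qed
  finally show ?thesis .
qed

end

end

section \<open>From cells to the whole space, and removal of integrability\<close>

lemma epowr_liminf_mult_le:
  fixes v :: "nat \<Rightarrow> ennreal"
  assumes "0 < a"
  shows "epowr (liminf v) a * c \<le> liminf (\<lambda>j. epowr (v j) a * c)"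
proof -
  have "epowr (liminf v) a * c = (SUP n. epowr (INF j\<in>{n..}. v j) a * c)"
    unfolding liminf_SUP_INF epowr_SUP[OF assms] by (rule SUP_mult_right_ennreal)
  also have "\<dots> \<le> (SUP n. INF j\<in>{n..}. epowr (v j) a * c)"
  proof (rule SUP_mono')
    fix n
    show "epowr (INF j\<in>{n..}. v j) a * c \<le> (INF j\<in>{n..}. epowr (v j) a * c)"
      using assms by (intro INF_greatest mult_right_mono epowr_mono INF_lower) auto
  qed
  finally show ?thesis unfolding liminf_SUP_INF .
qed

lemma liminf_le_const:
  fixes v :: "nat \<Rightarrow> ennreal"
  assumes "\<And>j. v j \<le> c"
  shows "liminf v \<le> c"
  unfolding liminf_SUP_INF by (intro SUP_least) (auto intro: INF_lower2 assms)

lemma cball_borel [measurable]: "cball (x :: real^'n) r \<in> sets borel"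
  by simp

context conical
begin

definition weighted_const where "weighted_const p = (2 ^ n * cell_const p) powr (1 / p)"

lemma cell_const_nonneg: "0 \<le> cell_const p"
  by (simp add: cell_const_def)

lemma Ssq_eq_0:
  assumes [measurable]: "f \<in> borel_measurable borel" and 0: "(\<integral>\<^sup>+x. ennreal (norm (f x)) \<partial>\<mu>) = 0"
  shows "Ssq f x = 0"
proof -
  have "AE z in \<mu>. f z = 0" using 0 by (subst (asm) nn_integral_0_iff_AE) auto
  then have "AE z in \<mu>. s t y z * f z = 0" for t y by eventually_elim simp
  then have "theta \<mu> s t f y = 0" for t y unfolding theta_def by (rule integral_eq_zero_AE)
  then show ?thesis by (simp add: Ssq_def dens_def case_prod_beta')
qed

text \<open>Where the integral defining \<open>\<theta>\<^sub>t f\<close> converges absolutely, the truncations converge to it; elsewhere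
  \<open>\<theta>\<^sub>t f\<close> has the default value \<open>0\<close> of the Bochner integral and the inequality is trivial.\<close>

lemma Ssq_le_liminf:
  assumes [measurable]: "f \<in> borel_measurable borel"
  shows "Ssq f x \<le> liminf (\<lambda>j. Ssq (\<lambda>z. f z * indicator (cball 0 (real j)) z) x)"
proof -
  let ?f = "\<lambda>j z. f z * indicator (cball 0 (real j)) z"
  have conv: "eventually (\<lambda>j. ?f j z = f z) sequentially" for z
  proof -
    obtain N :: nat where "norm z \<le> real N" using real_arch_simple by blast
    then have "?f j z = f z" if "N \<le> j" for j using that by (simp add: indicator_def)
    then show ?thesis unfolding eventually_sequentially by blast
  qed
  have dens: "dens f q \<le> liminf (\<lambda>j. dens (?f j) q)" for q
  proof (cases "0 < snd q \<and> integrable \<mu> (\<lambda>z. s (snd q) (fst q) z * f z)")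
    case True
    have [measurable]: "(\<lambda>z. s (snd q) (fst q) z) \<in> borel_measurable borel"
      using True by (intro kernel_section_measurable) simp
    have "(\<lambda>j. theta \<mu> s (snd q) (?f j) (fst q)) \<longlonglongrightarrow> theta \<mu> s (snd q) f (fst q)"
      unfolding theta_def
    proof (rule integral_dominated_convergence[where w = "\<lambda>z. norm (s (snd q) (fst q) z * f z)"])
      show "AE z in \<mu>. (\<lambda>j. s (snd q) (fst q) z * ?f j z) \<longlonglongrightarrow> s (snd q) (fst q) z * f z"
      proof (rule AE_I2, rule tendsto_eventually)
        fix z show "\<forall>\<^sub>F j in sequentially. s (snd q) (fst q) z * ?f j z = s (snd q) (fst q) z * f z"
          using conv[of z] by eventually_elim simp
      qed
      show "integrable \<mu> (\<lambda>z. norm (s (snd q) (fst q) z * f z))" using True by (intro integrable_norm) simp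
      show "AE z in \<mu>. norm (s (snd q) (fst q) z * ?f j z) \<le> norm (s (snd q) (fst q) z * f z)" for j
        by (rule AE_I2) (simp add: norm_mult indicator_def)
    qed measurable
    then have "(\<lambda>j. ennreal ((norm (theta \<mu> s (snd q) (?f j) (fst q)))\<^sup>2 / snd q powr (m + 1)))
      \<longlonglongrightarrow> ennreal ((norm (theta \<mu> s (snd q) f (fst q)))\<^sup>2 / snd q powr (m + 1))"
      using True by (intro tendsto_intros) auto
    then have "(\<lambda>j. dens (?f j) q) \<longlonglongrightarrow> dens f q"
      using True by (simp add: dens_def case_prod_beta')
    then show ?thesis by (simp add: lim_imp_Liminf)
  next
    case False
    then have "dens f q = 0"
      by (auto simp: dens_def case_prod_beta' theta_def not_integrable_integral_eq)
    then show ?thesis by simp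
  qed
  have "Ssq f x \<le> (\<integral>\<^sup>+q. liminf (\<lambda>j. dens (?f j) q * indicator {q. dist x (fst q) < snd q} q) \<partial>(\<mu> \<Otimes>\<^sub>M lborel))"
    unfolding Ssq_def by (intro nn_integral_mono) (use dens in \<open>auto simp: indicator_def\<close>)
  also have "\<dots> \<le> liminf (\<lambda>j. \<integral>\<^sup>+q. dens (?f j) q * indicator {q. dist x (fst q) < snd q} q \<partial>(\<mu> \<Otimes>\<^sub>M lborel))"
  proof (rule nn_integral_liminf)
    fix j
    have "{q \<in> space (\<mu> \<Otimes>\<^sub>M (lborel :: real measure)). dist x (fst q) < snd q} \<in> sets (\<mu> \<Otimes>\<^sub>M lborel)"
      by measurable
    then have [measurable]: "{q. dist x (fst q) < snd q} \<in> sets (\<mu> \<Otimes>\<^sub>M (lborel :: real measure))"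
      by (simp add: space_pair_measure)
    show "(\<lambda>q. dens (?f j) q * indicator {q. dist x (fst q) < snd q} q) \<in> borel_measurable (\<mu> \<Otimes>\<^sub>M lborel)" by measurable
  qed
  finally show ?thesis unfolding Ssq_def .
qed

definition Ssq_trunc :: "(real^'n \<Rightarrow> complex) \<Rightarrow> int \<Rightarrow> real^'n \<Rightarrow> ennreal" where
  "Ssq_trunc f k x = (\<integral>\<^sup>+q. dens f q * indicator {q. dist x (fst q) < snd q \<and> snd q \<le> side k} q \<partial>(\<mu> \<Otimes>\<^sub>M lborel))"

lemma Ssq_trunc_measurable [measurable]:
  assumes [measurable]: "f \<in> borel_measurable borel"
  shows "Ssq_trunc f k \<in> borel_measurable borel"
proof -
  have [measurable]: "(\<lambda>p. if dist (fst p) (fst (snd p)) < snd (snd p) \<and> snd (snd p) \<le> side k then 1 else 0 :: ennreal)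
      \<in> borel_measurable (\<mu> \<Otimes>\<^sub>M (\<mu> \<Otimes>\<^sub>M lborel))" by measurable
  have "(\<lambda>x. \<integral>\<^sup>+q. dens f q * (if dist x (fst q) < snd q \<and> snd q \<le> side k then 1 else 0) \<partial>(\<mu> \<Otimes>\<^sub>M lborel)) \<in> borel_measurable \<mu>"
    by (rule sigma_finite_measure.borel_measurable_nn_integral[OF sigma_finite_prod]) (simp add: case_prod_beta', measurable)
  then show ?thesis by (simp add: Ssq_trunc_def[abs_def] indicator_def measurable_cong_sets[OF sets_mu])
qed

lemma Ssq_trunc_mono: "j \<le> k \<Longrightarrow> Ssq_trunc f k x \<le> Ssq_trunc f j x"
  unfolding Ssq_trunc_def using side_antimono[of j k]
  by (intro nn_integral_mono mult_left_mono) (auto simp: indicator_def)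

lemma Ssq_eq_SUP:
  assumes [measurable]: "f \<in> borel_measurable borel"
  shows "Ssq f x = (SUP j. Ssq_trunc f (- int j) x)"
proof -
  let ?h = "\<lambda>j q. dens f q * indicator {q. dist x (fst q) < snd q \<and> snd q \<le> side (- int j)} q"
  have meas: "?h j \<in> borel_measurable (\<mu> \<Otimes>\<^sub>M lborel)" for j
  proof -
    have "(\<lambda>q. dens f q * (if dist x (fst q) < snd q \<and> snd q \<le> side (- int j) then 1 else 0)) \<in> borel_measurable (\<mu> \<Otimes>\<^sub>M lborel)"
      by measurable
    then show ?thesis by (simp add: indicator_def)
  qed
  have inc: "incseq ?h"
  proof (rule incseq_SucI, rule le_funI)
    fix j q
    have "side (- int j) \<le> side (- int (Suc j))" by (intro side_antimono) simp
    then show "?h j q \<le> ?h (Suc j) q" by (auto simp: indicator_def)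
  qed
  have "Ssq f x = (\<integral>\<^sup>+q. (SUP j. ?h j q) \<partial>(\<mu> \<Otimes>\<^sub>M lborel))"
    unfolding Ssq_def
  proof (rule nn_integral_cong, rule antisym)
    fix q :: "(real^'n) \<times> real"
    obtain j0 where "\<forall>j\<ge>j0. snd q \<le> side (0 - int j)" using side_LIMSEQ_ancestors by blast
    then have "snd q \<le> side (- int j0)" by simp
    then have "dens f q * indicator {q. dist x (fst q) < snd q} q = ?h j0 q" by (auto simp: indicator_def)
    also have "\<dots> \<le> (SUP j. ?h j q)" by (rule SUP_upper) simp
    finally show "dens f q * indicator {q. dist x (fst q) < snd q} q \<le> (SUP j. ?h j q)" .
    show "(SUP j. ?h j q) \<le> dens f q * indicator {q. dist x (fst q) < snd q} q"
      by (rule SUP_least) (auto simp: indicator_def)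
  qed
  also have "\<dots> = (SUP j. \<integral>\<^sup>+q. ?h j q \<partial>(\<mu> \<Otimes>\<^sub>M lborel))"
    by (rule nn_integral_monotone_convergence_SUP[OF inc meas])
  finally show ?thesis unfolding Ssq_trunc_def .
qed

end

context conical_weight_function
begin

abbreviation V where "V \<equiv> ennreal (cell_const p * Aw powr (p / r)) * X f"

lemma cell_bound:
  assumes nz: "(\<integral>\<^sup>+x. ennreal (norm (f x)) \<partial>\<mu>) \<noteq> 0"
  shows "(\<integral>\<^sup>+x. epowr (Dsq f k0 x) (p / 2) * indicator (cell k0 x0) x * ennreal (w x) \<partial>\<mu>) \<le> V"
proof -
  have h: "0 < p / 2" using p by simp
  let ?h = "\<lambda>J x. epowr (\<Sum>i<J. energy f (k0 + int i) x) (p / 2) * (indicator (cell k0 x0) x * ennreal (w x))"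
  have inc: "incseq ?h"
    using h by (intro incseq_SucI le_funI mult_right_mono epowr_mono sum_mono2) auto
  have "(\<integral>\<^sup>+x. epowr (Dsq f k0 x) (p / 2) * indicator (cell k0 x0) x * ennreal (w x) \<partial>\<mu>) = (\<integral>\<^sup>+x. (SUP J. ?h J x) \<partial>\<mu>)"
    unfolding Dsq_def suminf_eq_SUP epowr_SUP[OF h]
    by (simp only: SUP_mult_right_ennreal[symmetric] mult.assoc)
  also have "\<dots> = (SUP J. \<integral>\<^sup>+x. ?h J x \<partial>\<mu>)"
    by (rule nn_integral_monotone_convergence_SUP[OF inc]) measurable
  also have "\<dots> \<le> V"
  proof (rule SUP_least)
    fix J
    have "(\<integral>\<^sup>+x. ?h J x \<partial>\<mu>) \<le> (\<integral>\<^sup>+x. epowr (\<Sum>i\<le>J. energy f (k0 + int i) x) (p / 2) * indicator (cell k0 x0) x * ennreal (w x) \<partial>\<mu>)"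
      unfolding mult.assoc using h by (intro nn_integral_mono mult_right_mono epowr_mono sum_mono2) auto
    also have "\<dots> \<le> V" by (rule cell_bound_truncated[OF nz])
    finally show "(\<integral>\<^sup>+x. ?h J x \<partial>\<mu>) \<le> V" .
  qed
  finally show ?thesis .
qed

text \<open>The ancestors of a cell fill no more than an orthant, but the \<open>2\<^sup>n\<close> cells around the origin do so together.\<close>

lemma integrable_bound:
  "(\<integral>\<^sup>+x. epowr (Ssq f x) (p / 2) * ennreal (w x) \<partial>\<mu>) \<le> ennreal (2 ^ n) * V"
proof (cases "(\<integral>\<^sup>+x. ennreal (norm (f x)) \<partial>\<mu>) = 0")
  case True
  have "Ssq f x = 0" for x by (rule Ssq_eq_0[OF f_borel True])
  then show ?thesis using p by simp
next
  case nz: False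
  have h: "0 < p / 2" using p by simp
  define Z :: "(int^'n) set" where "Z = (\<lambda>g. \<chi> i. g i) ` (UNIV \<rightarrow>\<^sub>E {-1, 0})"
  have finZ: "finite Z" unfolding Z_def by (intro finite_imageI finite_PiE) auto
  have cardZ: "card Z \<le> 2 ^ n"
  proof -
    have "card Z \<le> card ((UNIV :: 'n set) \<rightarrow>\<^sub>E {-1, 0 :: int})" unfolding Z_def by (intro card_image_le finite_PiE) auto
    also have "\<dots> = 2 ^ n" by (subst card_PiE) (auto simp: n numeral_2_eq_2)
    finally show ?thesis .
  qed
  define U :: "nat \<Rightarrow> (real^'n) set" where "U = (\<lambda>j. {x. \<forall>i. - side (- int j) \<le> x $ i \<and> x $ i < side (- int j)})"
  have U_meas [measurable]: "U j \<in> sets borel" for j unfolding U_def by measurable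
  have UZ: "idx (- int j) x \<in> Z" if "x \<in> U j" for x j
  proof -
    have "idx (- int j) x $ i \<in> {-1, 0}" for i
    proof -
      have "- 1 \<le> x $ i / side (- int j)" "x $ i / side (- int j) < 1"
        using that by (auto simp: U_def pos_le_divide_eq pos_divide_less_eq)
      moreover have "idx (- int j) x $ i = \<lfloor>x $ i / side (- int j)\<rfloor>" by (simp add: idx_def)
      ultimately have "idx (- int j) x $ i = -1 \<or> idx (- int j) x $ i = 0" by linarith
      then show ?thesis by blast
    qed
    then show ?thesis unfolding Z_def by (intro image_eqI[of _ _ "\<lambda>i. idx (- int j) x $ i"]) auto
  qed
  define H where "H = (\<lambda>j x. epowr (Ssq_trunc f (- int j) x) (p / 2) * (indicator (U j) x * ennreal (w x)))"
  have U_mono: "U j \<subseteq> U (Suc j)" for j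
  proof
    fix x assume x: "x \<in> U j"
    have le: "side (- int j) \<le> side (- int (Suc j))" by (intro side_antimono) simp
    show "x \<in> U (Suc j)"
      unfolding U_def
    proof (intro CollectI allI)
      fix i
      have "- side (- int j) \<le> x $ i \<and> x $ i < side (- int j)" using x by (simp add: U_def)
      then show "- side (- int (Suc j)) \<le> x $ i \<and> x $ i < side (- int (Suc j))" using le by linarith
    qed
  qed
  have inc: "incseq H"
    unfolding H_def using h U_mono
    by (intro incseq_SucI le_funI mult_mono epowr_mono Ssq_trunc_mono) (auto simp: indicator_def)
  have "(\<integral>\<^sup>+x. epowr (Ssq f x) (p / 2) * ennreal (w x) \<partial>\<mu>) \<le> (\<integral>\<^sup>+x. (SUP j. H j x) \<partial>\<mu>)"
  proof (rule nn_integral_mono)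
    fix x
    have "epowr (Ssq f x) (p / 2) * ennreal (w x) = (SUP j. epowr (Ssq_trunc f (- int j) x) (p / 2) * ennreal (w x))"
      unfolding Ssq_eq_SUP[OF f_borel] epowr_SUP[OF h] by (rule SUP_mult_right_ennreal)
    also have "\<dots> \<le> (SUP j. H j x)"
    proof (rule SUP_least)
      fix j
      obtain j0 where j0: "\<forall>j\<ge>j0. norm x + 1 \<le> side (0 - int j)" using side_LIMSEQ_ancestors by blast
      let ?J = "max j j0"
      have "norm x + 1 \<le> side (- int ?J)" using j0[rule_format, of ?J] by simp
      then have "x \<in> U ?J"
        unfolding U_def using component_le_norm_cart[of x] by (auto simp: abs_le_iff) (smt (verit))+
      moreover have "Ssq_trunc f (- int j) x \<le> Ssq_trunc f (- int ?J) x" by (intro Ssq_trunc_mono) simp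
      ultimately have "epowr (Ssq_trunc f (- int j) x) (p / 2) * ennreal (w x) \<le> H ?J x"
        unfolding H_def using h by (simp add: epowr_mono mult_right_mono)
      also have "\<dots> \<le> (SUP j. H j x)" by (rule SUP_upper) simp
      finally show "epowr (Ssq_trunc f (- int j) x) (p / 2) * ennreal (w x) \<le> (SUP j. H j x)" .
    qed
    finally show "epowr (Ssq f x) (p / 2) * ennreal (w x) \<le> (SUP j. H j x)" .
  qed
  also have "\<dots> = (SUP j. \<integral>\<^sup>+x. H j x \<partial>\<mu>)"
    by (rule nn_integral_monotone_convergence_SUP[OF inc]) (unfold H_def, measurable)
  also have "\<dots> \<le> ennreal (2 ^ n) * V"
  proof (rule SUP_least)
    fix j
    let ?c = "\<lambda>z. cell (- int j) (corner (- int j) z)"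
    have "(\<integral>\<^sup>+x. H j x \<partial>\<mu>) \<le> (\<integral>\<^sup>+x. (\<Sum>z\<in>Z. epowr (Dsq f (- int j) x) (p / 2) * indicator (?c z) x * ennreal (w x)) \<partial>\<mu>)"
    proof (rule nn_integral_mono)
      fix x
      show "H j x \<le> (\<Sum>z\<in>Z. epowr (Dsq f (- int j) x) (p / 2) * indicator (?c z) x * ennreal (w x))"
      proof (cases "x \<in> U j")
        case True
        let ?z = "idx (- int j) x"
        have "Ssq_trunc f (- int j) x \<le> Dsq f (- int j) x"
          unfolding Ssq_trunc_def by (rule Ssq_truncated_le_Dsq[OF f_borel])
        then have "H j x \<le> epowr (Dsq f (- int j) x) (p / 2) * indicator (?c ?z) x * ennreal (w x)"
          unfolding H_def using h True by (simp add: epowr_mono mult_right_mono cell_def)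
        also have "\<dots> \<le> (\<Sum>z\<in>Z. epowr (Dsq f (- int j) x) (p / 2) * indicator (?c z) x * ennreal (w x))"
          using UZ[OF True] finZ by (intro member_le_sum) auto
        finally show ?thesis .
      qed (simp add: H_def)
    qed
    also have "\<dots> = (\<Sum>z\<in>Z. \<integral>\<^sup>+x. epowr (Dsq f (- int j) x) (p / 2) * indicator (?c z) x * ennreal (w x) \<partial>\<mu>)"
      by (rule nn_integral_sum) measurable
    also have "\<dots> \<le> (\<Sum>z\<in>Z. V)" by (intro sum_mono cell_bound nz)
    also have "\<dots> = of_nat (card Z) * V" by simp
    also have "\<dots> \<le> of_nat (2 ^ n) * V" using cardZ by (intro mult_right_mono of_nat_mono) auto
    also have "(of_nat (2 ^ n) :: ennreal) = ennreal (2 ^ n)" by (simp add: ennreal_of_nat_eq_real_of_nat)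
    finally show "(\<integral>\<^sup>+x. H j x \<partial>\<mu>) \<le> ennreal (2 ^ n) * V" .
  qed
  finally show ?thesis .
qed

end

context conical_weight
begin

lemma dual_weight_finite:
  "(\<integral>\<^sup>+y. ennreal (w y powr (- 1 / (p - 1))) * indicator (triple k x) y \<partial>\<mu>) < \<infinity>"
proof (rule Ap_dual_finite[OF Ap _ triple_finite p])
  show "0 < (\<integral>\<^sup>+y. ennreal (w y) * indicator (triple k x) y \<partial>\<mu>)"
  proof (rule ccontr)
    assume "\<not> ?thesis"
    then have "AE y in \<mu>. ennreal (w y) * indicator (triple k x) y = 0" by (simp add: nn_integral_0_iff_AE)
    then have "AE y in \<mu>. y \<notin> triple k x"
      by eventually_elim (use wpos[THEN not_le[THEN iffD2]] in \<open>auto simp: indicator_def ennreal_eq_0_iff split: if_splits\<close>)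
    then have "emeasure \<mu> (triple k x) = 0"
      using AE_iff_measurable[of "triple k x" \<mu> "\<lambda>y. y \<notin> triple k x"] by auto
    then show False using triple_pos[of k x] by simp
  qed
qed

text \<open>The truncations of \<open>f\<close> to balls are integrable by Hoelder's inequality, as the dual weight is locally
  integrable, and Fatou's lemma removes the truncation.\<close>

lemma weighted_bound:
  assumes [measurable]: "f \<in> borel_measurable borel" and X: "X f < \<infinity>"
  shows "(\<integral>\<^sup>+x. epowr (Ssq f x) (p / 2) * ennreal (w x) \<partial>\<mu>)
    \<le> ennreal (2 ^ n * cell_const p * Aw powr (p / r)) * X f"
proof -
  let ?f = "\<lambda>j z. f z * indicator (cball 0 (real j)) z"
  let ?C = "ennreal (2 ^ n * cell_const p * Aw powr (p / r))"
  have h: "0 < p / 2" using p by simp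
  have bound: "(\<integral>\<^sup>+x. epowr (Ssq (?f j) x) (p / 2) * ennreal (w x) \<partial>\<mu>) \<le> ?C * X f" for j
  proof -
    have XX: "X (?f j) \<le> X f"
      using p by (intro nn_integral_mono mult_right_mono epowr_mono) (auto simp: indicator_def)
    obtain i where "\<forall>i'\<ge>i. real j \<le> side (0 - int i')" using side_LIMSEQ_ancestors by blast
    then have i: "real j \<le> side (0 - int i)" by blast
    have sub: "cball 0 (real j) \<subseteq> triple (0 - int i) (0 :: real^'n)"
    proof
      fix y :: "real^'n" assume "y \<in> cball 0 (real j)"
      then have "\<bar>y $ a - 0 $ a\<bar> \<le> side (0 - int i)" for a
        using component_le_norm_cart[of y a] i by simp
      then show "y \<in> triple (0 - int i) 0" by (rule mem_triple_of_near)
    qed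
    have "(\<integral>\<^sup>+x. ennreal (norm (?f j x)) \<partial>\<mu>) \<le> (\<integral>\<^sup>+x. ennreal (norm (f x)) * indicator (triple (0 - int i) 0) x \<partial>\<mu>)"
      using sub by (intro nn_integral_mono) (auto simp: indicator_def)
    also have "\<dots> \<le> epowr (X f) (1 / p) * epowr (\<integral>\<^sup>+y. ennreal (w y powr (- 1 / (p - 1))) * indicator (triple (0 - int i) 0) y \<partial>\<mu>) (1 - 1 / p)"
      using wpos p by (intro weighted_Hoelder) auto
    also have "\<dots> < \<infinity>"
    proof -
      obtain x where x: "X f = ennreal x" "0 \<le> x" using X by (cases "X f") auto
      obtain y where y: "(\<integral>\<^sup>+y. ennreal (w y powr (- 1 / (p - 1))) * indicator (triple (0 - int i) 0) y \<partial>\<mu>) = ennreal y" "0 \<le> y"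
        using dual_weight_finite[of "0 - int i" 0]
        by (cases "\<integral>\<^sup>+y. ennreal (w y powr (- 1 / (p - 1))) * indicator (triple (0 - int i) 0) y \<partial>\<mu>") auto
      show ?thesis unfolding x y using p x y by (simp add: epowr_ennreal flip: ennreal_mult)
    qed
    finally have "integrable \<mu> (?f j)" by (intro integrableI_bounded) auto
    then interpret F: conical_weight_function \<mu> s m \<alpha> C\<^sub>\<mu> C\<^sub>s C\<^sub>d C\<^sub>w n w p Aw "?f j"
      by unfold_locales (use XX X in \<open>auto intro: le_less_trans\<close>)
    have "(\<integral>\<^sup>+x. epowr (Ssq (?f j) x) (p / 2) * ennreal (w x) \<partial>\<mu>) \<le> ennreal (2 ^ n) * (ennreal (cell_const p * Aw powr (p / r)) * X (?f j))"
      by (rule F.integrable_bound)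
    also have "\<dots> \<le> ennreal (2 ^ n) * (ennreal (cell_const p * Aw powr (p / r)) * X f)"
      by (intro mult_left_mono XX) auto
    also have "\<dots> = ?C * X f"
      using cell_const_nonneg[of p] by (simp add: ennreal_mult mult.assoc)
    finally show ?thesis .
  qed
  have "(\<integral>\<^sup>+x. epowr (Ssq f x) (p / 2) * ennreal (w x) \<partial>\<mu>)
    \<le> (\<integral>\<^sup>+x. liminf (\<lambda>j. epowr (Ssq (?f j) x) (p / 2) * ennreal (w x)) \<partial>\<mu>)"
  proof (rule nn_integral_mono)
    fix x
    have "epowr (Ssq f x) (p / 2) * ennreal (w x) \<le> epowr (liminf (\<lambda>j. Ssq (?f j) x)) (p / 2) * ennreal (w x)"
      using h by (intro mult_right_mono epowr_mono Ssq_le_liminf) auto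
    also have "\<dots> \<le> liminf (\<lambda>j. epowr (Ssq (?f j) x) (p / 2) * ennreal (w x))" by (rule epowr_liminf_mult_le[OF h])
    finally show "epowr (Ssq f x) (p / 2) * ennreal (w x) \<le> \<dots>" .
  qed
  also have "\<dots> \<le> liminf (\<lambda>j. \<integral>\<^sup>+x. epowr (Ssq (?f j) x) (p / 2) * ennreal (w x) \<partial>\<mu>)"
    by (rule nn_integral_liminf) measurable
  also have "\<dots> \<le> ?C * X f" by (rule liminf_le_const) (rule bound)
  finally show ?thesis .
qed

lemma Lp_norm_bound:
  assumes f: "f \<in> borel_measurable borel" and X: "X f < \<infinity>"
  shows "Lp_norm \<mu> w p (conical_S \<mu> m s f)
    \<le> ennreal (weighted_const p) * ennreal (Aw powr (1 / r)) * Lp_norm \<mu> w p (\<lambda>x. ennreal (norm (f x)))"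
proof -
  have p0: "0 < p" "0 < 1 / p" using p by auto
  have S: "epowr (conical_S \<mu> m s f x) p = epowr (Ssq f x) (p / 2)" for x
    unfolding conical_S_eq using p by (subst epowr_epowr) auto
  have "Lp_norm \<mu> w p (conical_S \<mu> m s f) = epowr (\<integral>\<^sup>+x. epowr (Ssq f x) (p / 2) * ennreal (w x) \<partial>\<mu>) (1 / p)"
    by (simp add: Lp_norm_def S)
  also have "\<dots> \<le> epowr (ennreal (2 ^ n * cell_const p * Aw powr (p / r)) * X f) (1 / p)"
    by (intro epowr_mono weighted_bound f X p0)
  also have "\<dots> = ennreal ((2 ^ n * cell_const p * Aw powr (p / r)) powr (1 / p)) * epowr (X f) (1 / p)"
    using p0 cell_const_nonneg[of p] by (simp add: epowr_mult epowr_ennreal)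
  also have "(2 ^ n * cell_const p * Aw powr (p / r)) powr (1 / p) = weighted_const p * Aw powr (1 / r)"
    using p0 cell_const_nonneg[of p] by (simp add: weighted_const_def powr_mult powr_powr)
  finally show ?thesis by (simp add: Lp_norm_def ennreal_mult weighted_const_def)
qed

end

section \<open>The theorem\<close>

text \<open>If \<open>w\<close> is nontrivial, then it has positive mass on all large cubes. There a finite characteristic forces
  the dual weight to be integrable, and the dual weight is infinite where \<open>w\<close> vanishes.\<close>

lemma (in conical) weight_positive_AE:
  assumes w [measurable]: "w \<in> borel_measurable borel" and w0: "\<And>x. 0 \<le> w x"
    and A: "Ap_char \<mu> p w < \<infinity>" and p: "1 < p" and nz: "\<not> (AE x in \<mu>. w x = 0)"
  shows "AE x in \<mu>. 0 < w x"
proof -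
  let ?T = "\<lambda>j. triple (0 - int j) (0 :: real^'n)"
  let ?W = "\<lambda>j. \<integral>\<^sup>+x. ennreal (w x) * indicator (?T j) x \<partial>\<mu>"
  let ?S = "\<lambda>j. \<integral>\<^sup>+x. epowr (ennreal (w x)) (- 1 / (p - 1)) * indicator (?T j) x \<partial>\<mu>"
  have "\<exists>j0. ?W j0 \<noteq> 0"
  proof (rule ccontr)
    assume "\<not> ?thesis"
    then have "AE x in \<mu>. ennreal (w x) * indicator (?T j) x = 0" for j
      by (subst nn_integral_0_iff_AE[symmetric]) auto
    then have "AE x in \<mu>. \<forall>j. ennreal (w x) * indicator (?T j) x = 0"
      unfolding AE_all_countable by (rule allI)
    then have "AE x in \<mu>. w x = 0"
    proof eventually_elim
      case (elim x)
      obtain j where "x \<in> ?T j" using mem_triple_ancestor[of x 0 0] by blast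
      then have "ennreal (w x) = 0" using elim[rule_format, of j] by simp
      then show ?case using w0[of x] by (simp add: ennreal_eq_0_iff)
    qed
    then show False using nz by simp
  qed
  then obtain j0 where j0: "?W j0 \<noteq> 0" by blast
  have "AE x in \<mu>. x \<in> ?T (j0 + j) \<longrightarrow> w x \<noteq> 0" for j
  proof -
    have "?T j0 \<subseteq> ?T (j0 + j)" by (rule triple_mono) simp
    then have "?W j0 \<le> ?W (j0 + j)" by (intro nn_integral_mono) (auto simp: indicator_def)
    then have W: "0 < ?W (j0 + j)" using j0 by (auto simp: zero_less_iff_neq_zero)
    obtain a where a: "Ap_char \<mu> p w = ennreal a" using A by (cases "Ap_char \<mu> p w") auto
    have "?W (j0 + j) / emeasure \<mu> (?T (j0 + j)) * epowr (?S (j0 + j) / emeasure \<mu> (?T (j0 + j))) (p - 1) \<le> Ap_char \<mu> p w"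
      unfolding Ap_char_def by (rule SUP_upper[OF triple_in_cubes])
    then have "?S (j0 + j) < \<infinity>" unfolding a by (rule Ap_dual_finite[OF _ W triple_finite p])
    then have "AE x in \<mu>. epowr (ennreal (w x)) (- 1 / (p - 1)) * indicator (?T (j0 + j)) x \<noteq> \<infinity>"
      by (intro nn_integral_noteq_infinite) auto
    then show ?thesis
      by eventually_elim (use p in \<open>auto simp: epowr_def\<close>)
  qed
  then have "AE x in \<mu>. \<forall>j. x \<in> ?T (j0 + j) \<longrightarrow> w x \<noteq> 0"
    unfolding AE_all_countable by (rule allI)
  then show ?thesis
  proof eventually_elim
    case (elim x)
    obtain i where i: "\<forall>j\<ge>i. x \<in> ?T j" using mem_triple_ancestor[of x 0 0] by blast
    have "x \<in> ?T (j0 + i)" by (rule i[rule_format]) simp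
    then show ?case using elim w0[of x] by (auto simp: less_le)
  qed
qed

theorem theorem1p8:
  fixes m \<alpha> p C\<^sub>\<mu> C\<^sub>s C\<^sub>c C\<^sub>d C\<^sub>w :: real
  assumes "0 < m" and "0 < \<alpha>" and "1 < p"
  shows "\<exists>C\<ge>0. \<forall>(\<mu> :: (real^'n) measure) (s :: real \<Rightarrow> real^'n \<Rightarrow> real^'n \<Rightarrow> complex).
    sets \<mu> = sets borel \<and>
    power_bound \<mu> m C\<^sub>\<mu> \<and>
    measurable_kernel s \<and>
    size_condition s m \<alpha> C\<^sub>s \<and>
    continuity_condition s m \<alpha> C\<^sub>c \<and>
    doubling \<mu> C\<^sub>d \<and>
    weak_type_1_1 \<mu> (conical_S \<mu> m s) C\<^sub>w
    \<longrightarrow>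
    (\<forall>w f. is_weight \<mu> w \<and> Ap_char \<mu> p w < \<infinity> \<and>
           f \<in> borel_measurable \<mu> \<and> Lp_norm \<mu> w p (\<lambda>x. ennreal (norm (f x))) < \<infinity>
       \<longrightarrow>
       Lp_norm \<mu> w p (conical_S \<mu> m s f)
         \<le> ennreal C * epowr (Ap_char \<mu> p w) (max (1 / 2) (1 / (p - 1)))
             * Lp_norm \<mu> w p (\<lambda>x. ennreal (norm (f x :: complex))))"
proof -
  define C where "C = max 0 (conical.weighted_const m \<alpha> (max 0 C\<^sub>\<mu>) (max 0 C\<^sub>s) (max 0 C\<^sub>d) (max 0 C\<^sub>w) CARD('n) p)"
  have main: "Lp_norm \<mu> w p (conical_S \<mu> m s f)
         \<le> ennreal C * epowr (Ap_char \<mu> p w) (max (1 / 2) (1 / (p - 1)))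
             * Lp_norm \<mu> w p (\<lambda>x. ennreal (norm (f x)))"
    if sets: "sets \<mu> = sets borel" and hyps: "power_bound \<mu> m C\<^sub>\<mu>" "measurable_kernel s" "size_condition s m \<alpha> C\<^sub>s"
        "doubling \<mu> C\<^sub>d" "weak_type_1_1 \<mu> (conical_S \<mu> m s) C\<^sub>w"
      and w: "is_weight \<mu> w" and A: "Ap_char \<mu> p w < \<infinity>" and f: "f \<in> borel_measurable \<mu>"
      and fin: "Lp_norm \<mu> w p (\<lambda>x. ennreal (norm (f x))) < \<infinity>"
    for \<mu> :: "(real^'n) measure" and s :: "real \<Rightarrow> real^'n \<Rightarrow> real^'n \<Rightarrow> complex" and w and f :: "real^'n \<Rightarrow> complex"
  proof -
    have enn: "ennreal (max 0 x) = ennreal x" for x :: real by (cases "0 \<le> x") (auto simp: max_def ennreal_neg)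
    have "power_bound \<mu> m (max 0 C\<^sub>\<mu>)"
      unfolding power_bound_def
    proof (intro allI impI)
      fix x :: "real^'n" and r :: real assume "0 < r"
      then have "emeasure \<mu> (ball x r) \<le> ennreal (C\<^sub>\<mu> * r powr m)" using hyps(1) unfolding power_bound_def by blast
      also have "\<dots> \<le> ennreal (max 0 C\<^sub>\<mu> * r powr m)" by (intro ennreal_leI mult_right_mono) auto
      finally show "emeasure \<mu> (ball x r) \<le> ennreal (max 0 C\<^sub>\<mu> * r powr m)" .
    qed
    moreover have "size_condition s m \<alpha> (max 0 C\<^sub>s)"
      unfolding size_condition_def
    proof (intro allI impI)
      fix t :: real and x y :: "real^'n" assume "0 < t"
      then have "norm (s t x y) \<le> C\<^sub>s * (t powr \<alpha> / (t + dist x y) powr (m + \<alpha>))"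
        using hyps(3) unfolding size_condition_def by blast
      also have "\<dots> \<le> max 0 C\<^sub>s * (t powr \<alpha> / (t + dist x y) powr (m + \<alpha>))" by (intro mult_right_mono) auto
      finally show "norm (s t x y) \<le> max 0 C\<^sub>s * (t powr \<alpha> / (t + dist x y) powr (m + \<alpha>))" .
    qed
    moreover have "doubling \<mu> (max 0 C\<^sub>d)" using hyps(4) by (simp add: doubling_def enn)
    moreover have "weak_type_1_1 \<mu> (conical_S \<mu> m s) (max 0 C\<^sub>w)" using hyps(5) by (simp add: weak_type_1_1_def enn)
    ultimately interpret conical \<mu> s m \<alpha> "max 0 C\<^sub>\<mu>" "max 0 C\<^sub>s" "max 0 C\<^sub>d" "max 0 C\<^sub>w" "CARD('n)"
      using assms sets hyps(2) by unfold_locales auto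
    have C: "C = weighted_const p" by (simp add: C_def weighted_const_def)
    have fb [measurable]: "f \<in> borel_measurable borel" and wb [measurable]: "w \<in> borel_measurable borel"
      using f w by (simp_all add: is_weight_def measurable_cong_sets[OF sets])
    have w0: "0 \<le> w x" for x using w by (simp add: is_weight_def)
    show ?thesis
    proof (cases "AE x in \<mu>. w x = 0")
      case True
      then have "AE x in \<mu>. epowr (conical_S \<mu> m s f x) p * ennreal (w x) = 0" by eventually_elim simp
      then have "(\<integral>\<^sup>+x. epowr (conical_S \<mu> m s f x) p * ennreal (w x) \<partial>\<mu>) = (\<integral>\<^sup>+x. 0 \<partial>\<mu>)"
        by (rule nn_integral_cong_AE)
      then show ?thesis using assms(3) by (simp add: Lp_norm_def)
    next
      case False
      have pos: "AE x in \<mu>. 0 < w x" by (rule weight_positive_AE[OF wb w0 A assms(3) False])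
      \<comment> \<open>the value 1 on the null set where the weight vanishes makes it positive everywhere\<close>
      define w' where "w' = (\<lambda>x. if 0 < w x then w x else 1)"
      have w'_eq: "AE x in \<mu>. w x = w' x" using pos by eventually_elim (simp add: w'_def)
      have w'_meas [measurable]: "w' \<in> borel_measurable borel" unfolding w'_def by measurable
      obtain a where a: "Ap_char \<mu> p w = ennreal a" "0 \<le> a" using A by (cases "Ap_char \<mu> p w") auto
      have W: "(\<integral>\<^sup>+y. ennreal (w' y) * indicator Q y \<partial>\<mu>) = (\<integral>\<^sup>+y. ennreal (w y) * indicator Q y \<partial>\<mu>)" for Q
        by (rule nn_integral_cong_AE) (use w'_eq in \<open>eventually_elim, simp\<close>)
      have S: "(\<integral>\<^sup>+y. ennreal (w' y powr (- 1 / (p - 1))) * indicator Q y \<partial>\<mu>)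
        = (\<integral>\<^sup>+y. epowr (ennreal (w y)) (- 1 / (p - 1)) * indicator Q y \<partial>\<mu>)" for Q
        by (rule nn_integral_cong_AE) (use pos in \<open>eventually_elim, simp add: w'_def epowr_ennreal_pos\<close>)
      interpret conical_weight \<mu> s m \<alpha> "max 0 C\<^sub>\<mu>" "max 0 C\<^sub>s" "max 0 C\<^sub>d" "max 0 C\<^sub>w" "CARD('n)" w' p a
      proof unfold_locales
        show "(\<integral>\<^sup>+y. ennreal (w' y) * indicator (triple k x) y \<partial>\<mu>) < \<infinity>" for k x
        proof -
          have "set_integrable \<mu> (triple k x) w" using w by (auto simp: is_weight_def triple_def)
          then have "(\<integral>\<^sup>+y. ennreal (norm (indicator (triple k x) y *\<^sub>R w y)) \<partial>\<mu>) < \<infinity>"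
            unfolding set_integrable_def by (simp add: integrable_iff_bounded)
          also have "(\<integral>\<^sup>+y. ennreal (norm (indicator (triple k x) y *\<^sub>R w y)) \<partial>\<mu>) = (\<integral>\<^sup>+y. ennreal (w y) * indicator (triple k x) y \<partial>\<mu>)"
            by (rule nn_integral_cong) (use w0 in \<open>auto simp: indicator_def\<close>)
          finally show ?thesis unfolding W .
        qed
        show "(\<integral>\<^sup>+y. ennreal (w' y) * indicator (triple k x) y \<partial>\<mu>) / emeasure \<mu> (triple k x) *
          epowr ((\<integral>\<^sup>+y. ennreal (w' y powr (- 1 / (p - 1))) * indicator (triple k x) y \<partial>\<mu>) / emeasure \<mu> (triple k x)) (p - 1) \<le> ennreal a" for k x
          unfolding W S a(1)[symmetric] Ap_char_def by (rule SUP_upper[OF triple_in_cubes])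
      qed (use assms a w'_meas in \<open>auto simp: w'_def\<close>)
      have Lp: "Lp_norm \<mu> w p g = Lp_norm \<mu> w' p g" for g
        unfolding Lp_norm_def
        by (rule arg_cong[where f = "\<lambda>z. epowr z (1 / p)"], rule nn_integral_cong_AE)
          (use w'_eq in \<open>eventually_elim, simp\<close>)
      have "X f < \<infinity>"
      proof (rule ccontr)
        assume "\<not> ?thesis"
        then have "X f = top" by (simp add: not_less top_unique)
        then have "Lp_norm \<mu> w' p (\<lambda>x. ennreal (norm (f x))) = top" using assms(3) by (simp add: Lp_norm_def)
        then show False using fin unfolding Lp by simp
      qed
      from Lp_norm_bound[OF fb this]
      have "Lp_norm \<mu> w p (conical_S \<mu> m s f) \<le> ennreal C * ennreal (a powr (1 / r)) * Lp_norm \<mu> w p (\<lambda>x. ennreal (norm (f x)))"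
        unfolding Lp C .
      also have "ennreal (a powr (1 / r)) = epowr (Ap_char \<mu> p w) (max (1 / 2) (1 / (p - 1)))"
      proof -
        have "1 / r = max (1 / 2) (1 / (p - 1))"
          using assms(3) by (auto simp: r_def min_def max_def field_simps)
        then show ?thesis using a by (simp add: epowr_ennreal less_max_iff_disj)
      qed
      finally show ?thesis .
    qed
  qed
  have "0 \<le> C" by (simp add: C_def)
  then show ?thesis using main by blast
qed

end
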